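(* Let $g\ge 4$ be an even integer, let $n$ be a positive integer, and let $A\in\mathbb{R}_{\ge 0}^{n\times n}$ be a nonnegative matrix whose support graph $G_A$ has girth at least $g$. Then $$\operatorname{Bethe}(A)\le \operatorname{per}(A)\le 2^{2n/g}\operatorname{Bethe}(A).$$ Moreover, whenever $g\mid 2n$, the upper bound is attained by the $0$–$1$ matrices whose support graphs are disjoint unions of cycles of length $g$; that is, for every $n\times n$ matrix $A$ with entries in $\{0,1\}$ whose support graph is a disjoint union of cycles of length $g$ (covering all $2n$ vertices), $\operatorname{per}(A)=2^{2n/g}\operatorname{Bethe}(A)$.
   Context: For $A\in\mathbb{R}^{n\times n}$, $\operatorname{per}(A)=\sum_{\sigma\in\operatorname{Sym}(n)}\prod_{i=1}^n A_{i,\sigma(i)}$, where $\operatorname{Sym}(n)$ is the set of permutations of $[n]=\{1,\dots,n\}$. The support graph $G_A=(L\sqcup R,E)$ is the bipartite graph in which $L$ and $R$ are disjoint copies of $[n]$, and $i\in L$, $j\in R$ are joined by an edge $ij$ if and only if $A_{ij}\neq 0$. For $e=ij\in E$ write $A_e:=A_{ij}$. The girth of a graph is the length of its shortest cycle; forests have infinite girth. For a bipartite graph $G$, the fractional perfect matching polytope is $$\operatorname{PM}(G)=\Big\{\mathbf p\in\mathbb{R}_{\ge 0}^{E(G)}:\ \sum_{e\ni v}p_e=1\text{ for every }v\in V(G)\Big\}.$$ The Bethe permanent of a nonnegative matrix $A$ is $\operatorname{Bethe}(A)=0$ if $\operatorname{PM}(G_A)=\emptyset$, and otherwise $$\operatorname{Bethe}(A)=\max_{\mathbf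 p\in \operatorname{PM}(G_A)}\ \prod_{e\in E(G_A)}\left(\frac{A_e}{p_e}\right)^{p_e}(1-p_e)^{1-p_e},$$ where boundary terms are defined by continuity (so $(A_e/p_e)^{p_e}=1$ when $p_e=0$ and $(1-p_e)^{1-p_e}=1$ when $p_e=1$). *)

theory Defs
  imports "HOL-Analysis.Analysis" "HOL-Library.Extended_Nat"
begin

definition permanent :: "'a::comm_semiring_1 ^ 'n ^ 'n \<Rightarrow> 'a" where
  "permanent A = (\<Sum>\<sigma> | \<sigma> permutes UNIV. \<Prod>i\<in>UNIV. A $ i $ \<sigma> i)"

text \<open>Simple graphs; an edge is a two-element set of vertices.\<close>

record 'v sgraph =
  verts :: "'v set"
  edges :: "'v set set"

text \<open>A cycle is given by its vertices in cyclic order. The length of a cycle is the length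
  of this list, which is also its number of edges.\<close>

definition cycle_edges :: "'v list \<Rightarrow> 'v set set" where
  "cycle_edges c = {{c ! k, c ! (Suc k mod length c)} | k. k < length c}"

definition is_cycle :: "'v sgraph \<Rightarrow> 'v list \<Rightarrow> bool" where
  "is_cycle G c \<longleftrightarrow>
     3 \<le> length c \<and> distinct c \<and> set c \<subseteq> verts G \<and> cycle_edges c \<subseteq> edges G"

text \<open>The infimum of the empty set is \<open>\<infinity>\<close>, the girth of a forest.\<close>

definition girth :: "'v sgraph \<Rightarrow> enat" where
  "girth G = (INF c \<in> {c. is_cycle G c}. enat (length c))"

definition disjoint_union_of_cycles :: "nat \<Rightarrow> 'v sgraph \<Rightarrow> bool" where
  "disjoint_union_of_cycles g G \<longleftrightarrow>
     (\<exists>C. (\<forall>c\<in>C. is_cycle G c \<and> length c = g) \<and>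
          (\<forall>c\<in>C. \<forall>d\<in>C. c \<noteq> d \<longrightarrow> set c \<inter> set d = {}) \<and>
          verts G = (\<Union>c\<in>C. set c) \<and>
          edges G = (\<Union>c\<in>C. cycle_edges c))"

text \<open>The fractional perfect matching polytope. A vector in \<open>\<real>\<^sup>E\<close> is a function that takes the
  value \<^term>\<open>undefined\<close> outside of the edge set.\<close>

definition PM :: "'v sgraph \<Rightarrow> ('v set \<Rightarrow> real) set" where
  "PM G = {p \<in> edges G \<rightarrow>\<^sub>E {0..}. \<forall>v\<in>verts G. (\<Sum>e | e \<in> edges G \<and> v \<in> e. p e) = 1}"

text \<open>In the support graph the row index \<open>i\<close> is the vertex \<^term>\<open>Inl i\<close>, and the column index \<open>j\<close>
  is the vertex \<^term>\<open>Inr j\<close>.\<close>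

definition support_graph :: "real ^ 'n ^ 'n \<Rightarrow> ('n + 'n) sgraph" where
  "support_graph A = \<lparr>verts = UNIV, edges = {{Inl i, Inr j} | i j. A $ i $ j \<noteq> 0}\<rparr>"

definition edge_entry :: "real ^ 'n ^ 'n \<Rightarrow> ('n + 'n) set \<Rightarrow> real" where
  "edge_entry A e = A $ (THE i. Inl i \<in> e) $ (THE j. Inr j \<in> e)"

text \<open>The boundary cases are explicit because \<^term>\<open>0 powr (0 :: real)\<close> is \<open>0\<close> in the library.\<close>

definition bethe_objective :: "real ^ 'n ^ 'n \<Rightarrow> (('n + 'n) set \<Rightarrow> real) \<Rightarrow> real" where
  "bethe_objective A p =
     (\<Prod>e\<in>edges (support_graph A).
        (if p e = 0 then 1 else (edge_entry A e / p e) powr p e) *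
        (if p e = 1 then 1 else (1 - p e) powr (1 - p e)))"

text \<open>The function \<^const>\<open>Max\<close> is only meaningful for finite sets, hence \<^const>\<open>Greatest\<close>.\<close>

definition Bethe :: "real ^ 'n ^ 'n \<Rightarrow> real" where
  "Bethe A =
     (if PM (support_graph A) = {} then 0
      else GREATEST b. b \<in> bethe_objective A ` PM (support_graph A))"

end

theory Submission
  imports Defs "HOL-Real_Asymp.Real_Asymp"
begin

text \<open>
Both inequalities compare the permanent with the objective at one point of the fractional
matching polytope.

For the upper bound, choose a permutation \<open>\<sigma>\<close> at random with probability proportional to
\<open>\<Prod>i. A i (\<sigma> i)\<close> and let \<open>p i j\<close> be the probability of \<open>\<sigma> i = j\<close>. The matrix \<open>p\<close> is a fractional
perfect matching, and the logarithm of the permanent minus the logarithm of the objective at \<open>p\<close>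
is the entropy of \<open>\<sigma>\<close> minus the sum of the local Bethe entropies
\<open>\<Sum>j. - p i j ln (p i j) + (1 - p i j) ln (1 - p i j)\<close> of the rows. Call this difference the
excess; the task is to show that it is at most \<open>(n / m) ln 2\<close> for \<open>m = g / 2\<close>.

Reveal the value of \<open>\<sigma>\<close> in one row \<open>v\<close>. The excess drops by the sum of all \<open>b e\<close> minus the sum of
the \<open>a e\<close> that are not in row \<open>v\<close>, where \<open>a e\<close> and \<open>b e\<close> are the average drops of the entropy
terms of the events that the edge \<open>e\<close> is used and that it is not used. At every vertex
\<open>\<Sum>b \<le> \<Sum>a\<close>, because the local Bethe entropy is concave (\<open>local_ent_superadd\<close>), and
every \<open>b e\<close> is at most the sum of the other \<open>a\<close> at either end of \<open>e\<close> (\<open>drop_edge\<close>). Now sort the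
edges by their distance from \<open>v\<close>. A vertex at distance less than \<open>m\<close> has only one neighbour
closer to \<open>v\<close>, as two of them would close a cycle of length less than \<open>g\<close>. Hence in the first
layers the \<open>b\<close> of a layer are bounded by the \<open>a\<close> of the next layer, and beyond any layer \<open>\<Sum>b \<le> \<Sum>a\<close>.
So the drop of the excess is at most the \<open>b\<close>-sum of any single one of the layers \<open>1, \<dots>, m - 1\<close>, and
\<open>m - 1\<close> times the drop is at most the sum of the \<open>b e\<close> outside of row \<open>v\<close> (\<open>reveal_cost\<close>).

Reveal all rows in a uniformly random order. The left-hand sides telescope to \<open>m - 1\<close> times the
excess, and together with the chain rule for the entropy this bounds \<open>m\<close> times the excess by a
sum over the rows \<open>i\<close> of averages of local entropies of the conditional distributions of \<open>\<sigma> i\<close>.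
Concavity again allows to remember only which columns have been used, not in which order. What is
left depends on the distribution \<open>p i\<close> of a single row: it is twice \<open>row_bound UNIV (p i)\<close>, an average of
entropy terms over subsets with the weights of the Shapley value (\<open>excess_bound\<close>). Finally
\<open>row_bound\<close> is at most \<open>ln 2 / 2\<close>, since merging the two smallest of at least three positive entries does
not decrease it and the case of two entries is the binary entropy (\<open>row_bound_le\<close>).

For the lower bound, let every row choose a column and, independently, every column choose a row.
Summing the weights of all choices gives a product of row sums and column sums, which the
weighted inequality of the arithmetic and geometric means bounds from below. Demand
consistency, that \<open>i\<close> chooses \<open>j\<close> iff \<open>j\<close> chooses \<open>i\<close>, for one entry after the other. As a
function of the two half-edge weights of the new entry the sum is \<open>a + b y + c z + d y z\<close> with
\<open>b c \<le> a d\<close> (\<open>exchange_inequality\<close>), and for such a function a lower bound \<open>K (y z)\<^sup>p\<close> implies the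
lower bound \<open>K p\<^sup>p (1 - p)\<^sup>1\<^sup>-\<^sup>p\<close> for \<open>a + d\<close>, which is what consistency leaves over. When
all entries are treated, the sum is the permanent and the bound is the objective at \<open>p\<close>.

As for equality, in a disjoint union of cycles every row has two entries, so the objective is \<open>1\<close>
everywhere, while each cycle can be matched in two ways independently of the others.
\<close>

section \<open>Superadditivity of the local Bethe entropy\<close>

text \<open>For an event of mass \<open>m\<close> in a space of total mass \<open>M\<close> this is \<open>M\<close> times the entropy term
\<open>- q ln q\<close> of its probability \<open>q = m / M\<close>. Working with masses avoids all conditional
probabilities below; as \<open>ln 0 = 0\<close>, empty events contribute \<open>0\<close>.\<close>

definition ent :: "real \<Rightarrow> real \<Rightarrow> real" where
  "ent M m = m * (ln M - ln m)"

text \<open>Jensen's inequality for the logarithm, by the tangent \<open>ln t \<le> t - 1\<close> taken at the common ratio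
\<open>\<Sum>x / \<Sum>y\<close>.\<close>

lemma log_sum_inequality_general:
  fixes x y :: "'b \<Rightarrow> real"
  assumes "finite B" "\<And>b. b \<in> B \<Longrightarrow> 0 \<le> x b" "\<And>b. b \<in> B \<Longrightarrow> 0 \<le> y b"
    and pos: "\<And>b. b \<in> B \<Longrightarrow> 0 < x b \<Longrightarrow> 0 < y b"
  shows "(\<Sum>b\<in>B. ent (y b) (x b)) \<le> ent (\<Sum>b\<in>B. y b) (\<Sum>b\<in>B. x b)"
proof -
  let ?X = "\<Sum>b\<in>B. x b" and ?Y = "\<Sum>b\<in>B. y b"
  have "0 \<le> ?X" using assms by (intro sum_nonneg) auto
  show ?thesis
  proof (cases "?X = 0")
    case True
    then have "\<And>b. b \<in> B \<Longrightarrow> x b = 0"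
      using assms(1,2) sum_nonneg_eq_0_iff by blast
    then show ?thesis by (simp add: ent_def)
  next
    case False
    with \<open>0 \<le> ?X\<close> have X: "0 < ?X" by simp
    then obtain c where c: "c \<in> B" "0 < x c" by (meson not_le sum_nonpos)
    have "y c \<le> ?Y" using c assms by (intro member_le_sum) auto
    with pos[OF c] have Y: "0 < ?Y" by simp
    have "ent (y b) (x b) \<le> x b * (ln ?Y - ln ?X) + y b * ?X / ?Y - x b" if "b \<in> B" for b
    proof (cases "x b = 0")
      case True
      then show ?thesis using assms(3)[OF that] X Y by (simp add: ent_def)
    next
      case False
      with assms(2)[OF that] pos[OF that] have xy: "0 < x b" "0 < y b" by auto
      have "ln (y b * ?X / (x b * ?Y)) \<le> y b * ?X / (x b * ?Y) - 1"
        using xy X Y by (intro ln_le_minus_one) auto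
      also have "ln (y b * ?X / (x b * ?Y)) = ln (y b) + ln ?X - ln (x b) - ln ?Y"
        using xy X Y by (simp add: ln_mult ln_div)
      finally have "x b * (ln (y b) + ln ?X - ln (x b) - ln ?Y) \<le> x b * (y b * ?X / (x b * ?Y) - 1)"
        using xy by (intro mult_left_mono) auto
      also have "\<dots> = y b * ?X / ?Y - x b"
        using xy by (simp add: field_simps)
      finally show ?thesis by (simp add: ent_def algebra_simps)
    qed
    then have "(\<Sum>b\<in>B. ent (y b) (x b)) \<le> (\<Sum>b\<in>B. x b * (ln ?Y - ln ?X) + y b * ?X / ?Y - x b)"
      by (rule sum_mono)
    also have "\<dots> = ?X * (ln ?Y - ln ?X) + ?Y * ?X / ?Y - ?X"
      by (simp add: sum.distrib sum_subtractf sum_distrib_right sum_divide_distrib)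
    also have "\<dots> = ent ?Y ?X" using Y by (simp add: ent_def)
    finally show ?thesis .
  qed
qed

lemma log_sum_inequality:
  fixes x y :: "'b \<Rightarrow> real"
  assumes "finite B" "\<And>b. b \<in> B \<Longrightarrow> 0 \<le> x b" "\<And>b. b \<in> B \<Longrightarrow> x b \<le> y b"
  shows "(\<Sum>b\<in>B. ent (y b) (x b)) \<le> ent (\<Sum>b\<in>B. y b) (\<Sum>b\<in>B. x b)"
  using assms by (intro log_sum_inequality_general) force+

definition xlx :: "real \<Rightarrow> real" where
  "xlx x = x * ln x"

text \<open>Minus the entropy of a two-point space with masses \<open>a\<close> and \<open>a'\<close>. It is positively homogeneous
and subadditive as a function of the vector \<open>(a, a')\<close>.\<close>

definition neg_ent2 :: "real \<Rightarrow> real \<Rightarrow> real" where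
  "neg_ent2 a a' = xlx a + xlx a' - xlx (a + a')"

lemma neg_ent2_scale:
  assumes "0 \<le> k" "0 \<le> a" "0 \<le> a'"
  shows "neg_ent2 (k * a) (k * a') = k * neg_ent2 a a'"
proof (cases "k = 0 \<or> a + a' = 0")
  case True
  with assms have "k = 0 \<or> (a = 0 \<and> a' = 0)" by auto
  then show ?thesis by (auto simp: neg_ent2_def xlx_def)
next
  case False
  then have "0 < k" "0 < a + a'" using assms by auto
  have sc: "xlx (k * t) = k * xlx t + k * t * ln k" if "0 \<le> t" for t
    using that \<open>0 < k\<close> by (cases "t = 0") (auto simp: xlx_def ln_mult algebra_simps)
  have "k * a + k * a' = k * (a + a')" by (simp add: algebra_simps)
  then show ?thesis
    using sc[of a] sc[of a'] sc[of "a + a'"] assms by (simp add: neg_ent2_def algebra_simps)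
qed

lemma neg_ent2_subadd:
  assumes "0 \<le> a" "0 \<le> a'" "0 \<le> b" "0 \<le> b'"
  shows "neg_ent2 (a + b) (a' + b') \<le> neg_ent2 a a' + neg_ent2 b b'"
proof -
  have *: "neg_ent2 a a' = - ent (a + a') a - ent (a + a') a'" if "0 \<le> a" "0 \<le> a'" for a a'
    by (simp add: neg_ent2_def ent_def xlx_def algebra_simps)
  have 1: "ent (a + a') a + ent (b + b') b \<le> ent (a + a' + (b + b')) (a + b)"
    using log_sum_inequality[of "{True, False}" "\<lambda>c. if c then a else b" "\<lambda>c. if c then a + a' else b + b'"] assms
    by simp
  have 2: "ent (a + a') a' + ent (b + b') b' \<le> ent (a + a' + (b + b')) (a' + b')"
    using log_sum_inequality[of "{True, False}" "\<lambda>c. if c then a' else b'" "\<lambda>c. if c then a + a' else b + b'"] assms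
    by simp
  show ?thesis using 1 2 assms by (simp add: * algebra_simps)
qed

lemma neg_ent2_cone:
  assumes "0 \<le> k" "0 \<le> l" "0 \<le> a" "0 \<le> a'" "0 \<le> b" "0 \<le> b'"
  shows "neg_ent2 (k * a + l * b) (k * a' + l * b') \<le> k * neg_ent2 a a' + l * neg_ent2 b b'"
  using neg_ent2_subadd[of "k*a" "k*a'" "l*b" "l*b'"] neg_ent2_scale[of k a a'] neg_ent2_scale[of l b b'] assms by simp

text \<open>Hlawka's inequality for three vectors of the plane, with the sublinear function \<^const>\<open>neg_ent2\<close>
in place of the norm.\<close>

definition hlawka :: "real \<Rightarrow> real \<Rightarrow> real \<Rightarrow> real \<Rightarrow> real \<Rightarrow> real \<Rightarrow> bool" where
  "hlawka a a' b b' c c' \<longleftrightarrow>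
     neg_ent2 (a + b) (a' + b') + neg_ent2 (b + c) (b' + c') + neg_ent2 (a + c) (a' + c')
       \<le> neg_ent2 a a' + neg_ent2 b b' + neg_ent2 c c' + neg_ent2 (a + b + c) (a' + b' + c')"

lemma hlawka_swap12: "hlawka a a' b b' c c' \<longleftrightarrow> hlawka b b' a a' c c'"
  and hlawka_swap23: "hlawka a a' b b' c c' \<longleftrightarrow> hlawka a a' c c' b b'"
  by (auto simp: hlawka_def add_ac)

text \<open>Let \<open>T\<close> be the sum of the three vectors \<open>a, b, c\<close>. If \<open>a + c\<close> lies in the cone of \<open>c\<close> and \<open>T\<close> with
coefficients \<open>k, l \<le> 1\<close>, then \<open>b + c = c + T - (a + c)\<close> has the complementary coefficients, so
that sublinearity bounds the sum of these two terms by the values at \<open>c\<close> and \<open>T\<close>.\<close>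

lemma hlawka_pivot:
  assumes nn: "0 \<le> a" "0 \<le> a'" "0 \<le> b" "0 \<le> b'" "0 \<le> c" "0 \<le> c'"
    and d: "0 \<le> k" "k \<le> 1" "0 \<le> l" "l \<le> 1"
    and e: "a + c = k * c + l * (a + b + c)" "a' + c' = k * c' + l * (a' + b' + c')"
  shows "hlawka a a' b b' c c'"
proof -
  have e2: "b + c = (1 - k) * c + (1 - l) * (a + b + c)" "b' + c' = (1 - k) * c' + (1 - l) * (a' + b' + c')"
    using e by (auto simp: algebra_simps)
  have "neg_ent2 (a + c) (a' + c') \<le> k * neg_ent2 c c' + l * neg_ent2 (a + b + c) (a' + b' + c')"
    unfolding e using nn d by (intro neg_ent2_cone) auto
  moreover have "neg_ent2 (b + c) (b' + c') \<le> (1 - k) * neg_ent2 c c' + (1 - l) * neg_ent2 (a + b + c) (a' + b' + c')"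
    unfolding e2 using nn d by (intro neg_ent2_cone) auto
  moreover have "neg_ent2 (a + b) (a' + b') \<le> neg_ent2 a a' + neg_ent2 b b'"
    using nn by (intro neg_ent2_subadd)
  ultimately show ?thesis by (simp add: hlawka_def algebra_simps)
qed

text \<open>For vectors ordered by slope the coefficients of the pivot lemma come from Cramer's rule; the
sign \<open>s\<close> covers both orientations of the order. The middle vector is \<open>b\<close>, and the pivot is the
outer vector that spans the larger determinant with it.\<close>

lemma hlawka_ordered_pivot:
  assumes nn: "0 \<le> a" "0 \<le> a'" "0 \<le> b" "0 \<le> b'" "0 \<le> c" "0 \<le> c'"
    and D: "D1 = s * (a * b' - a' * b)" "D2 = s * (b * c' - b' * c)" "D3 = s * (a * c' - a' * c)"
    and s: "0 \<le> D1" "D1 \<le> D2" "0 \<le> D3" "0 < D2 + D3" "s * s = (1::real)"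
  shows "hlawka a a' b b' c c'"
proof (rule hlawka_pivot[OF nn, where k = "(D2 - D1) / (D2 + D3)" and l = "D3 / (D2 + D3)"])
  have s0: "s \<noteq> 0" using s by auto
  have "(a + c) * (D2 + D3) = (D2 - D1) * c + D3 * (a + b + c)"
    unfolding D by algebra
  then have "a + c = ((D2 - D1) * c + D3 * (a + b + c)) / (D2 + D3)"
    using s(4) by (subst eq_divide_eq) auto
  then show "a + c = (D2 - D1) / (D2 + D3) * c + D3 / (D2 + D3) * (a + b + c)"
    by (simp only: add_divide_distrib times_divide_eq_left)
  have "(a' + c') * (D2 + D3) = (D2 - D1) * c' + D3 * (a' + b' + c')"
    unfolding D by algebra
  then have "a' + c' = ((D2 - D1) * c' + D3 * (a' + b' + c')) / (D2 + D3)"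
    using s(4) by (subst eq_divide_eq) auto
  then show "a' + c' = (D2 - D1) / (D2 + D3) * c' + D3 / (D2 + D3) * (a' + b' + c')"
    by (simp only: add_divide_distrib times_divide_eq_left)
qed (use s in \<open>auto simp: field_simps\<close>)

lemma hlawka_ordered:
  assumes nn: "0 \<le> a" "0 \<le> a'" "0 \<le> b" "0 \<le> b'" "0 \<le> c" "0 \<le> c'"
    and pos: "0 < a + a'" "0 < b + b'" "0 < c + c'"
    and D: "0 \<le> a * b' - a' * b" "0 \<le> b * c' - b' * c" "0 \<le> a * c' - a' * c"
  shows "hlawka a a' b b' c c'"
proof -
  define D1 D2 D3 where "D1 = a * b' - a' * b" and "D2 = b * c' - b' * c" and "D3 = a * c' - a' * c"
  note Ds = D1_def D2_def D3_def
  consider "D1 \<le> D2" "0 < D2 + D3" | "D2 \<le> D1" "0 < D1 + D3" | "D1 = 0" "D2 = 0" "D3 = 0"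
    using D unfolding Ds[symmetric] by linarith
  then show ?thesis
  proof cases
    case 1
    then show ?thesis using D by (intro hlawka_ordered_pivot[OF nn, of D1 1 D2 D3]) (auto simp: Ds)
  next
    case 2
    have "hlawka c c' b b' a a'"
      using D 2 nn by (intro hlawka_ordered_pivot[of c c' b b' a a' D2 "-1" D1 D3]) (auto simp: Ds algebra_simps)
    then show ?thesis by (metis hlawka_swap12 hlawka_swap23)
  next
    case 3
    \<comment> \<open>All three vectors are parallel, and the inequality is an equation.\<close>
    define k where "k = (a + a') / (c + c')"
    define l where "l = (b + b') / (c + c')"
    have z: "a * c' = a' * c" "b * c' = b' * c" using 3 by (auto simp: Ds)
    have k: "a = k * c" "a' = k * c'" "0 \<le> k" and l: "b = l * c" "b' = l * c'" "0 \<le> l"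
      using pos z by (auto simp: k_def l_def field_simps)
    have "neg_ent2 (a + b) (a' + b') = (k + l) * neg_ent2 c c'" "neg_ent2 (b + c) (b' + c') = (l + 1) * neg_ent2 c c'"
      "neg_ent2 (a + c) (a' + c') = (k + 1) * neg_ent2 c c'" "neg_ent2 (a + b + c) (a' + b' + c') = (k + l + 1) * neg_ent2 c c'"
      "neg_ent2 a a' = k * neg_ent2 c c'" "neg_ent2 b b' = l * neg_ent2 c c'"
      unfolding k(1,2) l(1,2) using k(3) l(3) nn(5,6)
      by (subst neg_ent2_scale[symmetric]; simp add: algebra_simps)+
    then show ?thesis by (simp add: hlawka_def algebra_simps)
  qed
qed

lemma hlawka_neg_ent2:
  assumes nn: "0 \<le> a" "0 \<le> a'" "0 \<le> b" "0 \<le> b'" "0 \<le> c" "0 \<le> c'"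
  shows "hlawka a a' b b' c c'"
proof (cases "a + a' = 0 \<or> b + b' = 0 \<or> c + c' = 0")
  case True
  then have "(a = 0 \<and> a' = 0) \<or> (b = 0 \<and> b' = 0) \<or> (c = 0 \<and> c' = 0)" using nn by auto
  moreover have "neg_ent2 0 0 = 0" by (simp add: neg_ent2_def xlx_def)
  ultimately show ?thesis by (auto simp: hlawka_def)
next
  case False
  then have pos: "0 < a + a'" "0 < b + b'" "0 < c + c'" using nn by auto
  have ord: "hlawka a a' b b' c c'"
    if "a / (a + a') \<ge> b / (b + b')" "b / (b + b') \<ge> c / (c + c')"
      and nn: "0 \<le> a" "0 \<le> a'" "0 \<le> b" "0 \<le> b'" "0 \<le> c" "0 \<le> c'"
      and pos: "0 < a + a'" "0 < b + b'" "0 < c + c'" for a a' b b' c c' :: real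
  proof (rule hlawka_ordered[OF nn pos])
    have "a / (a + a') \<ge> c / (c + c')" using that by linarith
    then show "0 \<le> a * c' - a' * c" using pos by (simp add: field_simps)
    show "0 \<le> a * b' - a' * b" using that(1) pos by (simp add: field_simps)
    show "0 \<le> b * c' - b' * c" using that(2) pos by (simp add: field_simps)
  qed
  consider "a / (a + a') \<ge> b / (b + b')" "b / (b + b') \<ge> c / (c + c')"
    | "a / (a + a') \<ge> c / (c + c')" "c / (c + c') \<ge> b / (b + b')"
    | "b / (b + b') \<ge> a / (a + a')" "a / (a + a') \<ge> c / (c + c')"
    | "b / (b + b') \<ge> c / (c + c')" "c / (c + c') \<ge> a / (a + a')"
    | "c / (c + c') \<ge> a / (a + a')" "a / (a + a') \<ge> b / (b + b')"
    | "c / (c + c') \<ge> b / (b + b')" "b / (b + b') \<ge> a / (a + a')" by linarith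
  then show ?thesis
    by cases (metis ord nn pos hlawka_swap12 hlawka_swap23)+
qed

text \<open>The local Bethe entropy of a vertex whose edges have the masses \<open>x j\<close>, scaled by the total mass:
the entropy terms of the events that an edge is used minus those of the events that it is not.\<close>

definition local_ent :: "'a set \<Rightarrow> ('a \<Rightarrow> real) \<Rightarrow> real" where
  "local_ent J x = (\<Sum>j\<in>J. ent (sum x J) (x j) - ent (sum x J) (sum x J - x j))"

definition local_ent3 :: "real \<Rightarrow> real \<Rightarrow> real \<Rightarrow> real" where
  "local_ent3 a b c = xlx (a + b) + xlx (b + c) + xlx (a + c) - xlx a - xlx b - xlx c - xlx (a + b + c)"

text \<open>Three edges carry the whole difficulty, and for them superadditivity is Hlawka's inequality.\<close>

lemma local_ent3_superadd:
  assumes "0 \<le> a" "0 \<le> a'" "0 \<le> b" "0 \<le> b'" "0 \<le> c" "0 \<le> c'"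
  shows "local_ent3 a b c + local_ent3 a' b' c' \<le> local_ent3 (a + a') (b + b') (c + c')"
  using hlawka_neg_ent2[OF assms] by (simp add: hlawka_def local_ent3_def neg_ent2_def add_ac)

lemma local_ent_xlx:
  assumes "finite J"
  shows "local_ent J x = (\<Sum>j\<in>J. xlx (sum x J - x j) - xlx (x j)) - (real (card J) - 2) * xlx (sum x J)"
proof -
  let ?M = "sum x J"
  have "local_ent J x = (\<Sum>j\<in>J. (xlx (?M - x j) - xlx (x j)) + (2 * (x j * ln ?M) - ?M * ln ?M))"
    unfolding local_ent_def by (intro sum.cong) (auto simp: ent_def xlx_def algebra_simps)
  also have "\<dots> = (\<Sum>j\<in>J. xlx (?M - x j) - xlx (x j)) + (2 * (?M * ln ?M) - card J * (?M * ln ?M))"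
    by (simp add: sum.distrib sum_subtractf sum_distrib_right sum_distrib_left algebra_simps)
  finally show ?thesis by (simp add: xlx_def algebra_simps)
qed

text \<open>Merging two edges \<open>a\<close> and \<open>b\<close> into one changes the local entropy by the local entropy of the
three masses of \<open>a\<close>, of \<open>b\<close> and of all other edges. This reduces superadditivity to three edges.\<close>

lemma local_ent_merge:
  assumes "finite K" "a \<notin> K" "b \<in> K"
  shows "local_ent (insert a K) x = local_ent3 (x a) (x b) (sum x (K - {b})) + local_ent K (x(b := x b + x a))"
proof -
  let ?r = "sum x (K - {b})" and ?x = "x(b := x b + x a)"
  have K: "K = insert b (K - {b})" "finite (K - {b})" "b \<notin> K - {b}" using assms by auto
  have sK: "sum x K = x b + ?r" by (subst K(1), subst sum.insert) (use K in auto)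
  have "sum ?x K = ?x b + sum ?x (K - {b})" by (subst K(1), subst sum.insert) (use K in auto)
  also have "sum ?x (K - {b}) = ?r" by (intro sum.cong) auto
  finally have M: "sum ?x K = x a + x b + ?r" "sum x (insert a K) = x a + x b + ?r"
    using assms sK by (auto simp: add_ac)
  let ?M = "x a + x b + ?r"
  have s1: "(\<Sum>j\<in>insert a K. xlx (?M - x j) - xlx (x j)) = 
      (xlx (?M - x a) - xlx (x a)) + ((xlx (?M - x b) - xlx (x b)) + (\<Sum>j\<in>K - {b}. xlx (?M - x j) - xlx (x j)))"
    using assms by (subst sum.insert, simp, simp, subst (1) K(1), subst sum.insert) (use K in auto)
  have "(\<Sum>j\<in>K. xlx (?M - ?x j) - xlx (?x j)) = 
      (xlx (?M - ?x b) - xlx (?x b)) + (\<Sum>j\<in>K - {b}. xlx (?M - ?x j) - xlx (?x j))"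
    by (subst (1) K(1), subst sum.insert) (use K in auto)
  also have "(\<Sum>j\<in>K - {b}. xlx (?M - ?x j) - xlx (?x j)) = (\<Sum>j\<in>K - {b}. xlx (?M - x j) - xlx (x j))"
    by (intro sum.cong) auto
  finally have s2: "(\<Sum>j\<in>K. xlx (?M - ?x j) - xlx (?x j)) = 
      (xlx (?M - (x b + x a)) - xlx (x b + x a)) + (\<Sum>j\<in>K - {b}. xlx (?M - x j) - xlx (x j))"
    by simp
  have c: "real (card (insert a K)) = real (card K) + 1" using assms by simp
  have e: "?M - x a = x b + ?r" "?M - x b = x a + ?r" "?M - (x b + x a) = ?r" "x b + x a = x a + x b" by auto
  have "finite (insert a K)" using assms by simp
  show ?thesis
    unfolding local_ent_xlx[OF \<open>finite (insert a K)\<close>] local_ent_xlx[OF assms(1)] M s1 s2 c local_ent3_def e(1,2,3)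
    unfolding e(4) by (simp add: algebra_simps)
qed

lemma local_ent_superadd2:
  assumes "finite J" "\<And>j. j \<in> J \<Longrightarrow> 0 \<le> x j" "\<And>j. j \<in> J \<Longrightarrow> 0 \<le> y j"
  shows "local_ent J x + local_ent J y \<le> local_ent J (\<lambda>j. x j + y j)"
  using assms
proof (induction J arbitrary: x y rule: finite_induct)
  case empty
  then show ?case by (simp add: local_ent_def)
next
  case (insert a K)
  show ?case
  proof (cases "K = {}")
    case True
    then show ?thesis by (simp add: local_ent_def ent_def)
  next
    case False
    then obtain b where b: "b \<in> K" by auto
    let ?x = "x(b := x b + x a)" and ?y = "y(b := y b + y a)"
    have e: "(\<lambda>j. x j + y j)(b := x b + y b + (x a + y a)) = (\<lambda>j. ?x j + ?y j)" by auto
    have "local_ent K ?x + local_ent K ?y \<le> local_ent K (\<lambda>j. ?x j + ?y j)"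
      using b insert.prems by (intro insert.IH) (auto intro: add_nonneg_nonneg)
    moreover have "local_ent3 (x a) (x b) (sum x (K - {b})) + local_ent3 (y a) (y b) (sum y (K - {b}))
        \<le> local_ent3 (x a + y a) (x b + y b) (sum x (K - {b}) + sum y (K - {b}))"
      using b insert.prems by (intro local_ent3_superadd sum_nonneg) auto
    ultimately show ?thesis
      unfolding local_ent_merge[OF insert.hyps b] by (simp only: e sum.distrib) 
  qed
qed

text \<open>As \<^const>\<open>local_ent\<close> is positively homogeneous, this is the concavity of the local Bethe entropy.
The single terms of its defining sum are not concave.\<close>

lemma local_ent_superadd:
  assumes "finite B" "finite J" "\<And>b j. b \<in> B \<Longrightarrow> j \<in> J \<Longrightarrow> 0 \<le> x b j"
  shows "(\<Sum>b\<in>B. local_ent J (x b)) \<le> local_ent J (\<lambda>j. \<Sum>b\<in>B. x b j)"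
  using assms(1,3)
proof (induction B rule: finite_induct)
  case empty
  then show ?case by (simp add: local_ent_def ent_def)
next
  case (insert b B)
  then have "(\<Sum>b\<in>B. local_ent J (x b)) \<le> local_ent J (\<lambda>j. \<Sum>b\<in>B. x b j)" by auto
  moreover have "local_ent J (x b) + local_ent J (\<lambda>j. \<Sum>b\<in>B. x b j) \<le> local_ent J (\<lambda>j. x b j + (\<Sum>b\<in>B. x b j))"
    using insert.prems assms(2) by (intro local_ent_superadd2 sum_nonneg) auto
  ultimately show ?case using insert.hyps by simp
qed

section \<open>Shapley averages of entropy terms\<close>

lemma sum_Pow_swap:
  assumes "finite J"
  shows "(\<Sum>W\<in>Pow J. \<Sum>j\<in>W. F W j) = (\<Sum>U\<in>Pow J. \<Sum>j\<in>J - U. F (insert j U) j)"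
proof -
  have "(\<Sum>W\<in>Pow J. \<Sum>j\<in>W. F W j) = (\<Sum>(W, j)\<in>Sigma (Pow J) (\<lambda>W. W). F W j)"
    using assms by (intro sum.Sigma) (auto intro: finite_subset)
  also have "\<dots> = (\<Sum>(U, j)\<in>Sigma (Pow J) (\<lambda>U. J - U). F (insert j U) j)"
    by (rule sum.reindex_bij_witness[where i = "\<lambda>(U, j). (insert j U, j)" and j = "\<lambda>(W, j). (W - {j}, j)"])
      (auto simp: insert_absorb)
  also have "\<dots> = (\<Sum>U\<in>Pow J. \<Sum>j\<in>J - U. F (insert j U) j)"
    using assms by (intro sum.Sigma[symmetric]) auto
  finally show ?thesis .
qed

lemma sum_Pow_insert:
  assumes "finite J" "a \<notin> J"
  shows "(\<Sum>W\<in>Pow (insert a J). F W) = (\<Sum>W\<in>Pow J. F W + F (insert a W))"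
proof -
  have "(\<Sum>W\<in>Pow (insert a J). F W) = (\<Sum>W\<in>Pow J. F W) + (\<Sum>W\<in>insert a ` Pow J. F W)"
    unfolding Pow_insert using assms by (intro sum.union_disjoint) auto
  also have "(\<Sum>W\<in>insert a ` Pow J. F W) = (\<Sum>W\<in>Pow J. F (insert a W))"
    using assms by (subst sum.reindex) (auto simp: inj_on_def)
  finally show ?thesis by (simp add: sum.distrib)
qed

text \<open>The weight of a set of size \<open>w\<close> in the Shapley value of a game with \<open>d\<close> players: in a
uniformly random order, \<open>shapley d (Suc k)\<close> is the probability that a given set of size \<open>k\<close> comes
first and a given further player comes next.\<close>

definition shapley :: "nat \<Rightarrow> nat \<Rightarrow> real" where
  "shapley d w = (if w = 0 \<or> w > d then 0 else fact (w - 1) * fact (d - w) / fact d)"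

lemma shapley_Suc: "w \<le> d \<Longrightarrow> w \<noteq> 0 \<Longrightarrow> shapley (Suc d) w + shapley (Suc d) (Suc w) = shapley d w"
proof -
  assume "w \<le> d" "w \<noteq> 0"
  then obtain k e where w: "w = Suc k" "d = Suc k + e" by (metis le_Suc_ex not0_implies_Suc)
  have f: "fact (Suc d - w) = fact e * real (e + 1)" "fact (Suc d - Suc w) = (fact e :: real)"
    "fact (w - 1) = (fact k :: real)" "fact (Suc w - 1) = fact k * real (k + 1)"
    by (simp_all add: w algebra_simps)
  have "shapley (Suc d) w + shapley (Suc d) (Suc w)
      = (fact k * (fact e * real (e + 1)) + fact k * real (k + 1) * fact e) / fact (Suc d)"
    unfolding shapley_def f add_divide_distrib using w by simp
  also have "fact k * (fact e * real (e + 1)) + fact k * real (k + 1) * fact e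
      = fact k * fact e * (real (e + 1) + real (k + 1))"
    by (simp add: algebra_simps)
  also have "real (e + 1) + real (k + 1) = real (Suc d)" using w by simp
  also have "fact k * fact e * real (Suc d) / (fact (Suc d)) = shapley d w"
    unfolding shapley_def w by (simp del: of_nat_Suc)
  finally show ?thesis .
qed

lemma shapley_mult:
  assumes "u < d" "u \<noteq> 0"
  shows "real (d - u) * shapley d (Suc u) = real u * shapley d u"
proof -
  obtain k where k: "u = Suc k" using assms by (cases u) auto
  obtain e where e: "d = Suc (u + e)" using assms by (metis less_imp_Suc_add)
  show ?thesis unfolding shapley_def k e by (simp add: algebra_simps)
qed

text \<open>For a fixed player the sets of players that can precede it have total probability \<open>1\<close>.\<close>

lemma sum_shapley:
  assumes "finite J"
  shows "(\<Sum>U\<in>Pow J. shapley (Suc (card J)) (Suc (card U))) = 1"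
  using assms
proof (induction J rule: finite_induct)
  case empty
  show ?case by (simp add: shapley_def)
next
  case (insert a J)
  have "(\<Sum>U\<in>Pow (insert a J). shapley (Suc (card (insert a J))) (Suc (card U)))
     = (\<Sum>U\<in>Pow J. shapley (Suc (Suc (card J))) (Suc (card U)) + shapley (Suc (Suc (card J))) (Suc (card (insert a U))))"
    using insert by (simp add: sum_Pow_insert)
  also have "\<dots> = (\<Sum>U\<in>Pow J. shapley (Suc (card J)) (Suc (card U)))"
  proof (intro sum.cong refl)
    fix U assume "U \<in> Pow J"
    then have "card (insert a U) = Suc (card U)" "card U \<le> card J"
      using insert by (auto intro: card_mono finite_subset dest: finite_subset intro!: card_insert_disjoint)
    then show "shapley (Suc (Suc (card J))) (Suc (card U)) + shapley (Suc (Suc (card J))) (Suc (card (insert a U))) = shapley (Suc (card J)) (Suc (card U))"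
      by (simp add: shapley_Suc)
  qed
  finally show ?case using insert by simp
qed

text \<open>Half of the average that remains of a row with distribution \<open>p\<close> when the rows have been
revealed in a random order; see the lemma \<open>local_ent_average\<close>.\<close>

definition row_bound :: "'a set \<Rightarrow> ('a \<Rightarrow> real) \<Rightarrow> real" where
  "row_bound J p = (\<Sum>W\<in>Pow J. shapley (card J) (card W) * xlx (sum p W)) - (\<Sum>j\<in>J. xlx (1 - p j))"

lemma xlx_0 [simp]: "xlx 0 = 0" and xlx_1 [simp]: "xlx 1 = 0" by (simp_all add: xlx_def)

lemma row_bound_drop_zero:
  assumes "finite J" "a \<notin> J" "p a = 0"
  shows "row_bound (insert a J) p = row_bound J p"
proof -
  have "(\<Sum>W\<in>Pow (insert a J). shapley (card (insert a J)) (card W) * xlx (sum p W))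
    = (\<Sum>W\<in>Pow J. shapley (card J) (card W) * xlx (sum p W))"
    unfolding sum_Pow_insert[OF assms(1,2)]
  proof (intro sum.cong refl)
    fix W assume W: "W \<in> Pow J"
    then have f: "finite W" "a \<notin> W" using assms by (auto intro: finite_subset)
    then have e: "sum p (insert a W) = sum p W" "card (insert a W) = Suc (card W)" using assms by auto
    show "shapley (card (insert a J)) (card W) * xlx (sum p W) + shapley (card (insert a J)) (card (insert a W)) * xlx (sum p (insert a W))
      = shapley (card J) (card W) * xlx (sum p W)"
    proof (cases "W = {}")
      case True
      then show ?thesis using assms by simp
    next
      case False
      then have "card W \<le> card J" "card W \<noteq> 0" using W f assms by (auto intro: card_mono)
      from shapley_Suc[OF this] show ?thesis unfolding e using assms by (simp add: distrib_right[symmetric])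
    qed
  qed
  then show ?thesis using assms by (simp add: row_bound_def)
qed

text \<open>The second difference of \<^const>\<open>xlx\<close> at \<open>u\<close> with steps \<open>a\<close> and \<open>b\<close>. It is the change of
\<open>xlx (sum p U)\<close>, for varying sets \<open>U\<close>, that comes from merging entries \<open>a\<close> and \<open>b\<close>.\<close>

definition diff2 :: "real \<Rightarrow> real \<Rightarrow> real \<Rightarrow> real" where
  "diff2 a b u = xlx (u + a + b) + xlx u - xlx (u + a) - xlx (u + b)"

text \<open>Only sets that contain exactly one of \<open>a\<close> and \<open>b\<close> notice the merging. Each set \<open>U\<close> without
both gives two such sets, \<open>insert a U\<close> and \<open>insert b U\<close>; after merging one of them has the mass
of \<open>U\<close> and the other one the mass of \<open>insert a (insert b U)\<close>.\<close>

lemma row_bound_merge: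
  assumes "finite K" "a \<notin> K" "b \<notin> K" "a \<noteq> b" "sum p K + p a + p b = 1"
  shows "row_bound (insert a (insert b K)) p - row_bound (insert a (insert b K)) (p(a := 0, b := p a + p b))
    = diff2 (p a) (p b) (sum p K) - (\<Sum>U\<in>Pow K. shapley (card K + 2) (Suc (card U)) * diff2 (p a) (p b) (sum p U))"
proof -
  let ?q = "p(a := 0, b := p a + p b)"
  let ?J = "insert a (insert b K)" and ?d = "card K + 2"
  have ab: "finite (insert b K)" "a \<notin> insert b K" using assms by auto
  have cJ: "card ?J = ?d" using assms by simp
  have *: "shapley ?d (card U) * (xlx (sum p U) - xlx (sum ?q U))
       + shapley ?d (card (insert a U)) * (xlx (sum p (insert a U)) - xlx (sum ?q (insert a U)))
       + (shapley ?d (card (insert b U)) * (xlx (sum p (insert b U)) - xlx (sum ?q (insert b U)))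
       + shapley ?d (card (insert a (insert b U))) * (xlx (sum p (insert a (insert b U))) - xlx (sum ?q (insert a (insert b U)))))
     = - (shapley ?d (Suc (card U)) * diff2 (p a) (p b) (sum p U))" if "U \<in> Pow K" for U
  proof -
    have f: "finite U" "a \<notin> U" "b \<notin> U" using that assms by (auto intro: finite_subset)
    have "sum ?q U = sum p U" using f by (intro sum.cong) auto
    with f \<open>a \<noteq> b\<close> show ?thesis by (simp add: diff2_def algebra_simps)
  qed
  have "(\<Sum>W\<in>Pow ?J. shapley ?d (card W) * (xlx (sum p W) - xlx (sum ?q W)))
     = - (\<Sum>U\<in>Pow K. shapley ?d (Suc (card U)) * diff2 (p a) (p b) (sum p U))"
    unfolding sum_Pow_insert[OF ab] sum_Pow_insert[OF assms(1,3)] sum_negf[symmetric]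
    by (intro sum.cong refl *)
  then have A: "(\<Sum>W\<in>Pow ?J. shapley ?d (card W) * xlx (sum p W)) - (\<Sum>W\<in>Pow ?J. shapley ?d (card W) * xlx (sum ?q W))
     = - (\<Sum>U\<in>Pow K. shapley ?d (Suc (card U)) * diff2 (p a) (p b) (sum p U))"
    by (simp only: right_diff_distrib sum_subtractf)
  have qK: "(\<Sum>j\<in>K. xlx (1 - ?q j)) = (\<Sum>j\<in>K. xlx (1 - p j))"
    using assms by (intro sum.cong) auto
  have e: "1 - p a = sum p K + p b" "1 - p b = sum p K + p a" "1 - (p a + p b) = sum p K"
    using assms by auto
  have B: "(\<Sum>j\<in>?J. xlx (1 - p j)) = xlx (sum p K + p b) + (xlx (sum p K + p a) + (\<Sum>j\<in>K. xlx (1 - p j)))"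
    using assms by (simp add: e)
  have "(\<Sum>j\<in>?J. xlx (1 - ?q j)) = xlx (1 - ?q a) + (xlx (1 - ?q b) + (\<Sum>j\<in>K. xlx (1 - ?q j)))"
    using assms by simp
  moreover have "xlx (1 - ?q a) = 0" using assms by simp
  moreover have "xlx (1 - ?q b) = xlx (sum p K)" using e(3) by simp
  ultimately have C: "(\<Sum>j\<in>?J. xlx (1 - ?q j)) = xlx (sum p K) + (\<Sum>j\<in>K. xlx (1 - p j))"
    unfolding qK by linarith
  have "diff2 (p a) (p b) (sum p K) = xlx (sum p K) - xlx (sum p K + p a) - xlx (sum p K + p b)"
    unfolding diff2_def assms(5) by simp
  then show ?thesis
    using A B C unfolding row_bound_def cJ by linarith
qed

lemma DERIV_xlx [derivative_intros]:
  assumes "(f has_real_derivative D) (at x within s)" "0 < f x"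
  shows "((\<lambda>x. xlx (f x)) has_real_derivative ((ln (f x) + 1) * D)) (at x within s)"
  unfolding xlx_def using assms by (auto intro!: derivative_eq_intros simp: field_simps)

lemma diff2_antimono:
  assumes "0 < a" "0 < b" "0 < u" "u \<le> v"
  shows "diff2 a b v \<le> diff2 a b u"
proof (rule DERIV_nonpos_imp_nonincreasing[OF assms(4)])
  fix x assume "u \<le> x" "x \<le> v"
  then have x: "0 < x" using assms by simp
  have "(diff2 a b has_real_derivative (ln (x + a + b) + ln x - ln (x + a) - ln (x + b))) (at x)"
    unfolding diff2_def using x assms
    by (auto intro!: derivative_eq_intros simp: algebra_simps)
  moreover have "(x + a) * (x + b) = (x + a + b) * x + a * b" by algebra
  then have "ln ((x + a + b) * x) \<le> ln ((x + a) * (x + b))"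
    using x assms by (intro ln_mono mult_pos_pos) auto
  then have "ln (x + a + b) + ln x - ln (x + a) - ln (x + b) \<le> 0"
    using x assms by (simp add: ln_mult)
  ultimately show "\<exists>y. (diff2 a b has_real_derivative y) (at x) \<and> y \<le> 0" by blast
qed

lemma log_ratio_antimono:
  fixes t b :: real
  assumes "1 \<le> t" "0 \<le> b" "b \<le> 1"
  shows "(t + 4) * (ln (t + 1 + b) - ln (t + b)) \<le> 5 * (ln (2 + b) - ln (1 + b))"
proof -
  let ?f = "\<lambda>t::real. (t + 4) * (ln (t + 1 + b) - ln (t + b))"
  have "?f t \<le> ?f 1"
  proof (rule DERIV_nonpos_imp_nonincreasing[OF assms(1)])
    fix x assume "1 \<le> x" "x \<le> t"
    then have w: "0 < x + b" using assms by simp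
    let ?d = "(ln (x + 1 + b) - ln (x + b)) + (x + 4) * (1 / (x + 1 + b) - 1 / (x + b))"
    have "(?f has_real_derivative ?d) (at x)"
      using w by (auto intro!: derivative_eq_intros)
    moreover have "?d \<le> 0"
    proof -
      have "ln (x + 1 + b) - ln (x + b) = ln ((x + 1 + b) / (x + b))"
        using w by (simp add: ln_div)
      also have "(x + 1 + b) / (x + b) = 1 + 1 / (x + b)" using w by (simp add: field_simps)
      also have "ln (1 + 1 / (x + b)) \<le> 1 / (x + b)" using w by (intro ln_add_one_self_le_self) auto
      also have "\<dots> \<le> (x + 4) * (1 / (x + b) - 1 / (x + 1 + b))"
      proof -
        have "1 / (x + b) - 1 / (x + 1 + b) = 1 / (x + b) / (x + 1 + b)"
          using w by (simp add: field_simps)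
        moreover have "1 / (x + b) * 1 \<le> 1 / (x + b) * ((x + 4) / (x + 1 + b))"
          using w assms by (intro mult_left_mono) auto
        ultimately show ?thesis by simp
      qed
      finally show ?thesis by (simp add: algebra_simps)
    qed
    ultimately show "\<exists>y. (?f has_real_derivative y) (at x) \<and> y \<le> 0" by blast
  qed
  then show ?thesis by (simp add: add_ac)
qed

text \<open>Reduces the estimate for \<open>t + 2\<close> entries to the one for three entries: both sides vanish at
\<open>b = 0\<close>, and \<open>log_ratio_antimono\<close> compares their derivatives in \<open>b\<close>.\<close>

lemma diff2_one_scaled_le:
  fixes t b :: real
  assumes "1 \<le> t" "0 \<le> b" "b \<le> 1"
  shows "(t + 4) * diff2 1 b t \<le> 5 * diff2 1 b 1"
proof -
  let ?f = "\<lambda>b. 5 * diff2 1 b 1 - (t + 4) * diff2 1 b t"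
  have "?f 0 \<le> ?f b"
  proof (rule DERIV_nonneg_imp_nondecreasing[OF assms(2)])
    fix x assume x: "0 \<le> x" "x \<le> b"
    have "(?f has_real_derivative (5 * (ln (2 + x) - ln (1 + x)) - (t + 4) * (ln (t + 1 + x) - ln (t + x)))) (at x)"
      unfolding diff2_def using x assms
      by (auto intro!: derivative_eq_intros simp: algebra_simps)
    moreover have "0 \<le> 5 * (ln (2 + x) - ln (1 + x)) - (t + 4) * (ln (t + 1 + x) - ln (t + x))"
      using log_ratio_antimono[of t x] x assms by simp
    ultimately show "\<exists>y. (?f has_real_derivative y) (at x) \<and> 0 \<le> y" by blast
  qed
  then show ?thesis by (simp add: diff2_def)
qed

text \<open>This is \<open>3 ^ 15 \<le> 2 ^ 24\<close>, the case \<open>b = 1\<close> of the following lemma.\<close>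

lemma log_two_three: "15 * ln (3::real) \<le> 24 * ln 2"
proof -
  have "ln ((3::real) ^ 15) \<le> ln (2 ^ 24)" by (subst ln_le_cancel_iff) auto
  then have "real 15 * ln 3 \<le> real 24 * ln (2::real)" by (simp only: ln_realpow)
  then show ?thesis by simp
qed

text \<open>The difference of the two sides, divided by \<open>b\<close>, is decreasing, so it suffices to check \<open>b = 1\<close>.
Dividing by \<open>b\<close> removes the term \<open>b ln b\<close> from the numerator of the derivative, which leaves the
elementary function \<open>?q\<close>.\<close>

lemma diff2_one_critical:
  fixes b :: real
  assumes "0 < b" "b \<le> 1"
  shows "5 / 2 * diff2 1 b 1 \<le> diff2 1 b 0"
proof -
  let ?f = "\<lambda>b. (diff2 1 b 0 - 5 / 2 * diff2 1 b 1) / b"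
  let ?q = "\<lambda>b::real. 5 * ln (2 + b) - 7 / 2 * ln (1 + b)"
  have q: "?q x \<le> 5 * ln 2" if "0 \<le> x" "x \<le> 1" for x
  proof -
    have "?q x \<le> ?q 0"
    proof (rule DERIV_nonpos_imp_nonincreasing[OF that(1)])
      fix y assume y: "0 \<le> y" "y \<le> x"
      have "(?q has_real_derivative (5 * (1 / (2 + y)) - 7 / 2 * (1 / (1 + y)))) (at y)"
        using y by (intro derivative_eq_intros refl) auto
      moreover have "5 * (1 / (2 + y)) \<le> 7 / 2 * (1 / (1 + y))" using y that by (simp add: field_simps)
      then have "5 * (1 / (2 + y)) - 7 / 2 * (1 / (1 + y)) \<le> 0" by simp
      ultimately show "\<exists>z. (?q has_real_derivative z) (at y) \<and> z \<le> 0" by blast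
    qed
    then show ?thesis by simp
  qed
  have "?f 1 \<le> ?f b"
  proof (rule DERIV_nonpos_imp_nonincreasing[OF assms(2)])
    fix x assume "b \<le> x" "x \<le> 1"
    then have x: "0 < x" "x \<le> 1" using assms by auto
    have "((\<lambda>b. diff2 1 b 0 - 5 / 2 * diff2 1 b 1) has_real_derivative
        (ln (1 + x) - ln x - 5 / 2 * (ln (2 + x) - ln (1 + x)))) (at x)"
      unfolding diff2_def using x
      by (auto intro!: derivative_eq_intros simp: algebra_simps add_divide_distrib)
    from DERIV_divide[OF this DERIV_ident] x
    have "(?f has_real_derivative ((ln (1 + x) - ln x - 5 / 2 * (ln (2 + x) - ln (1 + x))) * x
        - (diff2 1 x 0 - 5 / 2 * diff2 1 x 1)) / (x * x)) (at x)" by simp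
    also have "(ln (1 + x) - ln x - 5 / 2 * (ln (2 + x) - ln (1 + x))) * x
        - (diff2 1 x 0 - 5 / 2 * diff2 1 x 1) = ?q x - 5 * ln 2"
      unfolding diff2_def xlx_def by (simp add: algebra_simps)
    finally have "(?f has_real_derivative (?q x - 5 * ln 2) / (x * x)) (at x)" .
    moreover have "(?q x - 5 * ln 2) / (x * x) \<le> 0"
      using q[of x] x by (intro divide_nonpos_pos) auto
    ultimately show "\<exists>y. (?f has_real_derivative y) (at x) \<and> y \<le> 0" by blast
  qed
  moreover have "ln (4::real) = 2 * ln 2" using ln_realpow[of 2 2] by simp
  then have "0 \<le> ?f 1" using log_two_three by (simp add: diff2_def xlx_def)
  ultimately have "0 \<le> ?f b" by linarith
  then show ?thesis using assms by (simp add: zero_le_divide_iff)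
qed

lemma diff2_homogeneous:
  assumes "0 < a" "0 < b" "0 \<le> u"
  shows "diff2 a b u = a * diff2 1 (b / a) (u / a)"
proof -
  have sc: "xlx (a * t) = a * xlx t + (a * t) * ln a" if "0 \<le> t" for t
    using that assms(1) by (cases "t = 0") (auto simp: xlx_def ln_mult algebra_simps)
  have "u + a + b = a * (u / a + 1 + b / a)" "u = a * (u / a)" "u + a = a * (u / a + 1)"
    "u + b = a * (u / a + b / a)"
    using assms by (auto simp: field_simps)
  then have "diff2 a b u = xlx (a * (u / a + 1 + b / a)) + xlx (a * (u / a)) - xlx (a * (u / a + 1)) - xlx (a * (u / a + b / a))"
    unfolding diff2_def by metis
  also have "\<dots> = a * diff2 1 (b / a) (u / a)"
    unfolding diff2_def using assms by (subst (1 2 3 4) sc) (auto simp: algebra_simps)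
  finally show ?thesis .
qed

text \<open>The case of \<open>k + 2\<close> entries of which \<open>a\<close> and \<open>b\<close> are the smallest, so that the mass \<open>r\<close> of the
\<open>k\<close> other entries is at least \<open>k a\<close>. By homogeneity \<open>a\<close> may be scaled to \<open>1\<close>.\<close>

lemma diff2_zero_dominates:
  assumes "0 < b" "b \<le> a" "1 \<le> k" "real k * a \<le> r"
  shows "(real k + 4) / 2 * diff2 a b r \<le> diff2 a b 0"
proof -
  have a: "0 < a" using assms by simp
  have "diff2 a b r \<le> diff2 a b (real k * a)" using a assms by (intro diff2_antimono) auto
  also have "\<dots> = a * diff2 1 (b / a) (real k)" using a assms by (subst diff2_homogeneous) auto
  finally have "(real k + 4) / 2 * diff2 a b r \<le> (real k + 4) / 2 * (a * diff2 1 (b / a) (real k))"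
    by (intro mult_left_mono) auto
  also have "\<dots> = a / 2 * ((real k + 4) * diff2 1 (b / a) (real k))" by simp
  also have "\<dots> \<le> a / 2 * (5 * diff2 1 (b / a) 1)"
    using a assms by (intro mult_left_mono diff2_one_scaled_le) auto
  also have "\<dots> = a * (5 / 2 * diff2 1 (b / a) 1)" by simp
  also have "\<dots> \<le> a * diff2 1 (b / a) 0"
    using a assms by (intro mult_left_mono diff2_one_critical) auto
  also have "\<dots> = diff2 a b 0" using a assms by (subst (2) diff2_homogeneous) auto
  finally show ?thesis .
qed

text \<open>Of two fixed players either one comes first with the same probability.\<close>

lemma sum_shapley_half:
  assumes "finite K"
  shows "(\<Sum>U\<in>Pow K. shapley (card K + 2) (Suc (card U))) = 1 / 2"
proof -
  let ?s = "\<lambda>U. shapley (card K + 2) (Suc (card U))" and ?t = "\<lambda>U. shapley (card K + 2) (Suc (Suc (card U)))"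
  have "(\<Sum>U\<in>Pow K. ?s U) = (\<Sum>U\<in>Pow K. ?t U)"
  proof (rule sum.reindex_bij_witness[where i = "\<lambda>U. K - U" and j = "\<lambda>U. K - U"])
    fix U assume "U \<in> Pow K"
    then have "card (K - U) = card K - card U" "card U \<le> card K"
      using assms by (auto intro: card_Diff_subset card_mono finite_subset)
    then show "?t (K - U) = ?s U" by (simp add: shapley_def Suc_diff_le)
  qed auto
  moreover have "(\<Sum>U\<in>Pow K. ?s U) + (\<Sum>U\<in>Pow K. ?t U) = (\<Sum>U\<in>Pow K. shapley (Suc (card K)) (Suc (card U)))"
    unfolding sum.distrib[symmetric]
  proof (intro sum.cong refl)
    fix U assume "U \<in> Pow K"
    then have "card U \<le> card K" using assms by (auto intro: card_mono)
    then show "?s U + ?t U = shapley (Suc (card K)) (Suc (card U))" using shapley_Suc[of "Suc (card U)" "Suc (card K)"] by simp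
  qed
  ultimately show ?thesis using sum_shapley[OF assms] by simp
qed

text \<open>Merging the two smallest entries does not decrease \<^const>\<open>row_bound\<close>: the empty set has weight
\<open>1 / (k + 2)\<close> and second difference \<open>diff2 (p a) (p b) 0\<close>, every other set has at least
\<open>diff2 (p a) (p b) r\<close>, and the total weight is \<open>1 / 2\<close>.\<close>

lemma row_bound_merge_le:
  fixes K :: "'a set"
  assumes "finite K" "K \<noteq> {}" "a \<notin> K" "b \<notin> K" "a \<noteq> b" "sum p K + p a + p b = 1"
    "0 < p b" "p b \<le> p a" "\<And>j. j \<in> K \<Longrightarrow> p a \<le> p j"
  shows "row_bound (insert a (insert b K)) p \<le> row_bound (insert a (insert b K)) (p(a := 0, b := p a + p b))"
proof -
  let ?P = "diff2 (p a) (p b)" and ?k = "card K" and ?r = "sum p K"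
  let ?v = "\<lambda>U. shapley (?k + 2) (Suc (card U))"
  have k: "1 \<le> ?k" using assms(1,2) by (simp add: Suc_le_eq card_gt_0_iff)
  have pos: "0 < p j" if "j \<in> insert a K" for j using assms that by force
  have r: "real ?k * p a \<le> ?r"
    using sum_mono[of K "\<lambda>_. p a" p] assms(9) by simp
  have v0: "?v ({} :: 'a set) = 1 / (real ?k + 2)" 
    by (simp add: shapley_def del: fact_Suc) (simp add: add_ac)
  have vn: "0 \<le> ?v U" for U by (simp add: shapley_def)
  have ne: "Pow K = insert {} (Pow K - {{}})" by auto
  have "?v ({} :: 'a set) * ?P 0 + (1 / 2 - ?v ({} :: 'a set)) * ?P ?r = ?v ({} :: 'a set) * ?P 0 + (\<Sum>U\<in>Pow K - {{}}. ?v U * ?P ?r)"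
  proof -
    have "(\<Sum>U\<in>Pow K. ?v U) = ?v ({} :: 'a set) + (\<Sum>U\<in>Pow K - {{}}. ?v U)"
      using assms(1) by (subst sum.remove[of _ "{}"]) auto
    then show ?thesis using sum_shapley_half[OF assms(1)] by (simp add: sum_distrib_right[symmetric])
  qed
  also have "\<dots> \<le> ?v ({} :: 'a set) * ?P 0 + (\<Sum>U\<in>Pow K - {{}}. ?v U * ?P (sum p U))"
  proof (intro add_left_mono sum_mono mult_left_mono vn diff2_antimono)
    fix U assume U: "U \<in> Pow K - {{}}"
    then have "finite U" using assms(1) by (auto intro: finite_subset)
    then show "0 < sum p U" using U pos by (intro sum_pos) auto
    show "sum p U \<le> sum p K" using U assms(1) pos by (intro sum_mono2) (auto intro: less_imp_le)
  qed (use assms in auto)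
  also have "\<dots> = (\<Sum>U\<in>Pow K. ?v U * ?P (sum p U))"
    using assms(1) by (subst (2) sum.remove[of _ "{}"]) auto
  finally have 1: "?v ({} :: 'a set) * ?P 0 + (1 / 2 - ?v ({} :: 'a set)) * ?P ?r \<le> (\<Sum>U\<in>Pow K. ?v U * ?P (sum p U))" .
  have "(real ?k + 4) / 2 * ?P ?r \<le> ?P 0"
    using assms k r by (intro diff2_zero_dominates) auto
  then have "1 / (real ?k + 2) * ((real ?k + 4) / 2 * ?P ?r) \<le> 1 / (real ?k + 2) * ?P 0"
    by (intro mult_left_mono) auto
  also have "1 / (real ?k + 2) * ((real ?k + 4) / 2 * ?P ?r) = (1 / 2 + ?v ({} :: 'a set)) * ?P ?r"
    unfolding v0 by (simp add: field_simps)
  finally have "?P ?r \<le> ?v ({} :: 'a set) * ?P 0 + (1 / 2 - ?v ({} :: 'a set)) * ?P ?r" unfolding v0 by (simp add: algebra_simps)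
  with 1 show ?thesis using row_bound_merge[OF assms(1,3,4,5,6)] by simp
qed

text \<open>Zero entries can be dropped and the two smallest entries can be merged, until at most two
entries remain. For two entries \<^const>\<open>row_bound\<close> is half of the binary entropy.\<close>

lemma row_bound_le:
  assumes "finite J" "\<And>j. j \<in> J \<Longrightarrow> 0 \<le> p j" "sum p J = 1"
  shows "row_bound J p \<le> ln 2 / 2"
  using assms
proof (induction "card J" arbitrary: J p rule: less_induct)
  case less
  show ?case
  proof (cases "\<exists>a\<in>J. p a = 0")
    case True
    then obtain a where a: "a \<in> J" "p a = 0" by auto
    have J: "J = insert a (J - {a})" "finite (J - {a})" "a \<notin> J - {a}" using a less.prems by auto
    have "sum p (J - {a}) = 1" using a less.prems by (simp add: sum_diff1)
    moreover have "card (J - {a}) < card J" using a less.prems by (intro psubset_card_mono) auto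
    ultimately have "row_bound (J - {a}) p \<le> ln 2 / 2"
      using less.prems a by (intro less.hyps) auto
    then show ?thesis using row_bound_drop_zero[of "J - {a}" a p, OF J(2,3) a(2)] J(1) by simp
  next
    case False
    then have pos: "0 < p j" if "j \<in> J" for j using that less.prems by force
    have "J \<noteq> {}" using less.prems by auto
    define b where "b = arg_min_on p J"
    have b: "b \<in> J" "\<And>j. j \<in> J \<Longrightarrow> p b \<le> p j"
      using arg_min_if_finite(1)[OF less.prems(1) \<open>J \<noteq> {}\<close>, of p] arg_min_least[OF less.prems(1) \<open>J \<noteq> {}\<close>, of _ p] by (auto simp: b_def)
    show ?thesis
    proof (cases "J - {b} = {}")
      case True
      then have J: "J = {b}" using b by auto
      show ?thesis using less.prems unfolding J row_bound_def by (simp add: Pow_insert)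
    next
      case ne: False
      have fin: "finite (J - {b})" using less.prems by simp
      define a where "a = arg_min_on p (J - {b})"
      have a: "a \<in> J - {b}" "\<And>j. j \<in> J - {b} \<Longrightarrow> p a \<le> p j"
        using arg_min_if_finite(1)[OF fin ne, of p] arg_min_least[OF fin ne, of _ p] by (auto simp: a_def)
      define K where "K = J - {b} - {a}"
      have K: "finite K" "a \<notin> K" "b \<notin> K" "a \<noteq> b" "J = insert a (insert b K)" using a b fin by (auto simp: K_def)
      have s: "sum p K + p a + p b = 1" using less.prems(3) K by simp
      show ?thesis
      proof (cases "K = {}")
        case True
        have J: "J = {a, b}" using True K by simp
        have s: "p a + p b = 1" using s True by simp
        have "p x \<le> 1" if "x \<in> {a, b}" for x using that s pos[of a] pos[of b] J by auto
        then have "ent 1 (p a) + ent 1 (p b) \<le> ent 2 1"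
          using log_sum_inequality[of "{a, b}" p "\<lambda>_. 1"] less.prems(2) s K(4) pos[of a] pos[of b] J by auto
        then have e: "- xlx (p a) - xlx (p b) \<le> ln 2" by (simp add: ent_def xlx_def)
        have Pw: "Pow {a, b} = {{}, {a}, {b}, {a, b}}" by auto
        have n: "{a} \<noteq> {b}" "{a, b} \<noteq> {a}" "{a, b} \<noteq> {b}" using K(4) by auto
        have m: "1 - p a = p b" "1 - p b = p a" using s by auto
        have "row_bound J p = (xlx (p a) + xlx (p b)) / 2 - xlx (p b) - xlx (p a)"
          unfolding row_bound_def J Pw using n K(4) s by (simp add: shapley_def m add_divide_distrib)
        also have "\<dots> = (- xlx (p a) - xlx (p b)) / 2" by (simp add: field_simps)
        also have "\<dots> \<le> ln 2 / 2" using e by (rule divide_right_mono) simp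
        finally show ?thesis .
      next
        case False
        let ?q = "p(a := 0, b := p a + p b)"
        have "row_bound J p \<le> row_bound J ?q"
          unfolding K(5) using K False s pos b a by (intro row_bound_merge_le) auto
        also have "\<dots> = row_bound (insert b K) ?q"
          unfolding K(5) using K by (intro row_bound_drop_zero) auto
        also have "\<dots> \<le> ln 2 / 2"
        proof (rule less.hyps)
          show "card (insert b K) < card J" using K by simp
          have "sum ?q K = sum p K" using K by (intro sum.cong) auto
          then show "sum ?q (insert b K) = 1" using K s by simp
          fix j assume "j \<in> insert b K"
          then show "0 \<le> ?q j" using less.prems(2) K by auto
        qed (use K in auto)
        finally show ?thesis .
      qed
    qed
  qed
qed

lemma sum_shapley_containing:
  assumes "finite J"
  shows "(\<Sum>W\<in>Pow J. \<Sum>j\<in>W. shapley (card J) (card W) * f j) = sum f J"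
proof -
  have "(\<Sum>W\<in>Pow J. \<Sum>j\<in>W. shapley (card J) (card W) * f j)
      = (\<Sum>U\<in>Pow J. \<Sum>j\<in>J - U. shapley (card J) (card (insert j U)) * f j)"
    by (rule sum_Pow_swap[OF assms])
  also have "\<dots> = (\<Sum>U\<in>Pow J. \<Sum>j | j \<in> J \<and> j \<notin> U. shapley (card J) (Suc (card U)) * f j)"
    using assms by (intro sum.cong) (auto dest: finite_subset)
  also have "\<dots> = (\<Sum>j\<in>J. \<Sum>U | U \<in> Pow J \<and> j \<notin> U. shapley (card J) (Suc (card U)) * f j)"
    using assms by (intro sum.swap_restrict) auto
  also have "\<dots> = (\<Sum>j\<in>J. f j)"
  proof (intro sum.cong refl)
    fix j assume j: "j \<in> J"
    then have "card J = Suc (card (J - {j}))" using assms by (simp only: card_Suc_Diff1)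
    moreover have "{U. U \<in> Pow J \<and> j \<notin> U} = Pow (J - {j})" by auto
    ultimately show "(\<Sum>U | U \<in> Pow J \<and> j \<notin> U. shapley (card J) (Suc (card U)) * f j) = f j"
      using sum_shapley[of "J - {j}"] assms by (simp add: sum_distrib_right[symmetric])
  qed
  finally show ?thesis .
qed

text \<open>Expanding \<^const>\<open>local_ent\<close> into \<^const>\<open>xlx\<close> produces sums over pairs of a set and one of its
elements. Removing the element from the set turns these into sums over sets, because
\<open>(d - u) shapley d (u + 1) = u shapley d u\<close>.\<close>

lemma local_ent_average:
  assumes "finite J" "sum p J = 1"
  shows "(\<Sum>W\<in>Pow J. shapley (card J) (card W) * local_ent W p)
    + (\<Sum>j\<in>J. ent 1 (1 - p j)) - local_ent J p = 2 * row_bound J p"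
proof -
  let ?v = "\<lambda>W. shapley (card J) (card W)"
  have N: "local_ent W p = (\<Sum>j\<in>W. xlx (sum p (W - {j}))) - (\<Sum>j\<in>W. xlx (p j)) - (real (card W) - 2) * xlx (sum p W)"
    if "W \<in> Pow J" for W
  proof -
    have W: "finite W" using that assms by (auto intro: finite_subset)
    have "(\<Sum>j\<in>W. xlx (sum p W - p j)) = (\<Sum>j\<in>W. xlx (sum p (W - {j})))"
      using W by (intro sum.cong) (auto simp: sum_diff1)
    then show ?thesis unfolding local_ent_xlx[OF W] by (simp add: sum_subtractf)
  qed
  have "(\<Sum>W\<in>Pow J. \<Sum>j\<in>W. ?v W * xlx (sum p (W - {j})))
      = (\<Sum>U\<in>Pow J. \<Sum>j\<in>J - U. ?v (insert j U) * xlx (sum p (insert j U - {j})))"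
    by (rule sum_Pow_swap[OF assms(1)])
  also have "\<dots> = (\<Sum>U\<in>Pow J. real (card U) * ?v U * xlx (sum p U))"
  proof (intro sum.cong refl)
    fix U assume U: "U \<in> Pow J"
    then have f: "finite U" using assms by (auto intro: finite_subset)
    have c: "card (J - U) = card J - card U" "card U \<le> card J"
      using U f assms by (auto simp: card_Diff_subset card_mono)
    have "(\<Sum>j\<in>J - U. ?v (insert j U) * xlx (sum p (insert j U - {j})))
        = (\<Sum>j\<in>J - U. shapley (card J) (Suc (card U)) * xlx (sum p U))"
      using f by (intro sum.cong) auto
    also have "\<dots> = real (card J - card U) * shapley (card J) (Suc (card U)) * xlx (sum p U)"
      using c by simp
    also have "\<dots> = real (card U) * ?v U * xlx (sum p U)"
    proof (cases "U = {} \<or> U = J")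
      case True
      then show ?thesis using assms(2) by auto
    next
      case False
      then have "card U < card J" "card U \<noteq> 0"
        using U f assms(1) by (auto intro!: psubset_card_mono)
      from shapley_mult[OF this] show ?thesis by (rule arg_cong)
    qed
    finally show "(\<Sum>j\<in>J - U. ?v (insert j U) * xlx (sum p (insert j U - {j}))) = real (card U) * ?v U * xlx (sum p U)" .
  qed
  finally have A: "(\<Sum>W\<in>Pow J. ?v W * (\<Sum>j\<in>W. xlx (sum p (W - {j}))))
      = (\<Sum>U\<in>Pow J. real (card U) * ?v U * xlx (sum p U))"
    by (simp add: sum_distrib_left)
  have B: "(\<Sum>W\<in>Pow J. ?v W * (\<Sum>j\<in>W. xlx (p j))) = (\<Sum>j\<in>J. xlx (p j))"
    using sum_shapley_containing[OF assms(1)] by (simp add: sum_distrib_left)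
  have "(\<Sum>W\<in>Pow J. ?v W * local_ent W p) = (\<Sum>W\<in>Pow J. ?v W * (\<Sum>j\<in>W. xlx (sum p (W - {j})))
      - ?v W * (\<Sum>j\<in>W. xlx (p j)) - (real (card W) * ?v W * xlx (sum p W) - 2 * (?v W * xlx (sum p W))))"
    by (intro sum.cong refl) (simp add: N algebra_simps)
  also have "\<dots> = - (\<Sum>j\<in>J. xlx (p j)) + 2 * (\<Sum>W\<in>Pow J. ?v W * xlx (sum p W))"
    by (simp only: sum_subtractf A B sum_distrib_left[of "2::real"])
  finally have C: "(\<Sum>W\<in>Pow J. ?v W * local_ent W p) = - (\<Sum>j\<in>J. xlx (p j)) + 2 * (\<Sum>W\<in>Pow J. ?v W * xlx (sum p W))" .
  have D: "local_ent J p = (\<Sum>j\<in>J. ent 1 (p j)) - (\<Sum>j\<in>J. ent 1 (1 - p j))"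
    by (simp add: local_ent_def assms(2) sum_subtractf)
  have E: "ent 1 x = - xlx x" for x by (simp add: ent_def xlx_def)
  show ?thesis unfolding C D E row_bound_def by (simp add: sum_negf)
qed

section \<open>Sums over the layers of a graph\<close>

text \<open>A symmetric function on the edges of a graph in which the depths of adjacent vertices differ by
one. The edges between depth \<open>k\<close> and depth \<open>k + 1\<close> form the layer \<open>k\<close>.\<close>

locale layered =
  fixes adj :: "'v::finite \<Rightarrow> 'v \<Rightarrow> bool" and d :: "'v \<Rightarrow> nat" and f :: "'v \<Rightarrow> 'v \<Rightarrow> real"
  assumes sym: "f x y = f y x"
    and off: "\<not> adj x y \<Longrightarrow> f x y = 0"
    and depth: "adj x y \<Longrightarrow> d y = Suc (d x) \<or> d x = Suc (d y)"
begin

definition layer :: "nat \<Rightarrow> real" where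
  "layer k = (\<Sum>x | d x = k. \<Sum>y | d y = Suc k. f x y)"

lemma sum_at_vertex:
  "(\<Sum>y\<in>UNIV. f x y) = (\<Sum>y | d x = Suc (d y). f x y) + (\<Sum>y | d y = Suc (d x). f x y)"
proof -
  have "(\<Sum>y\<in>UNIV. f x y) = (\<Sum>y \<in> {y. d x = Suc (d y)} \<union> {y. d y = Suc (d x)}. f x y)"
    using off depth by (intro sum.mono_neutral_right) auto
  also have "\<dots> = (\<Sum>y | d x = Suc (d y). f x y) + (\<Sum>y | d y = Suc (d x). f x y)"
    by (intro sum.union_disjoint) auto
  finally show ?thesis .
qed

lemma layer_from_above: "layer k = (\<Sum>y | d y = Suc k. \<Sum>x | d x = k. f y x)"
  unfolding layer_def by (subst sum.swap) (simp add: sym)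

lemma sum_at_layer_Suc: "(\<Sum>x | d x = Suc k. \<Sum>y\<in>UNIV. f x y) = layer k + layer (Suc k)"
proof -
  have "(\<Sum>x | d x = Suc k. \<Sum>y\<in>UNIV. f x y) = (\<Sum>x | d x = Suc k. (\<Sum>y | d y = k. f x y) + (\<Sum>y | d y = Suc (Suc k). f x y))"
  proof (intro sum.cong refl)
    fix x assume "x \<in> {x. d x = Suc k}"
    then have "{y. d x = Suc (d y)} = {y. d y = k}" "{y. d y = Suc (d x)} = {y. d y = Suc (Suc k)}" by auto
    then show "(\<Sum>y\<in>UNIV. f x y) = (\<Sum>y | d y = k. f x y) + (\<Sum>y | d y = Suc (Suc k). f x y)"
      by (simp only: sum_at_vertex)
  qed
  then show ?thesis unfolding layer_from_above[of k] by (simp add: layer_def sum.distrib)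
qed

lemma sum_at_layer_0: "(\<Sum>x | d x = 0. \<Sum>y\<in>UNIV. f x y) = layer 0"
  by (simp add: layer_def sum_at_vertex)

lemma sum_layers:
  assumes "\<And>x. d x < K"
  shows "(\<Sum>x\<in>UNIV. \<Sum>y\<in>UNIV. f x y) = 2 * (\<Sum>k<K. layer k)"
proof -
  let ?up = "\<Sum>x\<in>UNIV. \<Sum>y | d y = Suc (d x). f x y"
  have "?up = (\<Sum>k<K. \<Sum>x | x \<in> UNIV \<and> d x = k. \<Sum>y | d y = Suc (d x). f x y)"
    using assms by (intro sum.group[symmetric]) auto
  also have "\<dots> = (\<Sum>k<K. layer k)"
    unfolding layer_def by (intro sum.cong) auto
  finally have up: "?up = (\<Sum>k<K. layer k)" .
  have "(\<Sum>x\<in>UNIV. \<Sum>y | d x = Suc (d y). f x y) = (\<Sum>y\<in>UNIV. \<Sum>x | d x = Suc (d y). f x y)"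
    using sum.swap_restrict[of UNIV UNIV f "\<lambda>x y. d x = Suc (d y)"] by simp
  also have "\<dots> = ?up" by (simp add: sym)
  finally show ?thesis by (simp add: sum_at_vertex sum.distrib up)
qed

lemma layer_outside:
  assumes "\<And>x. d x < K"
  shows "layer (K - 1) = 0"
proof -
  have "d y \<noteq> Suc (K - 1)" for y using assms[of y] by linarith
  then have "{y. d y = Suc (K - 1)} = {}" by auto
  then show ?thesis by (simp add: layer_def)
qed

end

text \<open>The premise \<open>vertex\<close> summed over the vertices of depth \<open>s + 1, s + 3, \<dots>\<close> bounds the \<open>b\<close>-sum of all
layers from \<open>s\<close> on by their \<open>a\<close>-sum (\<open>tail\<close>). The premise \<open>edge\<close> at the unique upward edge of
a vertex of small depth bounds the \<open>b\<close>-sum of a layer by the \<open>a\<close>-sum of the next one (\<open>step\<close>).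
Using \<open>step\<close> before layer \<open>s\<close> and \<open>tail\<close> after it, everything but the \<open>b\<close>-sum of layer \<open>s\<close> cancels.
The conclusion adds these estimates over \<open>s = 1, \<dots>, m - 1\<close>; the double sums count every edge
twice.\<close>

lemma layered_cost_bound:
  fixes a b :: "'v::finite \<Rightarrow> 'v \<Rightarrow> real" and d :: "'v \<Rightarrow> nat"
  assumes la: "layered adj d a" and lb: "layered adj d b"
    and nn: "\<And>x y. 0 \<le> a x y" "\<And>x y. 0 \<le> b x y"
    and vertex: "\<And>x. (\<Sum>y\<in>UNIV. b x y) \<le> (\<Sum>y\<in>UNIV. a x y)"
    and edge: "\<And>x y. b x y \<le> (\<Sum>z\<in>UNIV - {y}. a x z)"
    and root: "\<And>x. d x = 0 \<longleftrightarrow> x = r"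
    and uniq: "\<And>x y z. adj x y \<Longrightarrow> adj x z \<Longrightarrow> d x = Suc (d y) \<Longrightarrow> d x = Suc (d z) \<Longrightarrow> d x < m \<Longrightarrow> y = z"
  shows "real (m - 1) * ((\<Sum>x\<in>UNIV. \<Sum>y\<in>UNIV. b x y) / 2 - ((\<Sum>x\<in>UNIV. \<Sum>y\<in>UNIV. a x y) / 2 - (\<Sum>y\<in>UNIV. a r y)))
     \<le> (\<Sum>x\<in>UNIV. \<Sum>y\<in>UNIV. b x y) / 2 - (\<Sum>y\<in>UNIV. b r y)"
proof -
  interpret a: layered adj d a by (rule la)
  interpret b: layered adj d b by (rule lb)
  \<comment> \<open>More layers than exist, and more than \<open>m\<close>, so that all index ranges below are contained.\<close>
  define K where "K = m + Suc (Max (range d))"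
  have K: "d x < K" for x
  proof -
    have "d x \<le> Max (range d)" by simp
    then show ?thesis unfolding K_def by linarith
  qed
  have mK: "m < K" by (simp add: K_def)
  have layer_nonneg: "0 \<le> b.layer k" for k
    unfolding b.layer_def using nn by (auto intro!: sum_nonneg)
  have two: "b.layer k + b.layer (Suc k) \<le> a.layer k + a.layer (Suc k)" for k
    unfolding a.sum_at_layer_Suc[symmetric] b.sum_at_layer_Suc[symmetric]
    by (intro sum_mono vertex)
  have tail: "(\<Sum>k\<in>{s..<K}. b.layer k) \<le> (\<Sum>k\<in>{s..<K}. a.layer k)" for s
  proof (induction "K - s" arbitrary: s rule: less_induct)
    case less
    consider "K \<le> s" | "s = K - 1" "s < K" | "Suc s < K" by linarith
    then show ?case
    proof cases
      case 2
      then have "{s..<K} = {K - 1}" by auto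
      then show ?thesis using a.layer_outside[OF K] b.layer_outside[OF K] by simp
    next
      case 3
      then have "(\<Sum>k\<in>{Suc (Suc s)..<K}. b.layer k) \<le> (\<Sum>k\<in>{Suc (Suc s)..<K}. a.layer k)"
        by (intro less) auto
      then show ?thesis using 3 two[of s] by (simp add: sum.atLeast_Suc_lessThan)
    qed auto
  qed
  have step: "b.layer k \<le> a.layer (Suc k)" if "Suc k < m" for k
  proof -
    have "b.layer k = (\<Sum>x | d x = Suc k. \<Sum>y | d y = k. b x y)" by (rule b.layer_from_above)
    also have "\<dots> \<le> (\<Sum>x | d x = Suc k. \<Sum>y | d y = Suc (Suc k). a x y)"
    proof (intro sum_mono)
      fix x assume "x \<in> {x. d x = Suc k}"
      then have x: "d x = Suc k" by simp
      show "(\<Sum>y | d y = k. b x y) \<le> (\<Sum>y | d y = Suc (Suc k). a x y)"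
      proof (cases "\<exists>y. adj x y \<and> d y = k")
        case False
        then have "(\<Sum>y | d y = k. b x y) = 0" using b.off by (intro sum.neutral) auto
        then show ?thesis using nn by (simp add: sum_nonneg)
      next
        case True
        then obtain y where y: "adj x y" "d y = k" by auto
        have other: "\<not> adj x z" if "d z = k" "z \<noteq> y" for z
          using uniq[of x y z] y that x \<open>Suc k < m\<close> by auto
        have "(\<Sum>z | d z = k. b x z) = (\<Sum>z\<in>{y}. b x z)"
          using other y b.off by (intro sum.mono_neutral_right) auto
        also have "\<dots> \<le> (\<Sum>z\<in>UNIV - {y}. a x z)" using edge by simp
        also have "\<dots> = (\<Sum>z | d z = Suc (Suc k). a x z)"
        proof (intro sum.mono_neutral_right ballI)
          fix z assume "z \<in> UNIV - {y} - {z. d z = Suc (Suc k)}"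
          then have "\<not> adj x z" using a.depth[of x z] x other[of z] by auto
          then show "a x z = 0" by (rule a.off)
        qed (use y in auto)
        finally show ?thesis .
      qed
    qed
    also have "\<dots> = a.layer (Suc k)" by (simp add: a.layer_def)
    finally show ?thesis .
  qed
  define B where "B = (\<Sum>k<K. b.layer k)"
  define A1 where "A1 = (\<Sum>k\<in>{1..<K}. a.layer k)"
  have each: "B - A1 \<le> b.layer s" if s: "s \<in> {1..<m}" for s
  proof -
    have "B = (\<Sum>k<s. b.layer k) + (b.layer s + (\<Sum>k\<in>{Suc s..<K}. b.layer k))"
    proof -
      have "B = (\<Sum>k\<in>{0..<s}. b.layer k) + (\<Sum>k\<in>{s..<K}. b.layer k)"
        unfolding B_def using s mK by (subst sum.atLeastLessThan_concat) (auto simp: lessThan_atLeast0)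
      then show ?thesis using s mK by (simp add: sum.atLeast_Suc_lessThan lessThan_atLeast0)
    qed
    also have "\<dots> \<le> (\<Sum>k<s. a.layer (Suc k)) + (b.layer s + (\<Sum>k\<in>{Suc s..<K}. a.layer k))"
      using s by (intro add_mono sum_mono step tail order_refl) auto
    also have "(\<Sum>k<s. a.layer (Suc k)) = (\<Sum>k\<in>{1..<Suc s}. a.layer k)"
      by (simp add: sum.shift_bounds_Suc_ivl lessThan_atLeast0 del: sum.op_ivl_Suc)
    also have "(\<Sum>k\<in>{1..<Suc s}. a.layer k) + (b.layer s + (\<Sum>k\<in>{Suc s..<K}. a.layer k)) = A1 + b.layer s"
    proof -
      have "A1 = (\<Sum>k\<in>{1..<Suc s}. a.layer k) + (\<Sum>k\<in>{Suc s..<K}. a.layer k)"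
        unfolding A1_def using s mK by (subst sum.atLeastLessThan_concat) auto
      then show ?thesis by simp
    qed
    finally show ?thesis by simp
  qed
  have split0: "(\<Sum>k<K. g k) = g 0 + (\<Sum>k\<in>{1..<K}. g k)" for g :: "nat \<Rightarrow> real"
    using mK by (simp add: sum.atLeast_Suc_lessThan lessThan_atLeast0)
  have "real (m - 1) * (B - A1) = (\<Sum>s\<in>{1..<m}. B - A1)" by simp
  also have "\<dots> \<le> (\<Sum>s\<in>{1..<m}. b.layer s)" by (intro sum_mono each)
  also have "\<dots> \<le> (\<Sum>s\<in>{1..<K}. b.layer s)" using mK layer_nonneg by (intro sum_mono2) auto
  also have "\<dots> = B - b.layer 0" using split0[of b.layer] by (simp add: B_def)
  finally have *: "real (m - 1) * (B - A1) \<le> B - b.layer 0" .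
  have "{x. d x = 0} = {r}" using root by auto
  then have l0: "a.layer 0 = (\<Sum>y\<in>UNIV. a r y)" "b.layer 0 = (\<Sum>y\<in>UNIV. b r y)"
    using a.sum_at_layer_0 b.sum_at_layer_0 by simp_all
  have e: "(\<Sum>x\<in>UNIV. \<Sum>y\<in>UNIV. b x y) / 2 = B" "(\<Sum>x\<in>UNIV. \<Sum>y\<in>UNIV. a x y) / 2 = a.layer 0 + A1"
    using a.sum_layers[OF K] b.sum_layers[OF K] split0[of a.layer] by (simp_all add: B_def A1_def)
  show ?thesis unfolding e using * by (simp add: l0)
qed

section \<open>Distances in a graph of large girth\<close>

lemma girth_le_cycle:
  assumes "is_cycle G c"
  shows "girth G \<le> enat (length c)"
  unfolding girth_def using assms by (intro INF_lower) simp

lemma cycle_edges_subset: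
  assumes c: "c \<noteq> []" and succ: "successively (\<lambda>x y. {x, y} \<in> F) c" and closing: "{last c, hd c} \<in> F"
  shows "cycle_edges c \<subseteq> F"
proof
  fix e assume "e \<in> cycle_edges c"
  then obtain k where k: "k < length c" "e = {c ! k, c ! (Suc k mod length c)}"
    by (auto simp: cycle_edges_def)
  show "e \<in> F"
  proof (cases "Suc k < length c")
    case True
    then show ?thesis using k succ by (simp add: successively_conv_nth)
  next
    case False
    then have "Suc k = length c" using k by simp
    then have "c ! k = last c" "c ! 0 = hd c" using c by (auto simp: last_conv_nth hd_conv_nth intro: arg_cong[where f = "\<lambda>i. c ! i"])
    then show ?thesis using k closing \<open>Suc k = length c\<close> by simp
  qed
qed

text \<open>Follow the parents upward from the two neighbours \<open>y\<close> and \<open>z\<close> of \<open>x\<close> until the two paths meet for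
the first time, at the latest at the root. Vertices at different depths are distinct, so the two
paths together with \<open>x\<close> form a cycle.\<close>

lemma two_parents_give_short_cycle:
  fixes d :: "'v \<Rightarrow> nat"
  assumes verts: "verts G = UNIV" and adj: "\<And>x y. adj x y \<Longrightarrow> {x, y} \<in> edges G"
    and sym: "\<And>x y. adj x y \<Longrightarrow> adj y x"
    and root: "\<And>x. d x = 0 \<longleftrightarrow> x = r"
    and parent: "\<And>x. x \<noteq> r \<Longrightarrow> d x \<le> N \<Longrightarrow> adj x (par x) \<and> d x = Suc (d (par x))"
    and x: "adj x y" "adj x z" "d x = Suc (d y)" "d x = Suc (d z)" "y \<noteq> z" "d x \<le> N"
  shows "girth G \<le> enat (2 * d x)"
proof -
  define Y where "Y t = (par ^^ t) y" for t
  define Z where "Z t = (par ^^ t) z" for t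
  have dw: "d ((par ^^ t) w) + t = d w" if "t \<le> d w" "d w \<le> N" for t w
    using that
  proof (induction t)
    case (Suc t)
    then have "d ((par ^^ t) w) + t = d w" by simp
    then have "(par ^^ t) w \<noteq> r" "d ((par ^^ t) w) \<le> N" using Suc.prems root[of "(par ^^ t) w"] by auto
    from parent[OF this] show ?case using \<open>d ((par ^^ t) w) + t = d w\<close> by simp
  qed simp
  have dY: "d (Y t) + t = d y" and dZ: "d (Z t) + t = d y" if "t \<le> d y" for t
    using dw[of t y] dw[of t z] that x by (auto simp: Y_def Z_def)
  have "Y (d y) = Z (d y)" using dY[of "d y"] dZ[of "d y"] root by simp
  define t0 where "t0 = (LEAST t. Y t = Z t)"
  have t0: "Y t0 = Z t0" "t0 \<le> d y"
    unfolding t0_def by (rule LeastI[of "\<lambda>t. Y t = Z t"] Least_le; fact)+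
  have lt: "Y t \<noteq> Z t" if "t < t0" for t
    using not_less_Least[of t "\<lambda>t. Y t = Z t"] that by (simp add: t0_def)
  have "Y 0 \<noteq> Z 0" using x(5) by (simp add: Y_def Z_def)
  then have "t0 \<noteq> 0" using t0(1) by metis
  then obtain t1 where t1: "t0 = Suc t1" by (cases t0) auto
  have stepY: "adj (Y t) (Y (Suc t))" and stepZ: "adj (Z t) (Z (Suc t))" if "t < t0" for t
  proof -
    have "d (Y t) + t = d y" "d (Z t) + t = d y" using dY[of t] dZ[of t] that t0 by auto
    then have "d (Y t) \<noteq> 0" "d (Z t) \<noteq> 0" "d (Y t) \<le> N" "d (Z t) \<le> N" using that t0 x by auto
    then show "adj (Y t) (Y (Suc t))" "adj (Z t) (Z (Suc t))"
      using parent[of "Y t"] parent[of "Z t"] root by (auto simp: Y_def Z_def)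
  qed
  \<comment> \<open>Down from \<open>x\<close> along \<open>Y\<close> to the meeting point \<open>Y t0\<close> and back along \<open>Z\<close>.\<close>
  define c where "c = x # map Y [0..<Suc t0] @ rev (map Z [0..<t0])"
  let ?P = "\<lambda>x y. {x, y} \<in> edges G"
  have P: "?P (Y t) (Y (Suc t))" "?P (Z (Suc t)) (Z t)" if "t < t0" for t
    using stepY[OF that] stepZ[OF that] adj by (auto simp: insert_commute)
  have "successively ?P (map Y [0..<Suc t0])"
    using P by (auto simp: successively_conv_nth simp del: upt_Suc)
  moreover have "successively (\<lambda>x y. ?P y x) (map Z [0..<t0])"
    using P by (auto simp: successively_conv_nth simp del: upt_Suc)
  moreover have "?P (Y t0) (Z t1)" unfolding t0(1) using P(2)[of t1] by (simp add: t1)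
  moreover have "?P x (Y 0)" using adj x by (simp add: Y_def)
  ultimately have succ: "successively ?P c"
    unfolding c_def
    by (auto simp: successively_Cons successively_append_iff successively_rev hd_map hd_append
        hd_rev last_map t1 simp del: upt_Suc map_append)
  have "last c = z"
    unfolding c_def t1 by (simp add: Z_def last_rev upt_rec del: upt_Suc)
  moreover have "hd c = x" by (simp add: c_def)
  moreover have "{z, x} \<in> edges G" using adj[OF x(2)] by (simp add: insert_commute)
  ultimately have sub: "cycle_edges c \<subseteq> edges G"
    by (intro cycle_edges_subset succ) (auto simp: c_def)
  have "inj_on Y {0..<Suc t0}" "inj_on Z {0..<t0}"
    using dY dZ t0(2) by (auto intro!: inj_onI) (metis add_left_cancel le_trans less_Suc_eq_le less_imp_le)+
  moreover have YZ: "Y s \<noteq> Z t" if "s \<le> t0" "t < t0" for s t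
  proof
    assume e: "Y s = Z t"
    then have "s = t" using dY[of s] dZ[of t] that t0(2) by simp
    then show False using e lt that by simp
  qed
  have ne: "x \<noteq> Y s" "x \<noteq> Z s" if "s \<le> t0" for s
    using dY[of s] dZ[of s] that t0(2) x by auto
  moreover have "x \<notin> Y ` {0..<Suc t0}" "x \<notin> Z ` {0..<t0}" 
    using ne by (metis image_iff atLeastLessThan_iff less_Suc_eq_le less_imp_le)+
  moreover have "Y ` {0..<Suc t0} \<inter> Z ` {0..<t0} = {}" using YZ by auto
  ultimately have "distinct c"
    unfolding c_def by (simp add: distinct_map del: upt_Suc)
  moreover have len: "length c = 2 * t0 + 2" by (simp add: c_def)
  ultimately have "is_cycle G c" using sub t1 verts by (simp add: is_cycle_def)
  from girth_le_cycle[OF this] show ?thesis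
    unfolding len using t0(2) x by (simp add: order.trans)
qed

definition adjacent :: "('n \<times> 'n) set \<Rightarrow> 'n + 'n \<Rightarrow> 'n + 'n \<Rightarrow> bool" where
  "adjacent E x y \<longleftrightarrow> (\<exists>i j. (i, j) \<in> E \<and> (x = Inl i \<and> y = Inr j \<or> x = Inr j \<and> y = Inl i))"

lemma adjacent_sym: "adjacent E x y \<Longrightarrow> adjacent E y x"
  by (auto simp: adjacent_def)

text \<open>Walks instead of paths: their lengths have a parity that is determined by the end point.\<close>

definition reach :: "('n \<times> 'n) set \<Rightarrow> 'n \<Rightarrow> nat \<Rightarrow> 'n + 'n \<Rightarrow> bool" where
  "reach E v k x \<longleftrightarrow> (adjacent E ^^ k) (Inl v) x"

text \<open>The distance from the row \<open>v\<close>. Vertices that cannot be reached from \<open>v\<close> get a large value of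
the parity of their side, so that adjacent vertices always differ by one and so that no such
vertex has a depth below \<open>m\<close>.\<close>

definition depth :: "('n \<times> 'n) set \<Rightarrow> 'n \<Rightarrow> nat \<Rightarrow> 'n + 'n \<Rightarrow> nat" where
  "depth E v m x = (if \<exists>k. reach E v k x then LEAST k. reach E v k x
     else if isl x then 2 * m else 2 * m + 1)"

lemma reach_parity: "reach E v k x \<Longrightarrow> even k \<longleftrightarrow> isl x"
proof (induction k arbitrary: x)
  case (Suc k)
  then obtain y where "reach E v k y" "adjacent E y x" by (auto simp: reach_def)
  with Suc.IH[of y] show ?case by (auto simp: adjacent_def)
qed (auto simp: reach_def)

lemma reach_Suc: "reach E v k x \<Longrightarrow> adjacent E x y \<Longrightarrow> reach E v (Suc k) y"
  by (auto simp: reach_def)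

lemma depth_reach: "reach E v k x \<Longrightarrow> reach E v (depth E v m x) x \<and> depth E v m x \<le> k"
  unfolding depth_def by (auto intro: LeastI Least_le)

lemma depth_adjacent:
  assumes "adjacent E x y"
  shows "depth E v m y = Suc (depth E v m x) \<or> depth E v m x = Suc (depth E v m y)"
proof (cases "\<exists>k. reach E v k x")
  case True
  then obtain k where "reach E v k x" by auto
  then have dx: "reach E v (depth E v m x) x" using depth_reach[of E v k x] by blast
  from depth_reach[OF reach_Suc[OF this assms], of m]
  have dy: "reach E v (depth E v m y) y" "depth E v m y \<le> Suc (depth E v m x)" by auto
  have "depth E v m x \<le> Suc (depth E v m y)"
    using depth_reach[OF reach_Suc[OF dy(1) adjacent_sym[OF assms]], of m] by simp
  moreover have "even (depth E v m x) \<noteq> even (depth E v m y)"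
    using reach_parity[OF dx] reach_parity[OF dy(1)] assms by (auto simp: adjacent_def)
  ultimately show ?thesis using dy(2) by presburger
next
  case False
  moreover from this have "\<not> (\<exists>k. reach E v k y)"
    using reach_Suc[of E v _ y x] adjacent_sym[OF assms] by blast
  ultimately show ?thesis using assms by (auto simp: depth_def adjacent_def)
qed

lemma depth_root:
  assumes "0 < m"
  shows "depth E v m x = 0 \<longleftrightarrow> x = Inl v"
proof
  assume 0: "depth E v m x = 0"
  then have "\<exists>k. reach E v k x" using assms by (auto simp: depth_def split: if_splits)
  then obtain k where "reach E v k x" ..
  then have "reach E v 0 x" using depth_reach[of E v k x m] 0 by simp
  then show "x = Inl v" by (simp add: reach_def)
next
  assume "x = Inl v"
  then have "reach E v 0 x" by (simp add: reach_def)
  then show "depth E v m x = 0" using depth_reach[of E v 0 x m] by simp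
qed

lemma depth_parent:
  assumes "x \<noteq> Inl v" "depth E v m x < 2 * m"
  shows "\<exists>y. adjacent E x y \<and> depth E v m x = Suc (depth E v m y)"
proof -
  have m: "0 < m" using assms by auto
  obtain l where "reach E v l x" using assms by (auto simp: depth_def split: if_splits)
  then have r: "reach E v (depth E v m x) x" using depth_reach[of E v l x m] by simp
  obtain k where k: "depth E v m x = Suc k" using depth_root[OF m, of E v x] assms by (cases "depth E v m x") auto
  then obtain y where y: "reach E v k y" "adjacent E y x" using r by (auto simp: reach_def)
  have "depth E v m y \<le> k" using depth_reach[OF y(1)] by auto
  then show ?thesis using depth_adjacent[OF y(2), of v m] k adjacent_sym[OF y(2)] by auto
qed

lemma depth_unique_parent:
  assumes g: "\<not> girth G < enat (2 * m)" "verts G = UNIV" "\<And>x y. adjacent E x y \<Longrightarrow> {x, y} \<in> edges G"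
    and x: "adjacent E x y" "adjacent E x z" "depth E v m x = Suc (depth E v m y)" "depth E v m x = Suc (depth E v m z)" "depth E v m x < m"
  shows "y = z"
proof (rule ccontr)
  assume "y \<noteq> z"
  have m: "0 < m" using x by simp
  define par where "par x = (SOME y. adjacent E x y \<and> depth E v m x = Suc (depth E v m y))" for x
  have "girth G \<le> enat (2 * depth E v m x)"
  proof (rule two_parents_give_short_cycle[where adj = "adjacent E" and r = "Inl v" and N = m and par = par])
    fix x assume "x \<noteq> Inl v" "depth E v m x \<le> m"
    then have "\<exists>y. adjacent E x y \<and> depth E v m x = Suc (depth E v m y)" using m by (intro depth_parent) auto
    then show "adjacent E x (par x) \<and> depth E v m x = Suc (depth E v m (par x))"
      unfolding par_def by (rule someI_ex)
  qed (use g x \<open>y \<noteq> z\<close> adjacent_sym[of E] depth_root[OF m, of E v] in auto)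
  also have "\<dots> < enat (2 * m)" using x by simp
  finally show False using g by simp
qed

section \<open>Revealing one value of a random permutation\<close>

context
  fixes x :: "'k::finite \<Rightarrow> 'l::finite \<Rightarrow> real"
  assumes nn: "\<And>k l. 0 \<le> x k l"
begin

text \<open>A space is partitioned into parts \<open>k\<close> and also into events \<open>l\<close>, and \<open>x k l\<close> is the
mass of their intersection. This is the amount by which the entropy term of \<open>l\<close> drops when the
part is revealed.\<close>

definition drop_in :: "'l \<Rightarrow> real" where
  "drop_in l = ent (\<Sum>k\<in>UNIV. \<Sum>l\<in>UNIV. x k l) (\<Sum>k\<in>UNIV. x k l)
     - (\<Sum>k\<in>UNIV. ent (\<Sum>l\<in>UNIV. x k l) (x k l))"

text \<open>The same drop for the complementary event.\<close>

definition drop_out :: "'l \<Rightarrow> real" where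
  "drop_out l = ent (\<Sum>k\<in>UNIV. \<Sum>l\<in>UNIV. x k l) ((\<Sum>k\<in>UNIV. \<Sum>l\<in>UNIV. x k l) - (\<Sum>k\<in>UNIV. x k l))
     - (\<Sum>k\<in>UNIV. ent (\<Sum>l\<in>UNIV. x k l) ((\<Sum>l\<in>UNIV. x k l) - x k l))"

lemma fam_le: "x k l \<le> (\<Sum>l\<in>UNIV. x k l)"
  using nn by (intro member_le_sum) auto

lemma drop_in_nonneg: "0 \<le> drop_in l"
  unfolding drop_in_def using log_sum_inequality[of UNIV "\<lambda>k. x k l" "\<lambda>k. \<Sum>l\<in>UNIV. x k l"] nn fam_le by simp

lemma drop_out_nonneg: "0 \<le> drop_out l"
  unfolding drop_out_def
  using log_sum_inequality[of UNIV "\<lambda>k. (\<Sum>l\<in>UNIV. x k l) - x k l" "\<lambda>k. \<Sum>l\<in>UNIV. x k l"] nn fam_le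
  by (simp add: sum_subtractf)

lemma drop_vertex: "(\<Sum>l\<in>UNIV. drop_out l) \<le> (\<Sum>l\<in>UNIV. drop_in l)"
proof -
  have "(\<Sum>k\<in>UNIV. local_ent UNIV (x k)) \<le> local_ent UNIV (\<lambda>l. \<Sum>k\<in>UNIV. x k l)"
    using nn by (intro local_ent_superadd) auto
  moreover have "(\<Sum>l\<in>UNIV. \<Sum>k\<in>UNIV. x k l) = (\<Sum>k\<in>UNIV. \<Sum>l\<in>UNIV. x k l)" by (rule sum.swap)
  ultimately show ?thesis
    unfolding local_ent_def drop_in_def drop_out_def
    by (simp add: sum_subtractf sum.swap[of _ "UNIV :: 'k set" "UNIV :: 'l set"])
qed

text \<open>The entropy terms of the events \<open>l \<noteq> e\<close> minus the entropy term of the complement of \<open>e\<close> give the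
entropy of the distribution conditioned on the complement of \<open>e\<close>, whose drops are nonnegative.\<close>

lemma drop_edge: "drop_out e \<le> (\<Sum>l\<in>UNIV - {e}. drop_in l)"
proof -
  have id: "(\<Sum>l\<in>UNIV - {e}. ent (sum y UNIV) (y l)) - ent (sum y UNIV) (sum y UNIV - y e)
      = (\<Sum>l\<in>UNIV - {e}. ent (sum y UNIV - y e) (y l))" for y :: "'l \<Rightarrow> real"
  proof -
    have s: "(\<Sum>l\<in>UNIV - {e}. y l) = sum y UNIV - y e" by (simp add: sum_diff1)
    have "(\<Sum>l\<in>UNIV - {e}. ent (sum y UNIV) (y l)) = (\<Sum>l\<in>UNIV - {e}. y l) * ln (sum y UNIV) - (\<Sum>l\<in>UNIV - {e}. y l * ln (y l))"
      by (simp only: ent_def right_diff_distrib sum_subtractf sum_distrib_right)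
    moreover have "(\<Sum>l\<in>UNIV - {e}. ent (sum y UNIV - y e) (y l)) = (\<Sum>l\<in>UNIV - {e}. y l) * ln (sum y UNIV - y e) - (\<Sum>l\<in>UNIV - {e}. y l * ln (y l))"
      by (simp only: ent_def right_diff_distrib sum_subtractf sum_distrib_right)
    ultimately show ?thesis unfolding s by (simp add: ent_def algebra_simps)
  qed
  let ?y = "\<lambda>l. \<Sum>k\<in>UNIV. x k l"
  have M: "(\<Sum>k\<in>UNIV. \<Sum>l\<in>UNIV. x k l) = sum ?y UNIV" by (rule sum.swap)
  have "(\<Sum>l\<in>UNIV - {e}. drop_in l) - drop_out e
     = ((\<Sum>l\<in>UNIV - {e}. ent (sum ?y UNIV) (?y l)) - ent (sum ?y UNIV) (sum ?y UNIV - ?y e))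
     - (\<Sum>k\<in>UNIV. (\<Sum>l\<in>UNIV - {e}. ent (sum (x k) UNIV) (x k l)) - ent (sum (x k) UNIV) (sum (x k) UNIV - x k e))"
    unfolding drop_in_def drop_out_def M sum_subtractf
    by (simp add: sum.swap[of _ "UNIV :: 'k set" "UNIV - {e}"])
  also have "\<dots> = (\<Sum>l\<in>UNIV - {e}. ent (sum ?y UNIV - ?y e) (?y l) - (\<Sum>k\<in>UNIV. ent (sum (x k) UNIV - x k e) (x k l)))"
    unfolding id[of ?y] id[of "x _"] sum_subtractf by (simp add: sum.swap[of _ "UNIV :: 'k set" "UNIV - {e}"])
  also have "0 \<le> \<dots>"
  proof (rule sum_nonneg)
    fix l assume l: "l \<in> UNIV - {e}"
    have "(\<Sum>k\<in>UNIV. ent (sum (x k) UNIV - x k e) (x k l)) \<le> ent (\<Sum>k\<in>UNIV. sum (x k) UNIV - x k e) (?y l)"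
    proof (rule log_sum_inequality)
      fix k
      have "sum (x k) {e, l} \<le> sum (x k) UNIV" using nn by (intro sum_mono2) auto
      then show "x k l \<le> sum (x k) UNIV - x k e" using l by simp
    qed (use nn in auto)
    then show "0 \<le> ent (sum ?y UNIV - ?y e) (?y l) - (\<Sum>k\<in>UNIV. ent (sum (x k) UNIV - x k e) (x k l))"
      using M by (simp add: sum_subtractf)
  qed
  finally show ?thesis by simp
qed

end

lemma sum_UNIV_Plus: "(\<Sum>x\<in>UNIV. f x) = (\<Sum>i\<in>UNIV. f (Inl i)) + (\<Sum>j\<in>UNIV. f (Inr j))"
  for f :: "'a::finite + 'b::finite \<Rightarrow> real"
  by (subst UNIV_Plus_UNIV[symmetric], subst sum.Plus) (simp_all add: o_def)

text \<open>A matrix as a symmetric function on pairs of vertices of the bipartite graph.\<close>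

fun on_edges :: "('n \<Rightarrow> 'n \<Rightarrow> real) \<Rightarrow> 'n + 'n \<Rightarrow> 'n + 'n \<Rightarrow> real" where
  "on_edges f (Inl i) (Inr j) = f i j"
| "on_edges f (Inr j) (Inl i) = f i j"
| "on_edges f _ _ = 0"

text \<open>The unnormalized weights of a random permutation. A block is a set \<open>B\<close> of permutations, usually
those that agree with a prescribed partial map; instead of conditioning on a block the weights
are restricted to it, which scales all entropies by its mass.\<close>

locale weighted_perms =
  fixes mu :: "('n::finite \<Rightarrow> 'n) \<Rightarrow> real"
  assumes mu_nonneg: "0 \<le> mu s"
begin

definition mass :: "('n \<Rightarrow> 'n) set \<Rightarrow> real" where "mass B = sum mu B"

definition section_at :: "('n \<Rightarrow> 'n) set \<Rightarrow> 'n \<Rightarrow> 'n \<Rightarrow> ('n \<Rightarrow> 'n) set" where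
  "section_at B v k = {s \<in> B. s v = k}"

definition marg :: "('n \<Rightarrow> 'n) set \<Rightarrow> 'n \<Rightarrow> 'n \<Rightarrow> real" where
  "marg B i j = mass (section_at B i j)"

definition Ent :: "('n \<Rightarrow> 'n) set \<Rightarrow> real" where
  "Ent B = xlx (mass B) - (\<Sum>s\<in>B. xlx (mu s))"

text \<open>The entropy of the value in row \<open>i\<close>, scaled by the mass of the block.\<close>

definition Hrow :: "('n \<Rightarrow> 'n) set \<Rightarrow> 'n \<Rightarrow> real" where
  "Hrow B i = (\<Sum>j\<in>UNIV. ent (mass B) (marg B i j))"

text \<open>The entropy terms of the events that \<open>i\<close> is not mapped to \<open>j\<close>.\<close>

definition Srow :: "('n \<Rightarrow> 'n) set \<Rightarrow> 'n \<Rightarrow> real" where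
  "Srow B i = (\<Sum>j\<in>UNIV. ent (mass B) (mass B - marg B i j))"

text \<open>The amount by which the entropy exceeds its Bethe approximation.\<close>

definition excess :: "('n \<Rightarrow> 'n) set \<Rightarrow> real" where
  "excess B = Ent B - (\<Sum>i\<in>UNIV. Hrow B i - Srow B i)"

lemma mass_nonneg: "0 \<le> mass B"
  by (simp add: mass_def mu_nonneg sum_nonneg)

lemma marg_nonneg: "0 \<le> marg B i j"
  by (simp add: marg_def mass_nonneg)

lemma sum_sections: "(\<Sum>k\<in>UNIV. \<Sum>s\<in>section_at B v k. f s) = (\<Sum>s\<in>B. f s)" for f :: "_ \<Rightarrow> real"
  unfolding section_at_def by (intro sum.group) auto

lemma mass_sections: "(\<Sum>k\<in>UNIV. mass (section_at B v k)) = mass B"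
  unfolding mass_def by (rule sum_sections)

lemma marg_sections: "(\<Sum>k\<in>UNIV. marg (section_at B v k) i j) = marg B i j"
proof -
  have "section_at (section_at B v k) i j = section_at (section_at B i j) v k" for k
    by (auto simp: section_at_def)
  then show ?thesis by (simp add: marg_def mass_sections)
qed

lemma marg_row: "(\<Sum>j\<in>UNIV. marg B i j) = mass B"
  by (simp add: marg_def mass_sections)

lemma marg_column:
  assumes "\<And>s. s \<in> B \<Longrightarrow> bij s"
  shows "(\<Sum>i\<in>UNIV. marg B i j) = mass B"
proof -
  have "(\<Sum>i\<in>UNIV. marg B i j) = (\<Sum>i\<in>UNIV. \<Sum>s | s \<in> B \<and> inv s j = i. mu s)"
  proof (intro sum.cong refl)
    fix i
    have "section_at B i j = {s. s \<in> B \<and> inv s j = i}"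
      using assms by (auto simp: section_at_def bij_is_inj bij_is_surj surj_f_inv_f inv_f_eq)
    then show "marg B i j = (\<Sum>s | s \<in> B \<and> inv s j = i. mu s)" by (simp add: marg_def mass_def)
  qed
  also have "\<dots> = mass B"
    unfolding mass_def by (intro sum.group) auto
  finally show ?thesis .
qed

text \<open>The chain rule: revealing \<open>\<sigma> v\<close> lowers the entropy by the entropy of \<open>\<sigma> v\<close>.\<close>

lemma Ent_drop: "Ent B - (\<Sum>k\<in>UNIV. Ent (section_at B v k)) = Hrow B v"
proof -
  have "Ent B - (\<Sum>k\<in>UNIV. Ent (section_at B v k)) = xlx (mass B) - (\<Sum>k\<in>UNIV. xlx (mass (section_at B v k)))"
    unfolding Ent_def sum_subtractf sum_sections by simp
  also have "\<dots> = Hrow B v"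
  proof -
    have "Hrow B v = (\<Sum>k\<in>UNIV. marg B v k) * ln (mass B) - (\<Sum>k\<in>UNIV. xlx (mass (section_at B v k)))"
      unfolding Hrow_def ent_def right_diff_distrib sum_subtractf sum_distrib_right xlx_def marg_def ..
    then show ?thesis by (simp add: marg_row xlx_def)
  qed
  finally show ?thesis .
qed

lemma section_section_same: "section_at (section_at B v k) v j = (if j = k then section_at B v k else {})"
  by (auto simp: section_at_def)

lemma Hrow_section: "Hrow (section_at B v k) v = 0"
  unfolding Hrow_def marg_def section_section_same
  by (intro sum.neutral) (auto simp: ent_def mass_def)

lemma Srow_section: "Srow (section_at B v k) v = 0"
  unfolding Srow_def marg_def section_section_same
  by (intro sum.neutral) (auto simp: ent_def mass_def)

text \<open>The drop of \<open>excess\<close> is the sum of all \<open>b\<close> minus the sum of the \<open>a\<close> outside of row \<open>v\<close>: the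
entropy itself drops by the \<open>a\<close>-sum of row \<open>v\<close>. This is the quantity bounded by
\<open>layered_cost_bound\<close>, with the row \<open>v\<close> as the root. Columns are
vertices like the rows because a permutation takes every value exactly once.\<close>

lemma reveal_cost:
  fixes E :: "('n \<times> 'n) set"
  assumes B: "\<And>s. s \<in> B \<Longrightarrow> bij s" "\<And>s i. s \<in> B \<Longrightarrow> (i, s i) \<in> E"
    and G: "\<not> girth G < enat (2 * m)" "verts G = UNIV" "\<And>i j. (i, j) \<in> E \<Longrightarrow> {Inl i, Inr j} \<in> edges G"
    and m: "0 < m"
  shows "real (m - 1) * (excess B - (\<Sum>k\<in>UNIV. excess (section_at B v k)))
    \<le> (\<Sum>i\<in>UNIV - {v}. Srow B i - (\<Sum>k\<in>UNIV. Srow (section_at B v k) i))"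
proof -
  let ?S = "section_at B v"
  define a where "a i = drop_in (\<lambda>k. marg (?S k) i)" for i
  define b where "b i = drop_out (\<lambda>k. marg (?S k) i)" for i
  have nn: "0 \<le> marg (?S k) i j" for k i j by (rule marg_nonneg)
  have Sb: "bij s" if "s \<in> ?S k" for s k using B that by (auto simp: section_at_def)
  have a: "a i j = ent (mass B) (marg B i j) - (\<Sum>k\<in>UNIV. ent (mass (?S k)) (marg (?S k) i j))" for i j
    unfolding a_def drop_in_def[OF nn] by (simp add: marg_row mass_sections marg_sections)
  have b: "b i j = ent (mass B) (mass B - marg B i j) - (\<Sum>k\<in>UNIV. ent (mass (?S k)) (mass (?S k) - marg (?S k) i j))" for i j
    unfolding b_def drop_out_def[OF nn] by (simp add: marg_row mass_sections marg_sections)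
  have ac: "a i j = drop_in (\<lambda>k i. marg (?S k) i j) i" for i j
    unfolding a drop_in_def[OF nn] by (simp add: marg_column[OF Sb] mass_sections marg_sections)
  have bc: "b i j = drop_out (\<lambda>k i. marg (?S k) i j) i" for i j
    unfolding b drop_out_def[OF nn] by (simp add: marg_column[OF Sb] mass_sections marg_sections)
  have off: "a i j = 0 \<and> b i j = 0" if "(i, j) \<notin> E" for i j
  proof -
    have "section_at B i j = {}" "section_at (?S k) i j = {}" for k
      using B(2) that by (auto simp: section_at_def)
    then have "marg B i j = 0" "marg (?S k) i j = 0" for k
      by (simp_all only: marg_def mass_def sum.empty)
    then show ?thesis unfolding a b by (simp add: ent_def)
  qed
  let ?d = "depth E v m"
  have lay: "layered (adjacent E) ?d (on_edges f)" if "\<And>i j. (i, j) \<notin> E \<Longrightarrow> f i j = 0" for f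
  proof
    fix x y :: "'n + 'n"
    show "on_edges f x y = on_edges f y x" by (cases x; cases y) auto
    show "\<not> adjacent E x y \<Longrightarrow> on_edges f x y = 0"
      using that by (cases x; cases y) (auto simp: adjacent_def)
  qed (rule depth_adjacent)
  have tot: "(\<Sum>x\<in>UNIV. \<Sum>y\<in>UNIV. on_edges f x y) / 2 = (\<Sum>i\<in>UNIV. \<Sum>j\<in>UNIV. f i j)" for f :: "'n \<Rightarrow> 'n \<Rightarrow> real"
    using sum.swap[of f UNIV UNIV] by (simp add: sum_UNIV_Plus)
  have row: "(\<Sum>y\<in>UNIV. on_edges f (Inl i) y) = (\<Sum>j\<in>UNIV. f i j)"
    and col: "(\<Sum>y\<in>UNIV. on_edges f (Inr j) y) = (\<Sum>i\<in>UNIV. f i j)" for f :: "'n \<Rightarrow> 'n \<Rightarrow> real" and i j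
    by (simp_all add: sum_UNIV_Plus)
  have a_nonneg: "0 \<le> on_edges a x y" for x y
    by (cases x; cases y) (auto simp: a_def drop_in_nonneg[OF nn])
  have "real (m - 1) * ((\<Sum>x\<in>UNIV. \<Sum>y\<in>UNIV. on_edges b x y) / 2
      - ((\<Sum>x\<in>UNIV. \<Sum>y\<in>UNIV. on_edges a x y) / 2 - (\<Sum>y\<in>UNIV. on_edges a (Inl v) y)))
     \<le> (\<Sum>x\<in>UNIV. \<Sum>y\<in>UNIV. on_edges b x y) / 2 - (\<Sum>y\<in>UNIV. on_edges b (Inl v) y)"
  proof (rule layered_cost_bound[where adj = "adjacent E" and d = ?d])
    fix x y :: "'n + 'n"
    show "0 \<le> on_edges a x y" by (rule a_nonneg)
    show "0 \<le> on_edges b x y"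
      by (cases x; cases y) (auto simp: b_def drop_out_nonneg[OF nn])
    show "(\<Sum>y\<in>UNIV. on_edges b x y) \<le> (\<Sum>y\<in>UNIV. on_edges a x y)"
    proof (cases x)
      case (Inl i)
      then show ?thesis unfolding Inl row unfolding a_def b_def by (intro drop_vertex nn)
    next
      case (Inr j)
      then show ?thesis unfolding Inr col unfolding ac bc by (intro drop_vertex nn)
    qed
    show "on_edges b x y \<le> (\<Sum>z\<in>UNIV - {y}. on_edges a x z)"
    proof (cases x)
      case (Inl i)
      show ?thesis
      proof (cases y)
        case (Inl j)
        then show ?thesis using \<open>x = Inl i\<close> a_nonneg
          by (auto intro!: sum_nonneg)
      next
        case (Inr j)
        have "(\<Sum>z\<in>UNIV - {y}. on_edges a x z) = (\<Sum>j\<in>UNIV. a i j) - a i j"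
          using \<open>x = Inl i\<close> Inr by (simp add: sum_diff1 row)
        then show ?thesis using \<open>x = Inl i\<close> Inr drop_edge[of "\<lambda>k. marg (?S k) i", OF nn, of j] by (simp add: a_def b_def sum_diff1)
      qed
    next
      case (Inr j)
      show ?thesis
      proof (cases y)
        case (Inr k)
        then show ?thesis using \<open>x = Inr j\<close> a_nonneg
          by (auto intro!: sum_nonneg)
      next
        case (Inl i)
        have "(\<Sum>z\<in>UNIV - {y}. on_edges a x z) = (\<Sum>i\<in>UNIV. a i j) - a i j"
          using \<open>x = Inr j\<close> Inl by (simp add: sum_diff1 col)
        then show ?thesis using \<open>x = Inr j\<close> Inl drop_edge[of "\<lambda>k i. marg (?S k) i j", OF nn, of i] by (simp add: ac bc sum_diff1)
      qed
    qed
    show "?d x = 0 \<longleftrightarrow> x = Inl v" by (rule depth_root[OF m])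
    fix z assume "adjacent E x y" "adjacent E x z" "?d x = Suc (?d y)" "?d x = Suc (?d z)" "?d x < m"
    then show "y = z"
      using G by (intro depth_unique_parent[of G m E x y z v]) (auto simp: adjacent_def insert_commute)
  qed (use lay off in auto)
  then have main: "real (m - 1) * ((\<Sum>i\<in>UNIV. \<Sum>j\<in>UNIV. b i j)
      - ((\<Sum>i\<in>UNIV. \<Sum>j\<in>UNIV. a i j) - (\<Sum>j\<in>UNIV. a v j)))
     \<le> (\<Sum>i\<in>UNIV. \<Sum>j\<in>UNIV. b i j) - (\<Sum>j\<in>UNIV. b v j)"
    unfolding tot row .
  have sa: "(\<Sum>j\<in>UNIV. a i j) = Hrow B i - (\<Sum>k\<in>UNIV. Hrow (?S k) i)" for i
    unfolding a Hrow_def sum_subtractf by (subst (2) sum.swap) simp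
  have sb: "(\<Sum>j\<in>UNIV. b i j) = Srow B i - (\<Sum>k\<in>UNIV. Srow (?S k) i)" for i
    unfolding b Srow_def sum_subtractf by (subst (2) sum.swap) simp
  have sH: "(\<Sum>k\<in>UNIV. \<Sum>i\<in>UNIV. Hrow (?S k) i) = (\<Sum>i\<in>UNIV. \<Sum>k\<in>UNIV. Hrow (?S k) i)"
    by (rule sum.swap)
  have sS: "(\<Sum>k\<in>UNIV. \<Sum>i\<in>UNIV. Srow (?S k) i) = (\<Sum>i\<in>UNIV. \<Sum>k\<in>UNIV. Srow (?S k) i)"
    by (rule sum.swap)
  have "excess B - (\<Sum>k\<in>UNIV. excess (?S k))
     = (\<Sum>i\<in>UNIV. \<Sum>j\<in>UNIV. b i j) - ((\<Sum>i\<in>UNIV. \<Sum>j\<in>UNIV. a i j) - (\<Sum>j\<in>UNIV. a v j))"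
    unfolding sa sb excess_def sum_subtractf sH sS
    using Ent_drop[of B v] by (simp add: Hrow_section algebra_simps)
  moreover have "(\<Sum>i\<in>UNIV. \<Sum>j\<in>UNIV. b i j) - (\<Sum>j\<in>UNIV. b v j)
     = (\<Sum>i\<in>UNIV - {v}. Srow B i - (\<Sum>k\<in>UNIV. Srow (?S k) i))"
    unfolding sb by (simp add: sum_diff1)
  ultimately show ?thesis using main by simp
qed

end

section \<open>Revealing all values in a random order\<close>

lemma sum_Pow_drop:
  fixes f :: "'a set \<Rightarrow> real"
  assumes "finite U"
  shows "(\<Sum>S\<in>Pow U. \<Sum>v\<in>U - S. c (card S) * (f S - f (insert v S)))
    = (\<Sum>S\<in>Pow U. (real (card U - card S) * c (card S) - real (card S) * c (card S - 1)) * f S)"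
proof -
  have fin: "finite S" if "S \<in> Pow U" for S using that assms by (auto intro: finite_subset)
  have "(\<Sum>S\<in>Pow U. \<Sum>v\<in>U - S. c (card S) * f (insert v S))
      = (\<Sum>S\<in>Pow U. \<Sum>v\<in>U - S. c (card (insert v S) - 1) * f (insert v S))"
    using fin by (intro sum.cong refl) auto
  also have "\<dots> = (\<Sum>W\<in>Pow U. \<Sum>v\<in>W. c (card W - 1) * f W)"
    by (rule sum_Pow_swap[OF assms, symmetric])
  finally have A: "(\<Sum>S\<in>Pow U. \<Sum>v\<in>U - S. c (card S) * f (insert v S)) = (\<Sum>W\<in>Pow U. real (card W) * c (card W - 1) * f W)"
    by (simp add: mult.assoc)
  have "(\<Sum>S\<in>Pow U. \<Sum>v\<in>U - S. c (card S) * f S) = (\<Sum>S\<in>Pow U. real (card U - card S) * c (card S) * f S)"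
    using fin by (intro sum.cong refl) (auto simp: card_Diff_subset)
  with A show ?thesis
    by (simp add: right_diff_distrib left_diff_distrib sum_subtractf)
qed

lemma sum_Pow_zero_off:
  fixes f :: "'a set \<Rightarrow> real"
  assumes "finite U" "\<And>S. S \<subseteq> U \<Longrightarrow> S \<noteq> {} \<Longrightarrow> S \<noteq> U \<Longrightarrow> f S = 0" "U \<noteq> {}"
  shows "(\<Sum>S\<in>Pow U. f S) = f {} + f U"
proof -
  have "(\<Sum>S\<in>Pow U. f S) = (\<Sum>S\<in>{{}, U}. f S)"
    using assms by (intro sum.mono_neutral_right) auto
  then show ?thesis using assms by auto
qed

text \<open>The expected change of \<open>f\<close> along a random order of all elements telescopes. The left-hand side
groups the steps by the set \<open>S\<close> of earlier elements and the next element \<open>v\<close>.\<close>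

lemma order_average_UNIV:
  fixes f :: "'a::finite set \<Rightarrow> real"
  shows "(\<Sum>S\<in>UNIV. \<Sum>v\<in>- S. shapley CARD('a) (Suc (card S)) * (f S - f (insert v S))) = f {} - f UNIV"
proof -
  let ?N = "CARD('a)"
  have N: "?N \<noteq> 0" by simp
  have "(\<Sum>S\<in>UNIV. \<Sum>v\<in>- S. shapley ?N (Suc (card S)) * (f S - f (insert v S)))
    = (\<Sum>S\<in>Pow UNIV. (real (?N - card S) * shapley ?N (Suc (card S)) - real (card S) * shapley ?N (Suc (card S - 1))) * f S)"
    by (subst sum_Pow_drop[symmetric]) (auto simp: Compl_eq_Diff_UNIV)
  also have "\<dots> = (real (?N - card ({} :: 'a set)) * shapley ?N (Suc (card ({} :: 'a set))) - real (card ({} :: 'a set)) * shapley ?N (Suc (card ({} :: 'a set) - 1))) * f {}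
      + (real (?N - card (UNIV :: 'a set)) * shapley ?N (Suc (card (UNIV :: 'a set))) - real (card (UNIV :: 'a set)) * shapley ?N (Suc (card (UNIV :: 'a set) - 1))) * f UNIV"
  proof (rule sum_Pow_zero_off)
    fix S :: "'a set" assume "S \<noteq> {}" "S \<noteq> UNIV"
    then have "card S \<noteq> 0" "card S < ?N" by (auto intro!: psubset_card_mono)
    then have "Suc (card S - 1) = card S" by linarith
    moreover have "real (?N - card S) * shapley ?N (Suc (card S)) = real (card S) * shapley ?N (card S)"
      using shapley_mult[of "card S" ?N] \<open>card S \<noteq> 0\<close> \<open>card S < ?N\<close> by blast
    ultimately show "(real (?N - card S) * shapley ?N (Suc (card S)) - real (card S) * shapley ?N (Suc (card S - 1))) * f S = 0"
      by (simp only:) simp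
  qed auto
  also have "\<dots> = f {} - f UNIV"
  proof -
    obtain n where n: "?N = Suc n" using N not0_implies_Suc by blast
    show ?thesis by (simp add: n shapley_def)
  qed
  finally show ?thesis .
qed

text \<open>The same expectation for the steps that precede the element \<open>i\<close>: the sum telescopes to the
difference of \<open>f {}\<close> and the expected value of \<open>f\<close> at the set of the predecessors of \<open>i\<close>.\<close>

lemma order_average_off:
  fixes f :: "'a::finite set \<Rightarrow> real"
  shows "(\<Sum>S\<in>Pow (UNIV - {i}). \<Sum>v\<in>UNIV - {i} - S. shapley CARD('a) (Suc (card S)) * (f S - f (insert v S)))
     = f {} - (\<Sum>S\<in>Pow (UNIV - {i}). shapley CARD('a) (Suc (card S)) * f S)"
proof -
  let ?N = "CARD('a)" and ?U = "UNIV - {i}"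
  obtain n where n: "?N = Suc n" using not0_implies_Suc[of ?N] by auto
  have cU: "card ?U = n" by (simp add: card_Diff_subset n)
  have "(\<Sum>S\<in>Pow ?U. \<Sum>v\<in>?U - S. shapley ?N (Suc (card S)) * (f S - f (insert v S)))
     = (\<Sum>S\<in>Pow ?U. (real (n - card S) * shapley ?N (Suc (card S)) - real (card S) * shapley ?N (Suc (card S - 1))) * f S)"
    by (subst sum_Pow_drop) (auto simp: cU)
  also have "\<dots> = (\<Sum>S\<in>Pow ?U. (if S = {} then f S else 0) - shapley ?N (Suc (card S)) * f S)"
  proof (intro sum.cong refl)
    fix S assume S: "S \<in> Pow ?U"
    then have c: "card S \<le> n" using cU card_mono[of ?U S] by auto
    show "(real (n - card S) * shapley ?N (Suc (card S)) - real (card S) * shapley ?N (Suc (card S - 1))) * f S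
      = (if S = {} then f S else 0) - shapley ?N (Suc (card S)) * f S"
    proof (cases "S = {}")
      case True
      have "shapley ?N 1 = fact n / (real (Suc n) * fact n)" by (simp add: shapley_def n del: of_nat_Suc)
      then have "shapley ?N 1 = 1 / real (Suc n)" by (simp del: of_nat_Suc)
      then have "real n * shapley ?N 1 = 1 - shapley ?N 1" by (simp add: field_simps)
      then show ?thesis using True by (simp add: left_diff_distrib)
    next
      case False
      then have "card S \<noteq> 0" by auto
      then have "Suc (card S - 1) = card S" by linarith
      then have "real (?N - card S) * shapley ?N (Suc (card S)) = real (card S) * shapley ?N (Suc (card S - 1))"
        using c n \<open>card S \<noteq> 0\<close> by (simp only:) (rule shapley_mult, auto)
      moreover have "real (?N - card S) = real (n - card S) + 1" using c n by (simp add: of_nat_diff)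
      ultimately have "real (n - card S) * shapley ?N (Suc (card S)) - real (card S) * shapley ?N (Suc (card S - 1)) = - shapley ?N (Suc (card S))"
        by (simp add: algebra_simps)
      then show ?thesis using False by simp
    qed
  qed
  also have "\<dots> = f {} - (\<Sum>S\<in>Pow ?U. shapley ?N (Suc (card S)) * f S)"
    by (simp add: sum_subtractf sum.delta)
  finally show ?thesis .
qed

lemma sum_avoiding_swap:
  fixes F :: "'a::finite set \<Rightarrow> 'a \<Rightarrow> real"
  shows "(\<Sum>S\<in>UNIV. \<Sum>v\<in>- S. F S v) = (\<Sum>i\<in>UNIV. \<Sum>S\<in>Pow (UNIV - {i}). F S i)"
proof -
  have "(\<Sum>S\<in>UNIV. \<Sum>v\<in>- S. F S v) = (\<Sum>S\<in>UNIV. \<Sum>v | v \<in> UNIV \<and> v \<notin> S. F S v)"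
    by (intro sum.cong) auto
  also have "\<dots> = (\<Sum>i\<in>UNIV. \<Sum>S | S \<in> UNIV \<and> i \<notin> S. F S i)"
    by (rule sum.swap_restrict) auto
  also have "\<dots> = (\<Sum>i\<in>UNIV. \<Sum>S\<in>Pow (UNIV - {i}). F S i)"
    by (intro sum.cong refl) auto
  finally show ?thesis .
qed

lemma local_ent_zeros:
  assumes "finite J" "I \<subseteq> J" "\<And>j. j \<in> J - I \<Longrightarrow> x j = 0" "\<And>j. j \<in> I \<Longrightarrow> x j = y j"
  shows "local_ent J x = local_ent I y"
proof -
  have "sum x J = sum x I" using assms(1-3) by (intro sum.mono_neutral_right) auto
  also have "\<dots> = sum y I" using assms(4) by (intro sum.cong) auto
  finally have M: "sum x J = sum y I" .
  have "local_ent J x = (\<Sum>j\<in>I. ent (sum x J) (x j) - ent (sum x J) (sum x J - x j))"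
    unfolding local_ent_def using assms(1-3) by (intro sum.mono_neutral_right) (auto simp: ent_def)
  also have "\<dots> = local_ent I y" unfolding local_ent_def M using assms(4) by (intro sum.cong) auto
  finally show ?thesis .
qed

context weighted_perms
begin

definition block :: "('n \<Rightarrow> 'n) set \<Rightarrow> 'n set \<Rightarrow> ('n \<Rightarrow> 'n) \<Rightarrow> ('n \<Rightarrow> 'n) set" where
  "block P S t = {s \<in> P. \<forall>i\<in>S. s i = t i}"

text \<open>The expected value of \<open>F\<close> on the block that is known after the rows in \<open>S\<close> are revealed.\<close>

definition block_sum :: "('n \<Rightarrow> 'n) set \<Rightarrow> (('n \<Rightarrow> 'n) set \<Rightarrow> real) \<Rightarrow> 'n set \<Rightarrow> real" where
  "block_sum P F S = (\<Sum>t\<in>PiE S (\<lambda>_. UNIV). F (block P S t))"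

lemma block_sum_insert:
  assumes "v \<notin> S"
  shows "block_sum P F (insert v S) = (\<Sum>t\<in>PiE S (\<lambda>_. UNIV). \<Sum>k\<in>UNIV. F (section_at (block P S t) v k))"
proof -
  have "block_sum P F (insert v S) = (\<Sum>(k, t)\<in>UNIV \<times> PiE S (\<lambda>_. UNIV). F (block P (insert v S) (t(v := k))))"
    unfolding block_sum_def PiE_insert_eq
    by (subst sum.reindex[OF inj_combinator[OF assms]]) (simp add: o_def case_prod_unfold)
  also have "\<dots> = (\<Sum>(k, t)\<in>UNIV \<times> PiE S (\<lambda>_. UNIV). F (section_at (block P S t) v k))"
  proof (intro sum.cong refl, clarify)
    fix k t
    have "block P (insert v S) (t(v := k)) = section_at (block P S t) v k"
      using assms by (auto simp: block_def section_at_def)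
    then show "F (block P (insert v S) (t(v := k))) = F (section_at (block P S t) v k)" by simp
  qed
  also have "\<dots> = (\<Sum>k\<in>UNIV. \<Sum>t\<in>PiE S (\<lambda>_. UNIV). F (section_at (block P S t) v k))"
    by (rule sum.cartesian_product[symmetric])
  finally show ?thesis by (simp add: sum.swap[of _ UNIV])
qed

lemma block_sum_empty: "block_sum P F {} = F P"
  by (simp add: block_sum_def block_def)

lemma block_subset: "s \<in> block P S t \<Longrightarrow> s \<in> P" by (simp add: block_def)

lemma block_singleton: "block P UNIV t = {} \<or> block P UNIV t = {t}"
  unfolding block_def by (auto simp: fun_eq_iff[symmetric])

lemma Ent_block_UNIV: "Ent (block P UNIV t) = 0"
  using block_singleton[of P t] by (auto simp: Ent_def mass_def)

lemma block_section: "i \<in> S \<Longrightarrow> section_at (block P S t) i (t i) = block P S t"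
  by (auto simp: block_def section_at_def)

lemma Hrow_block: "i \<in> S \<Longrightarrow> Hrow (block P S t) i = 0"
  using Hrow_section[of "block P S t" i "t i"] by (simp add: block_section)

lemma Srow_block: "i \<in> S \<Longrightarrow> Srow (block P S t) i = 0"
  using Srow_section[of "block P S t" i "t i"] by (simp add: block_section)

lemma excess_block_UNIV: "excess (block P UNIV t) = 0"
  by (simp add: excess_def Ent_block_UNIV Hrow_block Srow_block)

text \<open>The entropy is the expected sum of the entropies of the rows, each one conditioned on the rows
that precede it in a random order.\<close>

lemma entropy_chain_rule:
  "Ent P = (\<Sum>i\<in>UNIV. \<Sum>S\<in>Pow (UNIV - {i}). shapley CARD('n) (Suc (card S)) * block_sum P (\<lambda>B. Hrow B i) S)"
proof -
  have "Ent P = block_sum P Ent {} - block_sum P Ent UNIV"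
    unfolding block_sum_empty by (simp add: block_sum_def Ent_block_UNIV)
  also have "\<dots> = (\<Sum>S\<in>UNIV. \<Sum>v\<in>- S. shapley CARD('n) (Suc (card S)) * (block_sum P Ent S - block_sum P Ent (insert v S)))"
    by (rule order_average_UNIV[symmetric])
  also have "\<dots> = (\<Sum>S\<in>UNIV. \<Sum>v\<in>- S. shapley CARD('n) (Suc (card S)) * block_sum P (\<lambda>B. Hrow B v) S)"
  proof (intro sum.cong refl)
    fix S :: "'n set" and v assume "v \<in> - S"
    then have "block_sum P Ent S - block_sum P Ent (insert v S) = block_sum P (\<lambda>B. Hrow B v) S"
      by (simp add: block_sum_insert) (simp add: block_sum_def sum_subtractf[symmetric] Ent_drop)
    then show "shapley CARD('n) (Suc (card S)) * (block_sum P Ent S - block_sum P Ent (insert v S))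
      = shapley CARD('n) (Suc (card S)) * block_sum P (\<lambda>B. Hrow B v) S" by simp
  qed
  finally show ?thesis by (simp only: sum_avoiding_swap)
qed

lemma shapley_nonneg: "0 \<le> shapley d w" by (simp add: shapley_def)

text \<open>Summing \<open>reveal_cost\<close> over all steps of a random order telescopes on the left. On the right a row \<open>i\<close>
contributes as long as it is not revealed itself, which leaves the value at the start minus the
expected value when the turn of \<open>i\<close> comes.\<close>

lemma averaged_reveal_cost:
  fixes E :: "('n \<times> 'n) set"
  assumes P: "\<And>s. s \<in> P \<Longrightarrow> bij s" "\<And>s i. s \<in> P \<Longrightarrow> (i, s i) \<in> E"
    and G: "\<not> girth G < enat (2 * m)" "verts G = UNIV" "\<And>i j. (i, j) \<in> E \<Longrightarrow> {Inl i, Inr j} \<in> edges G"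
    and m: "0 < m"
  shows "real (m - 1) * excess P
    \<le> (\<Sum>i\<in>UNIV. Srow P i - (\<Sum>S\<in>Pow (UNIV - {i}). shapley CARD('n) (Suc (card S)) * block_sum P (\<lambda>B. Srow B i) S))"
proof -
  let ?w = "\<lambda>S. shapley CARD('n) (Suc (card S))"
  let ?T = "\<lambda>i. block_sum P (\<lambda>B. Srow B i)"
  have "real (m - 1) * excess P = real (m - 1) * (block_sum P excess {} - block_sum P excess UNIV)"
    unfolding block_sum_empty by (simp add: block_sum_def excess_block_UNIV)
  also have "\<dots> = real (m - 1) * (\<Sum>S\<in>UNIV. \<Sum>v\<in>- S. ?w S * (block_sum P excess S - block_sum P excess (insert v S)))"
    by (simp add: order_average_UNIV)
  also have "\<dots> = (\<Sum>S\<in>UNIV. \<Sum>v\<in>- S. ?w S * (real (m - 1) * (block_sum P excess S - block_sum P excess (insert v S))))"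
    unfolding sum_distrib_left by (simp add: mult_ac)
  also have "\<dots> \<le> (\<Sum>S\<in>UNIV. \<Sum>v\<in>- S. ?w S * (\<Sum>i\<in>UNIV - {v}. ?T i S - ?T i (insert v S)))"
  proof (intro sum_mono mult_left_mono shapley_nonneg)
    fix S :: "'n set" and v assume v: "v \<in> - S"
    let ?D = "\<lambda>F t. F (block P S t) - (\<Sum>k\<in>UNIV. F (section_at (block P S t) v k)) :: real"
    have D: "block_sum P F S - block_sum P F (insert v S) = (\<Sum>t\<in>PiE S (\<lambda>_. UNIV). ?D F t)" for F
      using v by (simp add: block_sum_insert) (simp add: block_sum_def sum_subtractf)
    have "real (m - 1) * (\<Sum>t\<in>PiE S (\<lambda>_. UNIV). ?D excess t)
       \<le> (\<Sum>t\<in>PiE S (\<lambda>_. UNIV). \<Sum>i\<in>UNIV - {v}. ?D (\<lambda>B. Srow B i) t)"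
      unfolding sum_distrib_left
      using P by (intro sum_mono reveal_cost[OF _ _ G m]) (auto dest: block_subset)
    also have "\<dots> = (\<Sum>i\<in>UNIV - {v}. \<Sum>t\<in>PiE S (\<lambda>_. UNIV). ?D (\<lambda>B. Srow B i) t)"
      by (rule sum.swap)
    finally show "real (m - 1) * (block_sum P excess S - block_sum P excess (insert v S))
       \<le> (\<Sum>i\<in>UNIV - {v}. ?T i S - ?T i (insert v S))"
      by (simp only: D)
  qed
  also have "\<dots> = (\<Sum>S\<in>UNIV. \<Sum>v\<in>- S. \<Sum>i | i \<in> UNIV \<and> i \<noteq> v. ?w S * (?T i S - ?T i (insert v S)))"
    by (intro sum.cong refl) (auto simp: sum_distrib_left intro: sum.cong)
  also have "\<dots> = (\<Sum>S\<in>UNIV. \<Sum>i\<in>UNIV. \<Sum>v | v \<in> - S \<and> i \<noteq> v. ?w S * (?T i S - ?T i (insert v S)))"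
    by (intro sum.cong refl sum.swap_restrict) auto
  also have "\<dots> = (\<Sum>i\<in>UNIV. \<Sum>S\<in>UNIV. \<Sum>v | v \<in> - S \<and> i \<noteq> v. ?w S * (?T i S - ?T i (insert v S)))"
    by (rule sum.swap)
  also have "\<dots> = (\<Sum>i\<in>UNIV. \<Sum>S\<in>Pow (UNIV - {i}). \<Sum>v\<in>UNIV - {i} - S. ?w S * (?T i S - ?T i (insert v S)))"
  proof (rule sum.cong[OF refl])
    fix i :: 'n
    have "(\<Sum>S\<in>UNIV. \<Sum>v | v \<in> - S \<and> i \<noteq> v. ?w S * (?T i S - ?T i (insert v S)))
      = (\<Sum>S\<in>Pow (UNIV - {i}). \<Sum>v | v \<in> - S \<and> i \<noteq> v. ?w S * (?T i S - ?T i (insert v S)))"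
      by (intro sum.mono_neutral_right) (auto intro!: sum.neutral simp: block_sum_def Srow_block)
    also have "\<dots> = (\<Sum>S\<in>Pow (UNIV - {i}). \<Sum>v\<in>UNIV - {i} - S. ?w S * (?T i S - ?T i (insert v S)))"
      by (intro sum.cong refl) auto
    finally show "(\<Sum>S\<in>UNIV. \<Sum>v | v \<in> - S \<and> i \<noteq> v. ?w S * (?T i S - ?T i (insert v S)))
      = (\<Sum>S\<in>Pow (UNIV - {i}). \<Sum>v\<in>UNIV - {i} - S. ?w S * (?T i S - ?T i (insert v S)))" .
  qed
  also have "\<dots> = (\<Sum>i\<in>UNIV. Srow P i - (\<Sum>S\<in>Pow (UNIV - {i}). ?w S * ?T i S))"
    unfolding order_average_off block_sum_empty ..
  finally show ?thesis .
qed

lemma local_ent_marg: "local_ent UNIV (marg B i) = Hrow B i - Srow B i"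
  by (simp add: local_ent_def marg_row Hrow_def Srow_def sum_subtractf)

lemma marg_empty: "marg {} i j = 0"
  by (simp add: marg_def section_at_def mass_def)

text \<open>Blocks \<open>(S, t)\<close> are grouped by the set \<open>t ` S\<close> of the columns that are already used. In the
group of \<open>T\<close> every permutation with \<open>\<sigma> i \<notin> T\<close> lies in exactly one block, namely the one with
\<open>S = \<sigma> -` T\<close>, so superadditivity merges the group into the row \<open>i\<close> restricted to the columns outside
of \<open>T\<close>. The sum over \<open>W\<close> runs over the sets of unused columns.\<close>

lemma coarsen:
  assumes P: "\<And>s. s \<in> P \<Longrightarrow> bij s"
  shows "(\<Sum>S\<in>Pow (UNIV - {i}). shapley CARD('n) (Suc (card S)) * block_sum P (\<lambda>B. local_ent UNIV (marg B i)) S)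
    \<le> (\<Sum>W\<in>UNIV. shapley CARD('n) (card W) * local_ent W (marg P i))"
proof -
  let ?w = "\<lambda>S. shapley CARD('n) (Suc (card S))"
  let ?N = "\<lambda>B. local_ent UNIV (marg B i)"
  define I where "I = Sigma (Pow (UNIV - {i})) (\<lambda>S. {t \<in> PiE S (\<lambda>_. UNIV :: 'n set). inj_on t S})"
  have finPi: "finite (PiE S (\<lambda>_. UNIV) :: ('n \<Rightarrow> 'n) set)" for S :: "'n set" by (intro finite_PiE) auto
  have finInj: "finite {t \<in> PiE S (\<lambda>_. UNIV :: 'n set). inj_on t S}" for S :: "'n set"
    by (rule finite_subset[OF _ finPi[of S]]) auto
  have finI: "finite I" unfolding I_def by (intro finite_SigmaI finInj) auto
  have empty: "block P S t = {}" if "\<not> inj_on t S" for S t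
  proof (rule ccontr)
    assume "block P S t \<noteq> {}"
    then obtain s where "s \<in> P" "\<forall>i\<in>S. s i = t i" by (auto simp: block_def)
    moreover from this P have "inj_on s S" by (meson bij_is_inj inj_on_subset subset_UNIV)
    ultimately show False using that by (simp add: inj_on_def)
  qed
  have N0: "?N {} = 0" by (simp add: local_ent_def marg_empty ent_def)
  have "(\<Sum>S\<in>Pow (UNIV - {i}). ?w S * block_sum P ?N S)
      = (\<Sum>S\<in>Pow (UNIV - {i}). \<Sum>t\<in>{t \<in> PiE S (\<lambda>_. UNIV). inj_on t S}. ?w S * ?N (block P S t))"
    unfolding block_sum_def sum_distrib_left
    by (intro sum.cong refl sum.mono_neutral_right finPi) (auto simp: empty N0)
  also have "\<dots> = (\<Sum>(S, t)\<in>I. ?w S * ?N (block P S t))"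
    unfolding I_def by (intro sum.Sigma ballI finInj) simp
  also have "\<dots> = (\<Sum>T\<in>UNIV. \<Sum>(S, t) | (S, t) \<in> I \<and> t ` S = T. ?w S * ?N (block P S t))"
  proof -
    have "(\<Sum>x\<in>I. g x) = (\<Sum>T\<in>UNIV. \<Sum>x | x \<in> I \<and> snd x ` fst x = T. g x)" for g :: "'n set \<times> ('n \<Rightarrow> 'n) \<Rightarrow> real"
      using finI by (intro sum.group[symmetric]) auto
    moreover have "{x. x \<in> I \<and> snd x ` fst x = T} = {(S, t). (S, t) \<in> I \<and> t ` S = T}" for T by auto
    ultimately show ?thesis by simp
  qed
  also have "\<dots> \<le> (\<Sum>T\<in>UNIV. ?w T * local_ent (- T) (marg P i))"
  proof (intro sum_mono)
    fix T :: "'n set"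
    let ?Q = "{(S, t). (S, t) \<in> I \<and> t ` S = T}"
    have finQ: "finite ?Q" using finI by (rule finite_subset[rotated]) auto
    have "(\<Sum>(S, t)\<in>?Q. ?w S * ?N (block P S t)) = (\<Sum>x\<in>?Q. ?w T * ?N (block P (fst x) (snd x)))"
      by (intro sum.cong refl) (auto simp: I_def card_image)
    also have "\<dots> = ?w T * (\<Sum>x\<in>?Q. ?N (block P (fst x) (snd x)))" by (simp add: sum_distrib_left)
    also have "\<dots> \<le> ?w T * local_ent UNIV (\<lambda>j. \<Sum>x\<in>?Q. marg (block P (fst x) (snd x)) i j)"
      by (intro mult_left_mono shapley_nonneg local_ent_superadd finQ marg_nonneg) auto
    also have "local_ent UNIV (\<lambda>j. \<Sum>x\<in>?Q. marg (block P (fst x) (snd x)) i j) = local_ent (- T) (marg P i)"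
    proof (rule local_ent_zeros)
      fix j assume "j \<in> UNIV - - T"
      then have j: "j \<in> T" by simp
      show "(\<Sum>x\<in>?Q. marg (block P (fst x) (snd x)) i j) = 0"
      proof (intro sum.neutral ballI)
        fix x assume x: "x \<in> ?Q"
        have "section_at (block P (fst x) (snd x)) i j = {}"
        proof (rule ccontr)
          assume "section_at (block P (fst x) (snd x)) i j \<noteq> {}"
          then obtain s where s: "s \<in> P" "\<forall>k\<in>fst x. s k = snd x k" "s i = j" by (auto simp: section_at_def block_def)
          have "j \<in> snd x ` fst x" using x j by auto
          then obtain k where "k \<in> fst x" "j = snd x k" by auto
          then have "s k = s i" using s by auto
          then have "k = i" using P[OF s(1)] by (meson bij_is_inj injD)
          then show False using \<open>k \<in> fst x\<close> x by (auto simp: I_def)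
        qed
        then show "marg (block P (fst x) (snd x)) i j = 0" by (simp add: marg_def mass_def)
      qed
    next
      fix j assume "j \<in> - T"
      then have j: "j \<notin> T" by simp
      \<comment> \<open>The block of the group that contains \<open>s\<close>.\<close>
      define key where "key s = (s -` T, restrict s (s -` T))" for s :: "'n \<Rightarrow> 'n"
      let ?P = "section_at P i j"
      have eq: "section_at (block P (fst x) (snd x)) i j = {s. s \<in> ?P \<and> key s = x}" if "x \<in> ?Q" for x
      proof -
        obtain S t where x: "x = (S, t)" by (cases x)
        have t: "t \<in> extensional S" "t ` S = T" using that by (auto simp: x I_def PiE_def)
        have "(\<forall>k\<in>S. s k = t k) \<longleftrightarrow> key s = (S, t)" if "s \<in> P" for s
        proof
          assume *: "\<forall>k\<in>S. s k = t k"
          have "s -` T = S"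
          proof (intro set_eqI iffI)
            fix k assume "k \<in> s -` T"
            then obtain l where "l \<in> S" "s k = t l" using t by auto
            then have "s k = s l" using * by simp
            then have "k = l" using P[OF that] by (meson bij_is_inj injD)
            then show "k \<in> S" using \<open>l \<in> S\<close> by simp
          qed (use * t in auto)
          moreover have "restrict s S = t"
            using * t(1) by (auto simp: restrict_def extensional_def fun_eq_iff)
          ultimately show "key s = (S, t)" by (simp add: key_def)
        next
          assume "key s = (S, t)"
          then show "\<forall>k\<in>S. s k = t k" by (auto simp: key_def restrict_def)
        qed
        then show ?thesis by (auto simp: section_at_def block_def x)
      qed
      have "(\<Sum>x\<in>?Q. marg (block P (fst x) (snd x)) i j) = (\<Sum>x\<in>?Q. \<Sum>s | s \<in> ?P \<and> key s = x. mu s)"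
        unfolding marg_def mass_def using eq by (intro sum.cong refl) simp
      also have "\<dots> = sum mu ?P"
      proof (rule sum.group)
        show "key ` ?P \<subseteq> ?Q"
        proof
          fix x assume "x \<in> key ` ?P"
          then obtain s where s: "s \<in> P" "s i = j" "x = key s" by (auto simp: section_at_def)
          have "bij s" using P s by simp
          then have "inj_on s (s -` T)" "s ` (s -` T) = T"
            by (auto intro: inj_on_subset[OF bij_is_inj] simp: bij_is_surj surj_image_vimage_eq)
          then show "x \<in> ?Q" using s j by (auto simp: key_def I_def inj_on_def)
        qed
      qed (use finQ in auto)
      also have "\<dots> = marg P i j" by (simp add: marg_def mass_def)
      finally show "(\<Sum>x\<in>?Q. marg (block P (fst x) (snd x)) i j) = marg P i j" .
    qed auto
    finally show "(\<Sum>(S, t)\<in>?Q. ?w S * ?N (block P S t)) \<le> ?w T * local_ent (- T) (marg P i)" .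
  qed
  also have "\<dots> = (\<Sum>W\<in>UNIV. shapley CARD('n) (card W) * local_ent W (marg P i))"
  proof (rule sum.reindex_bij_witness[where i = uminus and j = uminus])
    fix T :: "'n set"
    have "card T \<le> CARD('n)" "card (- T) = CARD('n) - card T"
      by (auto simp: card_mono Compl_eq_Diff_UNIV card_Diff_subset)
    then show "shapley CARD('n) (card (- T)) * local_ent (- T) (marg P i) = ?w T * local_ent (- T) (marg P i)"
      by (auto simp: shapley_def)
  qed auto
  finally show ?thesis .
qed

text \<open>The terms with \<open>Srow\<close> of blocks in \<open>averaged_reveal_cost\<close> and the terms with \<open>Hrow\<close> in the
chain rule combine to local Bethe entropies of blocks, because exactly one further multiple of
\<open>excess\<close> is added.\<close>

theorem excess_bound:
  fixes E :: "('n \<times> 'n) set"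
  assumes P: "\<And>s. s \<in> P \<Longrightarrow> bij s" "\<And>s i. s \<in> P \<Longrightarrow> (i, s i) \<in> E"
    and G: "\<not> girth G < enat (2 * m)" "verts G = UNIV" "\<And>i j. (i, j) \<in> E \<Longrightarrow> {Inl i, Inr j} \<in> edges G"
    and m: "0 < m" and one: "mass P = 1"
  shows "real m * excess P \<le> real CARD('n) * ln 2"
proof -
  let ?w = "\<lambda>S. shapley CARD('n) (Suc (card S))"
  have avg: "real (m - 1) * excess P
    \<le> (\<Sum>i\<in>UNIV. Srow P i - (\<Sum>S\<in>Pow (UNIV - {i}). ?w S * block_sum P (\<lambda>B. Srow B i) S))"
    by (rule averaged_reveal_cost[of P E G m]) fact+
  have "real m * excess P = real (m - 1) * excess P + excess P"
    using m by (simp add: of_nat_diff algebra_simps)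
  also have "\<dots> \<le> (\<Sum>i\<in>UNIV. Srow P i - (\<Sum>S\<in>Pow (UNIV - {i}). ?w S * block_sum P (\<lambda>B. Srow B i) S))
      + ((\<Sum>i\<in>UNIV. \<Sum>S\<in>Pow (UNIV - {i}). ?w S * block_sum P (\<lambda>B. Hrow B i) S)
      - (\<Sum>i\<in>UNIV. Hrow P i - Srow P i))"
    unfolding entropy_chain_rule[symmetric]
    using avg by (simp add: excess_def)
  also have "\<dots> = (\<Sum>i\<in>UNIV. (\<Sum>S\<in>Pow (UNIV - {i}). ?w S * block_sum P (\<lambda>B. local_ent UNIV (marg B i)) S)
      + Srow P i - local_ent UNIV (marg P i))"
    unfolding local_ent_marg block_sum_def
    by (simp add: sum.distrib sum_subtractf right_diff_distrib sum_negf sum_distrib_left)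
  also have "\<dots> \<le> (\<Sum>i\<in>UNIV. (\<Sum>W\<in>UNIV. shapley CARD('n) (card W) * local_ent W (marg P i))
      + Srow P i - local_ent UNIV (marg P i))"
    using coarsen[OF P(1)] by (intro sum_mono) auto
  also have "\<dots> = (\<Sum>i\<in>UNIV. 2 * row_bound UNIV (marg P i))"
    using local_ent_average[of UNIV "marg P _"] one by (intro sum.cong refl) (simp add: marg_row Srow_def)
  also have "\<dots> \<le> (\<Sum>i\<in>(UNIV :: 'n set). ln 2)"
  proof (rule sum_mono)
    fix i
    have "row_bound UNIV (marg P i) \<le> ln 2 / 2" using one by (intro row_bound_le) (simp_all add: marg_row marg_nonneg)
    then show "2 * row_bound UNIV (marg P i) \<le> ln 2" by simp
  qed
  finally show ?thesis by simp
qed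

end

section \<open>The exchange inequality for half-edge configurations\<close>

text \<open>The map \<open>s\<close> lists the choices of the rows and \<open>t\<close> the choices of the columns.\<close>

definition consistent :: "('n \<times> 'n) set \<Rightarrow> ('n \<Rightarrow> 'n) \<Rightarrow> ('n \<Rightarrow> 'n) \<Rightarrow> bool" where
  "consistent C s t \<longleftrightarrow> (\<forall>(i, j)\<in>C. s i = j \<longleftrightarrow> t j = i)"

text \<open>The component of row \<open>k\<close> in the superposition of two configurations, when rows follow \<open>s\<close> and
columns follow \<open>t\<close> along the entries in \<open>C\<close>.\<close>

inductive_set orbit :: "('n \<times> 'n) set \<Rightarrow> ('n \<Rightarrow> 'n) \<Rightarrow> ('n \<Rightarrow> 'n) \<Rightarrow> 'n \<Rightarrow> ('n + 'n) set"
  for C s t k where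
  start: "Inl k \<in> orbit C s t k"
| row: "Inl i \<in> orbit C s t k \<Longrightarrow> (i, s i) \<in> C \<Longrightarrow> Inr (s i) \<in> orbit C s t k"
| column: "Inr j \<in> orbit C s t k \<Longrightarrow> (t j, j) \<in> C \<Longrightarrow> Inl (t j) \<in> orbit C s t k"

definition splice_rows :: "('n + 'n) set \<Rightarrow> ('n \<Rightarrow> 'n) \<Rightarrow> ('n \<Rightarrow> 'n) \<Rightarrow> 'n \<Rightarrow> 'n" where
  "splice_rows W s' s i = (if Inl i \<in> W then s' i else s i)"

definition splice_cols :: "('n + 'n) set \<Rightarrow> ('n \<Rightarrow> 'n) \<Rightarrow> ('n \<Rightarrow> 'n) \<Rightarrow> 'n \<Rightarrow> 'n" where
  "splice_cols W t' t j = (if Inr j \<in> W then t' j else t j)"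

lemma orbit_cong:
  assumes "\<And>i. Inl i \<in> orbit C s t k \<Longrightarrow> s' i = s i" "\<And>j. Inr j \<in> orbit C s t k \<Longrightarrow> t' j = t j"
  shows "orbit C s' t' k = orbit C s t k"
proof (intro set_eqI iffI)
  fix x assume "x \<in> orbit C s' t' k"
  then show "x \<in> orbit C s t k"
    by induction (auto simp: assms intro: orbit.intros)
next
  fix x assume "x \<in> orbit C s t k"
  then show "x \<in> orbit C s' t' k"
  proof induction
    case (row i)
    then show ?case using orbit.row[of i C s' t' k] assms(1)[of i] by simp
  next
    case (column j)
    then show ?case using orbit.column[of j C s' t' k] assms(2)[of j] by simp
  qed (rule orbit.start)
qed

context
  fixes C :: "('n \<times> 'n) set" and k l :: 'n and s t s' t' :: "'n \<Rightarrow> 'n" and W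
  assumes kl: "(k, l) \<notin> C" and c1: "consistent C s t" and c2: "consistent C s' t'"
    and s: "s k = l" and t': "t' l = k"
  defines "W \<equiv> orbit C s' t k"
begin

lemma orbit_row_source:
  assumes "Inl i \<in> W" "(i, j) \<in> C" "t j = i"
  shows "Inr j \<in> W"
proof -
  from assms(1) have "Inl i \<in> orbit C s' t k" unfolding W_def .
  then show ?thesis
  proof cases
  case start
  then have "s k = j" using c1 assms by (auto simp: consistent_def)
  then show ?thesis using s kl assms start by simp
next
  case (column j0)
  then have "s i = j0" "s i = j" using c1 assms by (auto simp: consistent_def)
  then show ?thesis using column by (simp add: W_def)
qed
qed

lemma orbit_column_source:
  assumes "Inr j \<in> W" "(i, j) \<in> C" "s' i = j"
  shows "Inl i \<in> W"
proof -
  from assms(1) have "Inr j \<in> orbit C s' t k" unfolding W_def .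
  then show ?thesis
  proof cases
  case (row i0)
  then have "t' j = i0" "t' j = i" using c2 assms by (auto simp: consistent_def)
  then show ?thesis using row by (simp add: W_def)
qed
qed

text \<open>No choice of either configuration crosses the boundary of the orbit along an entry of \<open>C\<close>. An
orbit is closed forward by definition; backward it is closed because consistency makes the chosen
entries at a vertex unique, and because the entry \<open>(k, l)\<close> that row \<open>k\<close> chooses is not in \<open>C\<close>.\<close>

lemma orbit_boundary:
  assumes "(i, j) \<in> C" "Inl i \<in> W \<longleftrightarrow> Inr j \<notin> W"
  shows "s i \<noteq> j" "t j \<noteq> i" "s' i \<noteq> j" "t' j \<noteq> i"
proof -
  have "t j \<noteq> i"
  proof
    assume e: "t j = i"
    show False
    proof (cases "Inl i \<in> W")
      case True
      then show False using orbit_row_source[OF True assms(1) e] assms(2) by simp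
    next
      case False
      then have "Inr j \<in> W" using assms(2) by simp
      then have "Inl (t j) \<in> W" unfolding W_def by (rule orbit.column) (simp add: e assms(1))
      then show False using False e by simp
    qed
  qed
  moreover have "s' i \<noteq> j"
  proof
    assume e: "s' i = j"
    show False
    proof (cases "Inl i \<in> W")
      case True
      then have "Inr (s' i) \<in> W" unfolding W_def by (rule orbit.row) (simp add: e assms(1))
      then show False using True assms(2) e by simp
    next
      case False
      then have "Inr j \<in> W" using assms(2) by simp
      then show False using orbit_column_source[OF _ assms(1) e] False by simp
    qed
  qed
  moreover have "s i = j \<longleftrightarrow> t j = i" "s' i = j \<longleftrightarrow> t' j = i"
    using assms(1) c1 c2 by (auto simp: consistent_def)
  ultimately show "s i \<noteq> j" "t j \<noteq> i" "s' i \<noteq> j" "t' j \<noteq> i" by simp_all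
qed

lemma target_not_in_orbit: "Inr l \<notin> W"
proof
  assume "Inr l \<in> W"
  then show False unfolding W_def
  proof (cases rule: orbit.cases)
    case (row i)
    then have "t' l = i" using c2 by (auto simp: consistent_def)
    then show False using row t' kl by simp
  qed
qed

lemma splice_consistent:
  "consistent C (splice_rows W s' s) (splice_cols W t' t)"
  "consistent C (splice_rows W s s') (splice_cols W t t')"
proof -
  have e: "(if Inl i \<in> W then s' i else s i) = j \<longleftrightarrow> (if Inr j \<in> W then t' j else t j) = i"
    "(if Inl i \<in> W then s i else s' i) = j \<longleftrightarrow> (if Inr j \<in> W then t j else t' j) = i" if "(i, j) \<in> C" for i j
    using orbit_boundary[of i j] c1 c2 that by (auto simp: consistent_def)
  show "consistent C (splice_rows W s' s) (splice_cols W t' t)"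
    unfolding consistent_def
  proof
    fix x assume "x \<in> C"
    then show "case x of (i, j) \<Rightarrow> (splice_rows W s' s i = j) = (splice_cols W t' t j = i)"
      using e(1)[of "fst x" "snd x"] by (simp add: split_beta splice_rows_def splice_cols_def)
  qed
  show "consistent C (splice_rows W s s') (splice_cols W t t')"
    unfolding consistent_def
  proof
    fix x assume "x \<in> C"
    then show "case x of (i, j) \<Rightarrow> (splice_rows W s s' i = j) = (splice_cols W t t' j = i)"
      using e(2)[of "fst x" "snd x"] by (simp add: split_beta splice_rows_def splice_cols_def)
  qed
qed

end

definition half_weight :: "('n::finite \<Rightarrow> 'n \<Rightarrow> real) \<Rightarrow> ('n \<Rightarrow> 'n \<Rightarrow> real) \<Rightarrow> ('n \<Rightarrow> 'n) \<times> ('n \<Rightarrow> 'n) \<Rightarrow> real" where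
  "half_weight u v x = (\<Prod>i\<in>UNIV. u i (fst x i)) * (\<Prod>j\<in>UNIV. v (snd x j) j)"

text \<open>The booleans tell whether row \<open>k\<close> chooses column \<open>l\<close>, and whether column \<open>l\<close> chooses row \<open>k\<close>.\<close>

definition configs :: "('n::finite \<times> 'n) set \<Rightarrow> 'n \<Rightarrow> 'n \<Rightarrow> bool \<Rightarrow> bool \<Rightarrow> (('n \<Rightarrow> 'n) \<times> ('n \<Rightarrow> 'n)) set" where
  "configs C k l b c = {x. consistent C (fst x) (snd x) \<and> (fst x k = l \<longleftrightarrow> b) \<and> (snd x l = k \<longleftrightarrow> c)}"

lemma half_weight_nonneg:
  assumes "\<And>i j. 0 \<le> u i j" "\<And>i j. 0 \<le> v i j"
  shows "0 \<le> half_weight u v x"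
  unfolding half_weight_def using assms by (intro mult_nonneg_nonneg prod_nonneg) auto

lemma half_weight_splice:
  "half_weight u v (splice_rows W s' s, splice_cols W t' t) * half_weight u v (splice_rows W s s', splice_cols W t t')
   = half_weight u v (s, t) * half_weight u v (s', t')"
proof -
  have "(\<Prod>i\<in>UNIV. u i (splice_rows W s' s i)) * (\<Prod>i\<in>UNIV. u i (splice_rows W s s' i))
      = (\<Prod>i\<in>UNIV. u i (s i)) * (\<Prod>i\<in>UNIV. u i (s' i))"
    unfolding prod.distrib[symmetric] by (intro prod.cong) (auto simp: splice_rows_def)
  moreover have "(\<Prod>j\<in>UNIV. v (splice_cols W t' t j) j) * (\<Prod>j\<in>UNIV. v (splice_cols W t t' j) j)
      = (\<Prod>j\<in>UNIV. v (t j) j) * (\<Prod>j\<in>UNIV. v (t' j) j)"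
    unfolding prod.distrib[symmetric] by (intro prod.cong) (auto simp: splice_cols_def)
  moreover have "(a * b) * (c * d) = (a * c) * (b * d)" for a b c d :: real by simp
  ultimately show ?thesis unfolding half_weight_def fst_conv snd_conv by (simp only:)
qed

lemma splice_splice:
  "splice_rows W (splice_rows W s s') (splice_rows W s' s) = s"
  "splice_rows W (splice_rows W s' s) (splice_rows W s s') = s'"
  "splice_cols W (splice_cols W t t') (splice_cols W t' t) = t"
  "splice_cols W (splice_cols W t' t) (splice_cols W t t') = t'"
  by (auto simp: splice_rows_def splice_cols_def fun_eq_iff)

text \<open>Two configurations in each of which only one end chooses the entry \<open>(k, l)\<close> are exchanged on the
orbit of row \<open>k\<close>, which does not contain column \<open>l\<close>. One of the new configurations has both
choices and the other one has none; weights and consistency are preserved. The exchange is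
injective, as the orbit can be recovered from the new pair.\<close>

lemma exchange_inequality:
  fixes C :: "('n::finite \<times> 'n) set"
  assumes kl: "(k, l) \<notin> C" and nn: "\<And>i j. 0 \<le> u i j" "\<And>i j. 0 \<le> v i j"
  shows "sum (half_weight u v) (configs C k l True False) * sum (half_weight u v) (configs C k l False True)
    \<le> sum (half_weight u v) (configs C k l False False) * sum (half_weight u v) (configs C k l True True)"
proof -
  let ?w = "half_weight u v"
  let ?W = "\<lambda>x y. orbit C (fst y) (snd x) k"
  define swap where "swap W x y =
     ((splice_rows W (fst y) (fst x), splice_cols W (snd y) (snd x)),
      (splice_rows W (fst x) (fst y), splice_cols W (snd x) (snd y)))"
    for W and x y :: "('n \<Rightarrow> 'n) \<times> ('n \<Rightarrow> 'n)"
  define h where "h z = swap (?W (fst z) (snd z)) (fst z) (snd z)" for z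
  \<comment> \<open>The orbit only depends on row choices and column choices inside of it. After the exchange
    the first configuration carries these row choices and the second one the column choices.\<close>
  define h' where "h' z = swap (orbit C (fst (fst z)) (snd (snd z)) k) (fst z) (snd z)" for z
  let ?D = "configs C k l True False \<times> configs C k l False True"
  let ?R = "configs C k l False False \<times> configs C k l True True"
  have inv: "h' (h z) = z" for z
  proof -
    obtain s t s' t' where z: "z = ((s, t), (s', t'))" by (metis surj_pair)
    let ?V = "orbit C s' t k"
    have "orbit C (splice_rows ?V s' s) (splice_cols ?V t t') k = ?V"
      by (rule orbit_cong) (auto simp: splice_rows_def splice_cols_def)
    then show ?thesis by (simp add: z h_def h'_def swap_def splice_splice)
  qed
  have into: "h z \<in> ?R" if "z \<in> ?D" for z
  proof -
    obtain s t s' t' where z: "z = ((s, t), (s', t'))" by (metis surj_pair)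
    let ?V = "orbit C s' t k"
    have c: "consistent C s t" "consistent C s' t'" "s k = l" "t l \<noteq> k" "s' k \<noteq> l" "t' l = k"
      using that by (auto simp: z configs_def)
    have k: "Inl k \<in> ?V" by (rule orbit.start)
    have l: "Inr l \<notin> ?V" by (rule target_not_in_orbit[OF kl c(1,2,3,6)])
    have "splice_rows ?V s' s k \<noteq> l" "splice_rows ?V s s' k = l" "splice_cols ?V t' t l \<noteq> k" "splice_cols ?V t t' l = k"
      using c k l by (simp_all add: splice_rows_def splice_cols_def)
    with splice_consistent[OF kl c(1,2,3,6)] show ?thesis
      by (simp add: z h_def swap_def configs_def)
  qed
  have weight: "?w (fst (h z)) * ?w (snd (h z)) = ?w (fst z) * ?w (snd z)" for z
  proof -
    obtain s t s' t' where z: "z = ((s, t), (s', t'))" by (metis surj_pair)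
    show ?thesis unfolding z h_def swap_def fst_conv snd_conv by (rule half_weight_splice)
  qed
  have "sum ?w (configs C k l True False) * sum ?w (configs C k l False True) = (\<Sum>z\<in>?D. ?w (fst z) * ?w (snd z))"
    by (simp only: sum_product sum.cartesian_product case_prod_unfold)
  also have "\<dots> = (\<Sum>z\<in>?D. ?w (fst (h z)) * ?w (snd (h z)))" by (simp add: weight)
  also have "\<dots> = (\<Sum>z\<in>h ` ?D. ?w (fst z) * ?w (snd z))"
    using inv by (subst sum.reindex) (auto intro!: inj_on_inverseI[where g = h'])
  also have "\<dots> \<le> (\<Sum>z\<in>?R. ?w (fst z) * ?w (snd z))"
  proof (rule sum_mono2)
    show "h ` ?D \<subseteq> ?R" using into by (rule image_subsetI)
    show "0 \<le> ?w (fst z) * ?w (snd z)" for z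
      by (intro mult_nonneg_nonneg half_weight_nonneg nn)
  qed simp
  also have "\<dots> = sum ?w (configs C k l False False) * sum ?w (configs C k l True True)"
    by (simp only: sum_product sum.cartesian_product case_prod_unfold)
  finally show ?thesis .
qed

section \<open>The permanent bounds the objective\<close>

text \<open>The factor of an edge in the objective.\<close>

definition edge_factor :: "real \<Rightarrow> real \<Rightarrow> real" where
  "edge_factor a p = (if p = 0 then 1 else (a / p) powr p) * (if p = 1 then 1 else (1 - p) powr (1 - p))"

text \<open>The factor of an edge of weight \<open>x\<close>, the product of its two half-edge weights, as long as its ends
choose independently.\<close>

definition half_edge_factor :: "real \<Rightarrow> real \<Rightarrow> real" where
  "half_edge_factor x p = (if p = 0 then 1 else (x / p\<^sup>2) powr p)"

lemma edge_factor_nonneg: "0 \<le> edge_factor a p"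
  by (simp add: edge_factor_def)

lemma half_edge_factor_nonneg: "0 \<le> half_edge_factor x p"
  by (simp add: half_edge_factor_def)

text \<open>The premise is used at one point \<open>(y, z)\<close>, the one at which the bound is sharp for \<open>b c = a d\<close>.
There the polynomial is at most \<open>a / (1 - p)\<^sup>2\<close>, and the weighted inequality of the means for \<open>a\<close>
and \<open>d A\<close> gives the claim.\<close>

lemma coefficient_bound:
  fixes a b c d K A p :: real
  assumes pos: "0 < a" "0 < b" "0 \<le> c" "0 < d" "0 < A" and p: "0 < p" "p < 1" and K: "0 \<le> K"
    and bc: "b * c \<le> a * d"
    and f: "\<And>y z. 0 < y \<Longrightarrow> 0 < z \<Longrightarrow> K * half_edge_factor (y * z) p \<le> a + b * y + c * z + d * y * z"
  shows "K * edge_factor A p \<le> a + d * A"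
proof -
  define q where "q = 1 - p"
  have q: "0 < q" "p + q = 1" using p by (auto simp: q_def)
  define y where "y = p * a / (q * b)"
  define z where "z = p * b / (q * d)"
  have yz: "0 < y" "0 < z" using pos p q by (auto simp: y_def z_def)
  have by1: "b * y = a * (p / q)" using pos q by (simp add: y_def)
  have "c * z = (b * c) * p / (q * d)" by (simp add: z_def)
  also have "\<dots> \<le> (a * d) * p / (q * d)"
    using bc pos p q by (intro divide_right_mono mult_right_mono) auto
  also have "\<dots> = a * (p / q)" using pos by simp
  finally have cz: "c * z \<le> a * (p / q)" .
  have dyz: "d * y * z = a * (p / q)\<^sup>2"
    using pos q by (simp add: y_def z_def power2_eq_square)
  have "y * z / p\<^sup>2 = a / (q\<^sup>2 * d)"
    using pos p q by (simp add: y_def z_def power2_eq_square)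
  then have "K * (a / (q\<^sup>2 * d)) powr p \<le> a + b * y + c * z + d * y * z"
    using f[OF yz] p by (simp add: half_edge_factor_def)
  also have "\<dots> \<le> a + a * (p / q) + a * (p / q) + a * (p / q)\<^sup>2"
    using by1 cz dyz by simp
  also have "\<dots> = a * (1 + p / q)\<^sup>2" by (simp add: power2_eq_square algebra_simps)
  also have "1 + p / q = 1 / q" using q by (simp add: field_simps)
  finally have *: "K * (a / (q\<^sup>2 * d)) powr p \<le> a / q\<^sup>2" by (simp add: power_divide)
  have e1: "(a / (q\<^sup>2 * d)) powr p * ((d * A / p) powr p * (q\<^sup>2 / a) powr p) = (A / p) powr p"
    using pos p q by (simp add: powr_mult[symmetric])
  have "(a / q\<^sup>2) * (q\<^sup>2 / a) powr p = (a / q\<^sup>2) powr 1 * (a / q\<^sup>2) powr (- p)"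
    using pos q by (simp add: powr_minus powr_divide)
  also have "\<dots> = (a / q\<^sup>2) powr q"
    unfolding powr_add[symmetric] using q by (simp add: q_def)
  finally have e2: "(a / q\<^sup>2) * (q\<^sup>2 / a) powr p = (a / q\<^sup>2) powr q" .
  have "K * edge_factor A p = K * (a / (q\<^sup>2 * d)) powr p * (((d * A / p) powr p * (q\<^sup>2 / a) powr p) * q powr q)"
    unfolding edge_factor_def e1[symmetric] using p by (simp add: q_def)
  also have "\<dots> \<le> (a / q\<^sup>2) * (((d * A / p) powr p * (q\<^sup>2 / a) powr p) * q powr q)"
    using * by (intro mult_right_mono) auto
  also have "\<dots> = (d * A / p) powr p * ((a / q\<^sup>2) powr q * q powr q)"
    unfolding e2[symmetric] by simp
  also have "(a / q\<^sup>2) powr q * q powr q = (a / q) powr q"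
    using pos q by (simp add: powr_mult[symmetric] power2_eq_square)
  also have "(d * A / p) powr p * (a / q) powr q \<le> p * (d * A / p) + q * (a / q)"
    using pos p q by (intro Youngs_inequality_0) auto
  also have "\<dots> = a + d * A" using p q by simp
  finally show ?thesis .
qed

lemma le_of_le_add_small:
  fixes K a c :: real
  assumes "\<And>e. 0 < e \<Longrightarrow> e < 1 \<Longrightarrow> K \<le> a + c * e"
  shows "K \<le> a"
proof (rule tendsto_lowerbound)
  have "((\<lambda>e. a + c * e) \<longlongrightarrow> a + c * 0) (at_right 0)"
    by (intro tendsto_intros)
  then show "((\<lambda>e. a + c * e) \<longlongrightarrow> a) (at_right 0)" by simp
  show "eventually (\<lambda>e. K \<le> a + c * e) (at_right 0)"
    using eventually_at_right_real[of 0 1] by (auto elim!: eventually_mono intro: assms)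
qed simp

text \<open>For \<open>p = 0\<close> and \<open>p = 1\<close> the extremal point moves to \<open>0\<close> and to infinity. For \<open>0 < p < 1\<close> the
coefficients are perturbed to be positive.\<close>

lemma coefficient_bound_limit:
  fixes a b c d K A p :: real
  assumes nn: "0 \<le> a" "0 \<le> b" "0 \<le> c" "0 \<le> d" "0 \<le> A" and p: "0 \<le> p" "p \<le> 1" "A = 0 \<Longrightarrow> p = 0" and K: "0 \<le> K"
    and bc: "b * c \<le> a * d"
    and f: "\<And>y z. 0 < y \<Longrightarrow> 0 < z \<Longrightarrow> K * half_edge_factor (y * z) p \<le> a + b * y + c * z + d * y * z"
  shows "K * edge_factor A p \<le> a + d * A"
proof -
  consider "p = 0" | "p = 1" | "0 < p" "p < 1" using p by linarith
  then show ?thesis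
  proof cases
    case 1
    have "K \<le> a + (b + c + d) * e" if "0 < e" "e < 1" for e
    proof -
      have "K \<le> a + b * e + c * e + d * e * e" using f[of e e] that 1 by (simp add: half_edge_factor_def)
      also have "d * e * e \<le> d * e" using that nn by (simp add: mult_left_le)
      finally show ?thesis by (simp add: algebra_simps)
    qed
    then have "K \<le> a" by (rule le_of_le_add_small)
    then show ?thesis using 1 nn by (simp add: edge_factor_def add_increasing2)
  next
    case 2
    have "K \<le> d + (a + b + c) * e" if "0 < e" "e < 1" for e
    proof -
      have "K * (1 / (e * e)) \<le> a + b / e + c / e + d / (e * e)"
        using f[of "1 / e" "1 / e"] that 2 by (simp add: half_edge_factor_def)
      then have "K * (1 / (e * e)) * (e * e) \<le> (a + b / e + c / e + d / (e * e)) * (e * e)"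
        using that by (intro mult_right_mono) auto
      also have "\<dots> = a * e * e + b * e + c * e + d" using that by (simp add: field_simps)
      also have "K * (1 / (e * e)) * (e * e) = K" using that by simp
      finally have "K \<le> a * e * e + b * e + c * e + d" .
      also have "a * e * e \<le> a * e" using that nn by (simp add: mult_left_le)
      finally show ?thesis by (simp add: algebra_simps)
    qed
    then have "K \<le> d" by (rule le_of_le_add_small)
    then have "K * A \<le> d * A" using nn by (intro mult_right_mono)
    then show ?thesis using 2 nn by (simp add: edge_factor_def)
  next
    case 3
    then have A: "0 < A" using p nn by force
    have "K * edge_factor A p \<le> a + d * A + e" if "0 < e" for e
    proof -
      define r where "r = e / (1 + A)"
      have r: "0 < r" using that nn by (simp add: r_def)
      \<comment> \<open>So small that \<open>(b + h) c \<le> (a + r) (d + r)\<close> still holds, although \<open>b\<close> may be \<open>0\<close>.\<close>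
      define h where "h = r\<^sup>2 / (1 + c)"
      have h: "0 < h" "h * c \<le> r\<^sup>2" using r nn by (auto simp: h_def field_simps)
      have "K * edge_factor A p \<le> (a + r) + (d + r) * A"
      proof (rule coefficient_bound[where b = "b + h" and c = c])
        have "(b + h) * c \<le> a * d + r\<^sup>2" using bc h by (simp add: algebra_simps)
        also have "\<dots> \<le> (a + r) * (d + r)" using nn r by (simp add: algebra_simps power2_eq_square)
        finally show "(b + h) * c \<le> (a + r) * (d + r)" .
        fix y z :: real assume yz: "0 < y" "0 < z"
        have "a + b * y + c * z + d * y * z \<le> (a + r) + (b + h) * y + c * z + (d + r) * y * z"
          using yz r h by (intro add_mono mult_right_mono) auto
        with f[OF yz] show "K * half_edge_factor (y * z) p \<le> (a + r) + (b + h) * y + c * z + (d + r) * y * z"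
          by linarith
      qed (use nn r h A 3 K in auto)
      also have "\<dots> = a + d * A + r * (1 + A)" by (simp add: algebra_simps)
      also have "r * (1 + A) = e" using nn by (simp add: r_def)
      finally show ?thesis .
    qed
    then show ?thesis by (rule field_le_epsilon)
  qed
qed

definition half_edge_sum :: "('n::finite \<times> 'n) set \<Rightarrow> ('n \<Rightarrow> 'n \<Rightarrow> real) \<Rightarrow> ('n \<Rightarrow> 'n \<Rightarrow> real) \<Rightarrow> real" where
  "half_edge_sum C u v = sum (half_weight u v) {x. consistent C (fst x) (snd x)}"

definition set_entry :: "('n \<Rightarrow> 'n \<Rightarrow> real) \<Rightarrow> 'n \<Rightarrow> 'n \<Rightarrow> real \<Rightarrow> 'n \<Rightarrow> 'n \<Rightarrow> real" where
  "set_entry u k l y i j = (if i = k \<and> j = l then y else u i j)"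

lemma half_weight_set_entry:
  "half_weight (set_entry u k l y) (set_entry v k l z) x
   = half_weight (set_entry u k l 1) (set_entry v k l 1) x * ((if fst x k = l then y else 1) * (if snd x l = k then z else 1))"
proof -
  have "(\<Prod>i\<in>UNIV. set_entry u k l y i (f i)) = (\<Prod>i\<in>UNIV. set_entry u k l 1 i (f i)) * (if f k = l then y else 1)" for f
  proof -
    have "(\<Prod>i\<in>UNIV. set_entry u k l y i (f i)) = (\<Prod>i\<in>UNIV. set_entry u k l 1 i (f i) * (if i = k then (if f k = l then y else 1) else 1))"
      by (intro prod.cong) (auto simp: set_entry_def)
    then show ?thesis by (simp add: prod.distrib)
  qed
  moreover have "(\<Prod>j\<in>UNIV. set_entry v k l z (f j) j) = (\<Prod>j\<in>UNIV. set_entry v k l 1 (f j) j) * (if f l = k then z else 1)" for f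
  proof -
    have "(\<Prod>j\<in>UNIV. set_entry v k l z (f j) j) = (\<Prod>j\<in>UNIV. set_entry v k l 1 (f j) j * (if j = l then (if f l = k then z else 1) else 1))"
      by (intro prod.cong) (auto simp: set_entry_def)
    then show ?thesis by (simp add: prod.distrib)
  qed
  ultimately show ?thesis unfolding half_weight_def by simp
qed

lemma sum_configs_set_entry:
  "sum (half_weight (set_entry u k l y) (set_entry v k l z)) (configs C k l b c)
   = sum (half_weight (set_entry u k l 1) (set_entry v k l 1)) (configs C k l b c) * ((if b then y else 1) * (if c then z else 1))"
  unfolding sum_distrib_right
  by (intro sum.cong refl, subst half_weight_set_entry) (auto simp: configs_def)

lemma consistent_insert:
  "consistent (insert (k, l) C) s t \<longleftrightarrow> consistent C s t \<and> (s k = l \<longleftrightarrow> t l = k)"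
  by (auto simp: consistent_def)

text \<open>Together with \<open>sum_configs_set_entry\<close> this shows that the sum is a polynomial of degree one in each
of the two half-edge weights at \<open>(k, l)\<close>.\<close>

lemma half_edge_sum_split:
  "half_edge_sum C u v = sum (half_weight u v) (configs C k l False False) + sum (half_weight u v) (configs C k l True False)
    + sum (half_weight u v) (configs C k l False True) + sum (half_weight u v) (configs C k l True True)"
proof -
  have "{x. consistent C (fst x) (snd x)} = configs C k l False False \<union> configs C k l True False
      \<union> configs C k l False True \<union> configs C k l True True"
    by (auto simp: configs_def)
  then show ?thesis unfolding half_edge_sum_def
    by (simp add: sum.union_disjoint configs_def disjoint_iff)
qed

lemma half_edge_sum_insert:
  "half_edge_sum (insert (k, l) C) u v = sum (half_weight u v) (configs C k l False False) + sum (half_weight u v) (configs C k l True True)"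
proof -
  have "{x. consistent (insert (k, l) C) (fst x) (snd x)} = configs C k l False False \<union> configs C k l True True"
    by (auto simp: configs_def consistent_insert)
  then show ?thesis unfolding half_edge_sum_def
    by (simp add: sum.union_disjoint configs_def disjoint_iff)
qed

lemma half_edge_sum_insert_bound:
  fixes C :: "('n::finite \<times> 'n) set"
  assumes kl: "(k, l) \<notin> C" and nn: "\<And>i j. 0 \<le> u i j" "\<And>i j. 0 \<le> v i j"
    and p: "0 \<le> p" "p \<le> 1" "A = 0 \<Longrightarrow> p = 0" and A: "0 \<le> A" and K: "0 \<le> K"
    and f: "\<And>y z. 0 < y \<Longrightarrow> 0 < z \<Longrightarrow> K * half_edge_factor (y * z) p \<le> half_edge_sum C (set_entry u k l y) (set_entry v k l z)"
  shows "K * edge_factor A p \<le> half_edge_sum (insert (k, l) C) (set_entry u k l A) (set_entry v k l 1)"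
proof -
  let ?u = "set_entry u k l 1" and ?v = "set_entry v k l 1"
  let ?c = "\<lambda>b c. sum (half_weight ?u ?v) (configs C k l b c)"
  have nn1: "0 \<le> ?u i j" "0 \<le> ?v i j" for i j using nn by (auto simp: set_entry_def)
  have c: "0 \<le> ?c b c" for b c by (intro sum_nonneg half_weight_nonneg nn1)
  have "K * edge_factor A p \<le> ?c False False + ?c True True * A"
  proof (rule coefficient_bound_limit[where b = "?c True False" and c = "?c False True"])
    show "?c True False * ?c False True \<le> ?c False False * ?c True True"
      by (rule exchange_inequality[OF kl nn1])
    fix y z :: real assume yz: "0 < y" "0 < z"
    from f[OF yz] show "K * half_edge_factor (y * z) p \<le> ?c False False + ?c True False * y + ?c False True * z + ?c True True * y * z"
      unfolding half_edge_sum_split[of C _ _ k l] sum_configs_set_entry[of u k l y v z] by (simp add: mult.assoc)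
  qed (use c p A K in auto)
  also have "\<dots> = half_edge_sum (insert (k, l) C) (set_entry u k l A) (set_entry v k l 1)"
    unfolding half_edge_sum_insert sum_configs_set_entry[of u k l A v 1] by simp
  finally show ?thesis .
qed

text \<open>The weighted inequality of the arithmetic and geometric means.\<close>

lemma weighted_sum_bound:
  fixes y p :: "'a::finite \<Rightarrow> real"
  assumes y: "\<And>j. 0 < y j" and p: "\<And>j. 0 \<le> p j" "sum p UNIV = 1"
  shows "(\<Prod>j\<in>UNIV. if p j = 0 then 1 else (y j / p j) powr p j) \<le> sum y UNIV"
proof -
  have "(\<Sum>j\<in>UNIV. ent (y j) (p j)) \<le> ent (sum y UNIV) (sum p UNIV)"
    using y p by (intro log_sum_inequality_general) (auto intro: less_imp_le)
  then have *: "(\<Sum>j\<in>UNIV. ent (y j) (p j)) \<le> ln (sum y UNIV)" using p by (simp add: ent_def)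
  have "0 < sum y UNIV" using y by (intro sum_pos) auto
  have "(\<Prod>j\<in>UNIV. if p j = 0 then 1 else (y j / p j) powr p j) = (\<Prod>j\<in>UNIV. exp (ent (y j) (p j)))"
  proof (intro prod.cong refl)
    fix j
    show "(if p j = 0 then 1 else (y j / p j) powr p j) = exp (ent (y j) (p j))"
      using y[of j] p(1)[of j] by (auto simp: ent_def powr_def ln_div)
  qed
  also have "\<dots> = exp (\<Sum>j\<in>UNIV. ent (y j) (p j))" by (simp add: exp_sum)
  also have "\<dots> \<le> exp (ln (sum y UNIV))" using * by simp
  also have "\<dots> = sum y UNIV" using \<open>0 < sum y UNIV\<close> by simp
  finally show ?thesis .
qed

lemma half_edge_sum_empty:
  fixes u v :: "'n::finite \<Rightarrow> 'n \<Rightarrow> real"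
  shows "half_edge_sum {} u v = (\<Prod>i\<in>UNIV. \<Sum>j\<in>UNIV. u i j) * (\<Prod>j\<in>UNIV. \<Sum>i\<in>UNIV. v i j)"
proof -
  have "(\<Prod>i\<in>UNIV. \<Sum>j\<in>UNIV. w i j) = (\<Sum>s\<in>UNIV. \<Prod>i\<in>UNIV. w i (s i))" for w :: "'n \<Rightarrow> 'n \<Rightarrow> real"
    using prod_sum_PiE[of "UNIV :: 'n set" "\<lambda>_. UNIV :: 'n set" w] by (simp add: PiE_UNIV_domain)
  from this[of u] this[of "\<lambda>j i. v i j"] show ?thesis
    unfolding half_edge_sum_def half_weight_def
    by (simp add: consistent_def sum_product sum.cartesian_product case_prod_unfold)
qed

lemma half_edge_sum_UNIV:
  fixes u :: "'n::finite \<Rightarrow> 'n \<Rightarrow> real"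
  shows "half_edge_sum UNIV u (\<lambda>_ _. 1) = (\<Sum>s | bij s. \<Prod>i\<in>UNIV. u i (s i))"
proof -
  have "consistent UNIV s t \<longleftrightarrow> bij s \<and> t = inv s" for s t :: "'n \<Rightarrow> 'n"
  proof
    assume "consistent UNIV s t"
    then have c: "s i = j \<longleftrightarrow> t j = i" for i j by (auto simp: consistent_def)
    have "s \<circ> t = id" "t \<circ> s = id" using c by (auto simp: fun_eq_iff)
    then show "bij s \<and> t = inv s" using o_bij inv_unique_comp by metis
  next
    assume "bij s \<and> t = inv s"
    then show "consistent UNIV s t"
      by (auto simp: consistent_def bij_is_inj bij_is_surj surj_f_inv_f inv_f_eq)
  qed
  then have "{x. consistent UNIV (fst x) (snd x)} = (\<lambda>s :: 'n \<Rightarrow> 'n. (s, inv s)) ` {s. bij s}" by force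
  then show ?thesis unfolding half_edge_sum_def
    by (simp add: sum.reindex inj_on_def half_weight_def)
qed

text \<open>Induction over the set \<open>C\<close> of the entries at which consistency is required. Entries in \<open>C\<close> have
the weight \<open>A i j\<close> on the row side and \<open>1\<close> on the column side; the half-edge weights of all
other entries stay variable, since each induction step needs the bound for all values of its
own two variables.\<close>

theorem edge_factors_le_permanent:
  fixes A p :: "'n::finite \<Rightarrow> 'n \<Rightarrow> real"
  assumes A: "\<And>i j. 0 \<le> A i j" and p: "\<And>i j. 0 \<le> p i j" "\<And>i j. A i j = 0 \<Longrightarrow> p i j = 0"
    and rows: "\<And>i. (\<Sum>j\<in>UNIV. p i j) = 1" and cols: "\<And>j. (\<Sum>i\<in>UNIV. p i j) = 1"
  shows "(\<Prod>(i, j)\<in>UNIV. edge_factor (A i j) (p i j)) \<le> (\<Sum>s | bij s. \<Prod>i\<in>UNIV. A i (s i))"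
proof -
  let ?f = "\<lambda>C y z (i, j). if (i, j) \<in> C then edge_factor (A i j) (p i j) else half_edge_factor (y i j * z i j) (p i j)"
  let ?u = "\<lambda>C y i j. if (i, j) \<in> C then A i j else y i j"
  let ?v = "\<lambda>C z i j. if (i, j) \<in> C then 1 else z i j"
  have p1: "p i j \<le> 1" for i j
    unfolding rows[of i, symmetric] using p by (intro member_le_sum) auto
  have main: "(\<Prod>x\<in>UNIV. ?f C y z x) \<le> half_edge_sum C (?u C y) (?v C z)"
    if "\<And>i j. 0 < y i j" "\<And>i j. 0 < z i j" for C :: "('n \<times> 'n) set" and y z :: "'n \<Rightarrow> 'n \<Rightarrow> real"
    using finite[of C] that
  proof (induction C arbitrary: y z rule: finite_induct)
    case empty
    let ?w = "\<lambda>y (i, j). if p i j = 0 then 1 else (y i j / p i j) powr p i j"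
    have "(\<Prod>x\<in>UNIV. ?f {} y z x) = (\<Prod>x\<in>UNIV. ?w y x * ?w z x)"
    proof (intro prod.cong refl)
      fix x :: "'n \<times> 'n"
      obtain i j where x: "x = (i, j)" by (cases x)
      have "y i j * z i j / (p i j)\<^sup>2 = (y i j / p i j) * (z i j / p i j)" by (simp add: power2_eq_square)
      also have "\<dots> powr p i j = (y i j / p i j) powr p i j * (z i j / p i j) powr p i j"
        using empty[of i j] p(1)[of i j] by (intro powr_mult)
      finally show "?f {} y z x = ?w y x * ?w z x"
        by (simp add: x half_edge_factor_def)
    qed
    also have "\<dots> = (\<Prod>i\<in>UNIV. \<Prod>j\<in>UNIV. ?w y (i, j)) * (\<Prod>j\<in>UNIV. \<Prod>i\<in>UNIV. ?w z (i, j))"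
    proof -
      have "(\<Prod>x\<in>UNIV. g x) = (\<Prod>i\<in>UNIV. \<Prod>j\<in>UNIV. g (i, j))" for g :: "'n \<times> 'n \<Rightarrow> real"
        unfolding UNIV_Times_UNIV[symmetric] by (simp add: prod.cartesian_product case_prod_unfold)
      then have "(\<Prod>x\<in>UNIV. ?w y x * ?w z x) = (\<Prod>i\<in>UNIV. \<Prod>j\<in>UNIV. ?w y (i, j)) * (\<Prod>i\<in>UNIV. \<Prod>j\<in>UNIV. ?w z (i, j))"
        by (simp only: prod.distrib)
      also have "(\<Prod>i\<in>UNIV. \<Prod>j\<in>UNIV. ?w z (i, j)) = (\<Prod>j\<in>UNIV. \<Prod>i\<in>UNIV. ?w z (i, j))"
        by (rule prod.swap)
      finally show ?thesis .
    qed
    also have "\<dots> \<le> (\<Prod>i\<in>UNIV. \<Sum>j\<in>UNIV. y i j) * (\<Prod>j\<in>UNIV. \<Sum>i\<in>UNIV. z i j)"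
    proof (intro mult_mono prod_mono conjI prod_nonneg ballI sum_nonneg)
      fix i j
      show "(\<Prod>j\<in>UNIV. ?w y (i, j)) \<le> (\<Sum>j\<in>UNIV. y i j)"
        using weighted_sum_bound[of "y i" "p i"] empty p rows by simp
      show "(\<Prod>i\<in>UNIV. ?w z (i, j)) \<le> (\<Sum>i\<in>UNIV. z i j)"
        using weighted_sum_bound[of "\<lambda>i. z i j" "\<lambda>i. p i j"] empty p cols by simp
      show "0 \<le> y i j" using empty[of i j] by simp
    qed auto
    also have "\<dots> = half_edge_sum {} (?u {} y) (?v {} z)" by (simp add: half_edge_sum_empty)
    finally show ?case .
  next
    case (insert x C)
    obtain k l where x: "x = (k, l)" by (cases x)
    let ?g = "\<lambda>y z. \<Prod>x\<in>UNIV - {(k, l)}. ?f C y z x"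
    have "0 \<le> ?f C y z x" for x
      by (cases x) (simp add: edge_factor_nonneg half_edge_factor_nonneg)
    then have "0 \<le> ?g y z" by (intro prod_nonneg) simp
    have "?g y z * edge_factor (A k l) (p k l)
      \<le> half_edge_sum (Set.insert (k, l) C) (set_entry (?u C y) k l (A k l)) (set_entry (?v C z) k l 1)"
    proof (rule half_edge_sum_insert_bound)
      show "(k, l) \<notin> C" using insert x by simp
      show "0 \<le> ?u C y i j" "0 \<le> ?v C z i j" for i j
        using A[of i j] insert.prems[of i j] by (auto intro: less_imp_le)
      show "0 \<le> ?g y z" by fact
      fix a b :: real assume ab: "0 < a" "0 < b"
      have "(\<Prod>x\<in>UNIV. ?f C (set_entry y k l a) (set_entry z k l b) x)
         \<le> half_edge_sum C (?u C (set_entry y k l a)) (?v C (set_entry z k l b))"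
        using insert.prems ab by (intro insert.IH) (auto simp: set_entry_def)
      also have "(\<Prod>x\<in>UNIV. ?f C (set_entry y k l a) (set_entry z k l b) x)
         = half_edge_factor (a * b) (p k l) * ?g (set_entry y k l a) (set_entry z k l b)"
        using insert.hyps x by (subst prod.remove[of _ "(k, l)"]) (auto simp: set_entry_def)
      also have "?g (set_entry y k l a) (set_entry z k l b) = ?g y z"
        by (intro prod.cong refl) (auto simp: set_entry_def split: if_splits)
      also have "?u C (set_entry y k l a) = set_entry (?u C y) k l a"
        using insert.hyps x by (auto simp: set_entry_def fun_eq_iff)
      also have "?v C (set_entry z k l b) = set_entry (?v C z) k l b"
        using insert.hyps x by (auto simp: set_entry_def fun_eq_iff)
      finally show "?g y z * half_edge_factor (a * b) (p k l)
         \<le> half_edge_sum C (set_entry (?u C y) k l a) (set_entry (?v C z) k l b)"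
        by (simp add: mult.commute)
    qed (use A p p1 in auto)
    also have "set_entry (?u C y) k l (A k l) = ?u (Set.insert (k, l) C) y"
      by (auto simp: set_entry_def fun_eq_iff)
    also have "set_entry (?v C z) k l 1 = ?v (Set.insert (k, l) C) z"
      by (auto simp: set_entry_def fun_eq_iff)
    also have "?g y z * edge_factor (A k l) (p k l) = (\<Prod>x\<in>UNIV. ?f (Set.insert (k, l) C) y z x)"
    proof -
      have "(\<Prod>x\<in>UNIV. ?f (Set.insert (k, l) C) y z x)
        = edge_factor (A k l) (p k l) * (\<Prod>x\<in>UNIV - {(k, l)}. ?f (Set.insert (k, l) C) y z x)"
        by (subst prod.remove[of _ "(k, l)"]) auto
      also have "(\<Prod>x\<in>UNIV - {(k, l)}. ?f (Set.insert (k, l) C) y z x) = ?g y z"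
        by (intro prod.cong refl) (auto split: if_splits)
      finally show ?thesis by simp
    qed
    finally show ?case unfolding x .
  qed
  from main[of "\<lambda>_ _. 1" "\<lambda>_ _. 1" UNIV] show ?thesis
    by (simp add: half_edge_sum_UNIV)
qed

section \<open>The Bethe permanent as a maximum over matrices\<close>

text \<open>The fractional perfect matching polytope in terms of matrices, that is, doubly stochastic matrices
with support in the support of \<open>A\<close>.\<close>

definition fractional_matchings :: "real ^ 'n ^ 'n \<Rightarrow> (real ^ 'n ^ 'n) set" where
  "fractional_matchings A = {Q. (\<forall>i j. 0 \<le> Q $ i $ j) \<and> (\<forall>i j. A $ i $ j = 0 \<longrightarrow> Q $ i $ j = 0)
     \<and> (\<forall>i. (\<Sum>j\<in>UNIV. Q $ i $ j) = 1) \<and> (\<forall>j. (\<Sum>i\<in>UNIV. Q $ i $ j) = 1)}"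

definition matrix_objective :: "real ^ 'n ^ 'n \<Rightarrow> real ^ 'n ^ 'n \<Rightarrow> real" where
  "matrix_objective A Q = (\<Prod>i\<in>UNIV. \<Prod>j\<in>UNIV. edge_factor (A $ i $ j) (Q $ i $ j))"

definition to_matrix :: "real ^ 'n ^ 'n \<Rightarrow> (('n + 'n) set \<Rightarrow> real) \<Rightarrow> real ^ 'n ^ 'n" where
  "to_matrix A p = (\<chi> i j. if A $ i $ j = 0 then 0 else p {Inl i, Inr j})"

lemma edges_support_graph: "edges (support_graph A) = (\<lambda>(i, j). {Inl i, Inr j}) ` {(i, j). A $ i $ j \<noteq> 0}"
  by (auto simp: support_graph_def)

lemma inj_edge: "inj_on (\<lambda>(i, j). {Inl i, Inr j}) X"
  by (auto simp: inj_on_def doubleton_eq_iff)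

lemma edge_entry_edge [simp]: "edge_entry A {Inl i, Inr j} = A $ i $ j"
  by (simp add: edge_entry_def)

lemma edges_at_row: "{e. e \<in> edges (support_graph A) \<and> Inl i \<in> e} = (\<lambda>j. {Inl i, Inr j}) ` {j. A $ i $ j \<noteq> 0}"
  by (auto simp: support_graph_def)

lemma edges_at_column: "{e. e \<in> edges (support_graph A) \<and> Inr j \<in> e} = (\<lambda>i. {Inl i, Inr j}) ` {i. A $ i $ j \<noteq> 0}"
  by (auto simp: support_graph_def)

lemma sum_at_row:
  "(\<Sum>e | e \<in> edges (support_graph A) \<and> Inl i \<in> e. p e) = (\<Sum>j\<in>UNIV. to_matrix A p $ i $ j)"
proof -
  have "(\<Sum>e | e \<in> edges (support_graph A) \<and> Inl i \<in> e. p e) = (\<Sum>j | A $ i $ j \<noteq> 0. p {Inl i, Inr j})"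
    unfolding edges_at_row by (subst sum.reindex) (auto simp: inj_on_def doubleton_eq_iff)
  also have "\<dots> = (\<Sum>j | A $ i $ j \<noteq> 0. to_matrix A p $ i $ j)"
    by (intro sum.cong) (auto simp: to_matrix_def)
  also have "\<dots> = (\<Sum>j\<in>UNIV. to_matrix A p $ i $ j)"
    by (intro sum.mono_neutral_left) (auto simp: to_matrix_def)
  finally show ?thesis .
qed

lemma sum_at_column:
  "(\<Sum>e | e \<in> edges (support_graph A) \<and> Inr j \<in> e. p e) = (\<Sum>i\<in>UNIV. to_matrix A p $ i $ j)"
proof -
  have "(\<Sum>e | e \<in> edges (support_graph A) \<and> Inr j \<in> e. p e) = (\<Sum>i | A $ i $ j \<noteq> 0. p {Inl i, Inr j})"
    unfolding edges_at_column by (subst sum.reindex) (auto simp: inj_on_def doubleton_eq_iff)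
  also have "\<dots> = (\<Sum>i | A $ i $ j \<noteq> 0. to_matrix A p $ i $ j)"
    by (intro sum.cong) (auto simp: to_matrix_def)
  also have "\<dots> = (\<Sum>i\<in>UNIV. to_matrix A p $ i $ j)"
    by (intro sum.mono_neutral_left) (auto simp: to_matrix_def)
  finally show ?thesis .
qed

lemma to_matrix_PM:
  assumes "p \<in> PM (support_graph A)"
  shows "to_matrix A p \<in> fractional_matchings A"
proof -
  have v: "verts (support_graph A) = UNIV" by (simp add: support_graph_def)
  have "0 \<le> p {Inl i, Inr j}" if "A $ i $ j \<noteq> 0" for i j
  proof -
    have "{Inl i, Inr j} \<in> edges (support_graph A)" using that by (auto simp: support_graph_def)
    then show ?thesis using assms by (auto simp: PM_def)
  qed
  then show ?thesis
    using assms sum_at_row[where A = A and p = p] sum_at_column[where A = A and p = p]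
    unfolding fractional_matchings_def PM_def v by (auto simp: to_matrix_def)
qed

lemma matrix_in_PM:
  assumes "Q \<in> fractional_matchings A"
  shows "\<exists>p\<in>PM (support_graph A). to_matrix A p = Q"
proof -
  define p where "p = restrict (edge_entry Q) (edges (support_graph A))"
  have m: "to_matrix A p = Q"
    using assms unfolding vec_eq_iff
    by (auto simp: to_matrix_def p_def edges_support_graph fractional_matchings_def)
  have "p \<in> PM (support_graph A)"
    unfolding PM_def
  proof (safe intro!: PiE_I)
    fix e assume "e \<in> edges (support_graph A)"
    then show "0 \<le> p e" using assms by (auto simp: p_def edges_support_graph fractional_matchings_def)
  next
    fix v show "(\<Sum>e | e \<in> edges (support_graph A) \<and> v \<in> e. p e) = 1"
      using assms by (cases v) (simp_all add: sum_at_row sum_at_column m fractional_matchings_def)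
  qed (auto simp: p_def)
  with m show ?thesis by blast
qed

lemma edge_factor_0 [simp]: "edge_factor a 0 = 1"
  by (simp add: edge_factor_def)

lemma bethe_objective_matrix:
  "bethe_objective A p = matrix_objective A (to_matrix A p)"
proof -
  have "bethe_objective A p = (\<Prod>(i, j) | A $ i $ j \<noteq> 0. edge_factor (A $ i $ j) (p {Inl i, Inr j}))"
    unfolding bethe_objective_def edges_support_graph
    by (subst prod.reindex[OF inj_edge]) (auto simp: edge_factor_def intro!: prod.cong)
  also have "\<dots> = (\<Prod>(i, j) | A $ i $ j \<noteq> 0. edge_factor (A $ i $ j) (to_matrix A p $ i $ j))"
    by (intro prod.cong) (auto simp: to_matrix_def)
  also have "\<dots> = (\<Prod>(i, j)\<in>UNIV \<times> UNIV. edge_factor (A $ i $ j) (to_matrix A p $ i $ j))"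
    by (intro prod.mono_neutral_left) (auto simp: to_matrix_def)
  also have "\<dots> = matrix_objective A (to_matrix A p)"
    unfolding matrix_objective_def by (rule prod.cartesian_product[symmetric])
  finally show ?thesis .
qed

lemma Bethe_matrix:
  "Bethe A = (if fractional_matchings A = {} then 0
     else GREATEST b. b \<in> matrix_objective A ` fractional_matchings A)"
proof -
  have "matrix_objective A ` fractional_matchings A = bethe_objective A ` PM (support_graph A)"
    using to_matrix_PM[where A = A] matrix_in_PM[where A = A] by (force simp: bethe_objective_matrix)
  moreover from this have "fractional_matchings A = {} \<longleftrightarrow> PM (support_graph A) = {}" by blast
  ultimately show ?thesis by (simp add: Bethe_def)
qed

lemma fractional_matching_le_1:
  assumes "Q \<in> fractional_matchings A"
  shows "Q $ i $ j \<le> 1"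
proof -
  have "Q $ i $ j \<le> (\<Sum>j\<in>UNIV. Q $ i $ j)"
    using assms by (intro member_le_sum) (auto simp: fractional_matchings_def)
  then show ?thesis using assms by (simp add: fractional_matchings_def)
qed

lemma edge_factor_exp:
  assumes "0 < a" "0 \<le> p" "p \<le> 1"
  shows "edge_factor a p = exp (p * ln a - xlx p + xlx (1 - p))"
  using assms
  by (auto simp: edge_factor_def powr_def ln_div xlx_def exp_add[symmetric] algebra_simps)

lemma continuous_on_xlx: "continuous_on {0..} xlx"
proof (rule continuous_on_eq_continuous_within[THEN iffD2], rule ballI)
  fix x :: real assume "x \<in> {0..}"
  then consider "x = 0" | "0 < x" by fastforce
  then show "continuous (at x within {0..}) xlx"
  proof cases
    case 1
    have "((\<lambda>x::real. x * ln x) \<longlongrightarrow> 0) (at_right 0)" by real_asymp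
    then have "(xlx \<longlongrightarrow> xlx 0) (at 0 within {0..})"
      unfolding at_within_Ici_at_right by (simp add: xlx_def[abs_def])
    then show ?thesis unfolding 1 continuous_within .
  next
    case 2
    then have "continuous (at x) (\<lambda>x. x * ln x)" by (intro continuous_intros) auto
    then show ?thesis unfolding xlx_def[abs_def] by (rule continuous_at_imp_continuous_within)
  qed
qed

lemma compact_fractional_matchings: "compact (fractional_matchings A)"
proof -
  have "closed (fractional_matchings A)"
  proof -
    have "fractional_matchings A = (\<Inter>i. \<Inter>j. {Q. 0 \<le> Q $ i $ j}) \<inter> (\<Inter>i. \<Inter>j. {Q. A $ i $ j = 0 \<longrightarrow> Q $ i $ j = 0})
        \<inter> (\<Inter>i. {Q. (\<Sum>j\<in>UNIV. Q $ i $ j) = 1}) \<inter> (\<Inter>j. {Q. (\<Sum>i\<in>UNIV. Q $ i $ j) = 1})"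
      by (auto simp: fractional_matchings_def)
    also have "closed \<dots>"
      by (intro closed_Int closed_INT ballI closed_Collect_le closed_Collect_eq closed_Collect_imp
          continuous_intros open_Collect_const)
    finally show ?thesis .
  qed
  moreover have "bounded (fractional_matchings A)"
  proof (rule boundedI)
    fix Q assume Q: "Q \<in> fractional_matchings A"
    have "norm Q \<le> (\<Sum>i\<in>UNIV. norm (Q $ i))" unfolding norm_vec_def by (rule L2_set_le_sum) simp
    also have "\<dots> \<le> (\<Sum>i\<in>(UNIV :: 'a set). \<Sum>j\<in>(UNIV :: 'a set). 1)"
    proof (rule sum_mono)
      fix i
      have "norm (Q $ i) \<le> (\<Sum>j\<in>UNIV. norm (Q $ i $ j))" unfolding norm_vec_def by (rule L2_set_le_sum) simp
      also have "\<dots> \<le> (\<Sum>j\<in>(UNIV :: 'a set). 1)"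
        using Q fractional_matching_le_1[OF Q] by (intro sum_mono) (auto simp: fractional_matchings_def)
      finally show "norm (Q $ i) \<le> (\<Sum>j\<in>(UNIV :: 'a set). 1)" .
    qed
    finally show "norm Q \<le> (\<Sum>i\<in>(UNIV :: 'a set). \<Sum>j\<in>(UNIV :: 'a set). 1)" .
  qed
  ultimately show ?thesis by (simp add: compact_eq_bounded_closed)
qed

lemma matrix_objective_exp:
  assumes A: "\<And>i j. 0 \<le> A $ i $ j" and Q: "Q \<in> fractional_matchings A"
  shows "matrix_objective A Q
    = exp (\<Sum>i\<in>UNIV. \<Sum>j\<in>UNIV. Q $ i $ j * ln (A $ i $ j) - xlx (Q $ i $ j) + xlx (1 - Q $ i $ j))"
proof -
  have "edge_factor (A $ i $ j) (Q $ i $ j) = exp (Q $ i $ j * ln (A $ i $ j) - xlx (Q $ i $ j) + xlx (1 - Q $ i $ j))" for i j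
  proof (cases "A $ i $ j = 0")
    case True
    then have "Q $ i $ j = 0" using Q by (auto simp: fractional_matchings_def)
    then show ?thesis by simp
  next
    case False
    then have "0 < A $ i $ j" using A[of i j] by simp
    then show ?thesis using fractional_matching_le_1[OF Q, of i j] Q
      by (intro edge_factor_exp) (auto simp: fractional_matchings_def)
  qed
  then show ?thesis unfolding matrix_objective_def by (simp add: exp_sum)
qed

lemma continuous_matrix_objective:
  assumes A: "\<And>i j. 0 \<le> A $ i $ j"
  shows "continuous_on (fractional_matchings A) (matrix_objective A)"
proof -
  let ?S = "fractional_matchings A"
  have "continuous_on ?S (\<lambda>Q. xlx (Q $ i $ j))" "continuous_on ?S (\<lambda>Q. xlx (1 - Q $ i $ j))" for i j
    by (rule continuous_on_compose2[OF continuous_on_xlx], intro continuous_intros,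
        auto simp: fractional_matchings_def fractional_matching_le_1[of _ A])+
  then have "continuous_on ?S (\<lambda>Q. exp (\<Sum>i\<in>UNIV. \<Sum>j\<in>UNIV. Q $ i $ j * ln (A $ i $ j) - xlx (Q $ i $ j) + xlx (1 - Q $ i $ j)))"
    by (intro continuous_intros)
  then show ?thesis
    by (rule continuous_on_eq) (simp add: matrix_objective_exp[OF A])
qed

text \<open>The polytope is compact and the objective is continuous on it, even where entries are \<open>0\<close> or \<open>1\<close>.\<close>

lemma Bethe_maximum:
  assumes A: "\<And>i j. 0 \<le> A $ i $ j" and ne: "fractional_matchings A \<noteq> {}"
  obtains Q where "Q \<in> fractional_matchings A" "Bethe A = matrix_objective A Q"
    "\<And>R. R \<in> fractional_matchings A \<Longrightarrow> matrix_objective A R \<le> Bethe A"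
proof -
  obtain Q where Q: "Q \<in> fractional_matchings A"
    "\<And>R. R \<in> fractional_matchings A \<Longrightarrow> matrix_objective A R \<le> matrix_objective A Q"
    using continuous_attains_sup[OF compact_fractional_matchings ne continuous_matrix_objective[OF A]] by blast
  have "Bethe A = matrix_objective A Q"
    unfolding Bethe_matrix using ne Q by (auto intro!: Greatest_equality)
  with Q show thesis by (intro that) auto
qed

lemma permanent_bij:
  fixes A :: "'a::comm_semiring_1 ^ 'n ^ 'n"
  shows "permanent A = (\<Sum>s | bij s. \<Prod>i\<in>UNIV. A $ i $ s i)"
proof -
  have "{s. s permutes (UNIV :: 'n set)} = {s. bij s}"
    by (auto simp: permutes_bij intro: bij_imp_permutes)
  then show ?thesis by (simp add: permanent_def)
qed

lemma Bethe_le_permanent: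
  assumes A: "\<And>i j. 0 \<le> A $ i $ j"
  shows "Bethe A \<le> permanent A"
proof (cases "fractional_matchings A = {}")
  case True
  then show ?thesis using A by (auto simp: Bethe_matrix permanent_def intro!: sum_nonneg prod_nonneg)
next
  case False
  then obtain Q where Q: "Q \<in> fractional_matchings A" "Bethe A = matrix_objective A Q"
    using Bethe_maximum[OF A] by metis
  have "matrix_objective A Q = (\<Prod>(i, j)\<in>UNIV. edge_factor (A $ i $ j) (Q $ i $ j))"
    unfolding matrix_objective_def UNIV_Times_UNIV[symmetric] by (rule prod.cartesian_product)
  also have "\<dots> \<le> permanent A"
    unfolding permanent_bij using Q A by (intro edge_factors_le_permanent) (auto simp: fractional_matchings_def)
  finally show ?thesis using Q by simp
qed

text \<open>For a positive permanent, \<open>excess\<close> of the random permutation is the logarithm of the permanent minus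
the logarithm of the objective at its marginals.\<close>

lemma permanent_le_Bethe:
  fixes A :: "real ^ 'n ^ 'n"
  assumes A: "\<And>i j. 0 \<le> A $ i $ j" and g: "4 \<le> g" "even g" and girth: "enat g \<le> girth (support_graph A)"
  shows "permanent A \<le> 2 powr (2 * real CARD('n) / real g) * Bethe A"
proof -
  have per0: "0 \<le> permanent A" using A by (auto simp: permanent_def intro!: sum_nonneg prod_nonneg)
  define P where "P = {s :: 'n \<Rightarrow> 'n. bij s \<and> (\<forall>i. A $ i $ s i \<noteq> 0)}"
  have per: "permanent A = (\<Sum>s\<in>P. \<Prod>i\<in>UNIV. A $ i $ s i)"
    unfolding permanent_bij P_def by (intro sum.mono_neutral_right) auto
  define mu where "mu s = (\<Prod>i\<in>UNIV. A $ i $ s i) / permanent A" for s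
  interpret weighted_perms mu
    by unfold_locales (use A per0 in \<open>auto simp: mu_def intro!: divide_nonneg_nonneg prod_nonneg\<close>)
  show ?thesis
  proof (cases "permanent A = 0")
    case True
    have "0 \<le> Bethe A"
    proof (cases "fractional_matchings A = {}")
      case True
      then show ?thesis by (simp add: Bethe_matrix)
    next
      case False
      then obtain Q where "Q \<in> fractional_matchings A" "Bethe A = matrix_objective A Q"
        using Bethe_maximum[OF A] by metis
      then show ?thesis by (simp add: matrix_objective_exp[OF A])
    qed
    then show ?thesis by (simp add: True)
  next
    case False
    with per0 have pos: "0 < permanent A" by simp
    have one: "mass P = 1"
      using pos by (simp add: mass_def mu_def sum_divide_distrib[symmetric] per[symmetric])
    define Q :: "real ^ 'n ^ 'n" where "Q = (\<chi> i j. marg P i j)"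
    have bij: "bij s" if "s \<in> P" for s using that by (simp add: P_def)
    have "marg P i j = 0" if "A $ i $ j = 0" for i j
    proof -
      have "section_at P i j = {}" using that by (auto simp: section_at_def P_def)
      then show ?thesis by (simp add: marg_def mass_def)
    qed
    then have Q: "Q \<in> fractional_matchings A"
      unfolding fractional_matchings_def using marg_row[of P] marg_column[OF bij] one
      by (simp add: Q_def marg_nonneg)
    let ?obj = "\<Sum>i\<in>UNIV. \<Sum>j\<in>UNIV. Q $ i $ j * ln (A $ i $ j) - xlx (Q $ i $ j) + xlx (1 - Q $ i $ j)"
    define m where "m = g div 2"
    have m: "g = 2 * m" "0 < m" using g by (auto simp: m_def)
    have "real m * excess P \<le> real CARD('n) * ln 2"
    proof (rule excess_bound[where E = "{(i, j). A $ i $ j \<noteq> 0}" and G = "support_graph A"])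
      show "\<not> girth (support_graph A) < enat (2 * m)" using girth m by (simp add: not_less)
      show "{Inl i, Inr j} \<in> edges (support_graph A)" if "(i, j) \<in> {(i, j). A $ i $ j \<noteq> 0}" for i j
        using that by (auto simp: support_graph_def)
    qed (use m one in \<open>auto simp: P_def support_graph_def\<close>)
    then have ex: "excess P \<le> real CARD('n) * ln 2 / real m"
      using m by (simp add: field_simps)
    have "Ent P = - (\<Sum>s\<in>P. mu s * ((\<Sum>i\<in>UNIV. ln (A $ i $ s i)) - ln (permanent A)))"
    proof -
      have "xlx (mu s) = mu s * ((\<Sum>i\<in>UNIV. ln (A $ i $ s i)) - ln (permanent A))" if "s \<in> P" for s
      proof -
        have "0 < A $ i $ s i" for i using that A[of i "s i"] by (simp add: P_def less_le)
        then have "A $ i $ s i \<noteq> 0" "0 < A $ i $ s i" for i by (auto simp: less_le)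
        then have "ln (mu s) = (\<Sum>i\<in>UNIV. ln (A $ i $ s i)) - ln (permanent A)"
          using pos prod_pos[of UNIV "\<lambda>i. A $ i $ s i"] ln_prod[of UNIV "\<lambda>i. A $ i $ s i"]
          unfolding mu_def by (subst ln_div) auto
        then show ?thesis by (simp add: xlx_def)
      qed
      then show ?thesis by (simp add: Ent_def one)
    qed
    also have "\<dots> = ln (permanent A) - (\<Sum>s\<in>P. \<Sum>i\<in>UNIV. mu s * ln (A $ i $ s i))"
    proof -
      have "(\<Sum>s\<in>P. mu s * ((\<Sum>i\<in>UNIV. ln (A $ i $ s i)) - ln (permanent A)))
        = (\<Sum>s\<in>P. \<Sum>i\<in>UNIV. mu s * ln (A $ i $ s i)) - mass P * ln (permanent A)"
        by (simp add: right_diff_distrib sum_subtractf sum_distrib_left sum_distrib_right mass_def)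
      then show ?thesis by (simp add: one)
    qed
    also have "(\<Sum>s\<in>P. \<Sum>i\<in>UNIV. mu s * ln (A $ i $ s i)) = (\<Sum>i\<in>UNIV. \<Sum>j\<in>UNIV. Q $ i $ j * ln (A $ i $ j))"
    proof -
      have "(\<Sum>s\<in>P. mu s * ln (A $ i $ s i)) = (\<Sum>j\<in>UNIV. Q $ i $ j * ln (A $ i $ j))" for i
      proof -
        have "(\<Sum>s\<in>P. mu s * ln (A $ i $ s i)) = (\<Sum>j\<in>UNIV. \<Sum>s\<in>section_at P i j. mu s * ln (A $ i $ s i))"
          by (rule sum_sections[symmetric])
        also have "\<dots> = (\<Sum>j\<in>UNIV. \<Sum>s\<in>section_at P i j. mu s * ln (A $ i $ j))"
          by (intro sum.cong) (auto simp: section_at_def)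
        finally show ?thesis by (simp add: Q_def marg_def mass_def sum_distrib_right)
      qed
      then show ?thesis by (subst sum.swap) simp
    qed
    finally have Ent: "Ent P = ln (permanent A) - (\<Sum>i\<in>UNIV. \<Sum>j\<in>UNIV. Q $ i $ j * ln (A $ i $ j))" .
    have HS: "Hrow P i - Srow P i = (\<Sum>j\<in>UNIV. - xlx (Q $ i $ j) + xlx (1 - Q $ i $ j))" for i
      by (simp add: Hrow_def Srow_def one Q_def ent_def xlx_def sum_subtractf[symmetric] del: sum_subtractf)
    have "excess P = ln (permanent A)
      - ?obj"
      unfolding excess_def Ent HS by (simp add: sum.distrib sum_subtractf sum_negf)
    with ex have "ln (permanent A) \<le> real CARD('n) * ln 2 / real m
      + ?obj" by linarith
    then have "exp (ln (permanent A)) \<le> exp (real CARD('n) * ln 2 / real m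
      + ?obj)"
      by (simp only: exp_le_cancel_iff)
    also have "\<dots> = exp (real CARD('n) * ln 2 / real m) * matrix_objective A Q"
      by (simp add: exp_add matrix_objective_exp[OF A Q])
    also have "exp (real CARD('n) * ln 2 / real m) = 2 powr (2 * real CARD('n) / real g)"
      using m by (simp add: powr_def)
    finally have "permanent A \<le> 2 powr (2 * real CARD('n) / real g) * matrix_objective A Q"
      using pos by simp
    also have "\<dots> \<le> 2 powr (2 * real CARD('n) / real g) * Bethe A"
    proof -
      have "matrix_objective A Q \<le> Bethe A" using Bethe_maximum[OF A] Q by (metis empty_iff)
      then show ?thesis by (intro mult_left_mono) auto
    qed
    finally show ?thesis .
  qed
qed

section \<open>Disjoint unions of cycles\<close>

lemma succ_mod: "k < g \<Longrightarrow> Suc k mod g = (if Suc k = g then 0 else Suc k)" by simp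

lemma pred_mod: "k < g \<Longrightarrow> (k + (g - 1)) mod g = (if k = 0 then g - 1 else k - 1)" for k g :: nat
proof (cases k)
  case (Suc l)
  moreover assume "k < g"
  ultimately have "k + (g - 1) = l + g" "l < g" by auto
  then show ?thesis using Suc by simp
qed auto

text \<open>A disjoint union of cycles. Fixing an orientation of each cycle gives a successor and a
predecessor of every vertex, and these are its only neighbours.\<close>

locale cycle_cover =
  fixes G :: "'v::finite sgraph" and C :: "'v list set" and g :: nat
  assumes g3: "3 \<le> g"
    and cycles: "\<And>c. c \<in> C \<Longrightarrow> is_cycle G c \<and> length c = g"
    and disj: "\<And>c d. c \<in> C \<Longrightarrow> d \<in> C \<Longrightarrow> c \<noteq> d \<Longrightarrow> set c \<inter> set d = {}"
    and cover: "(\<Union>c\<in>C. set c) = UNIV"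
    and edges: "edges G = (\<Union>c\<in>C. cycle_edges c)"
begin

definition cyc :: "'v \<Rightarrow> 'v list" where "cyc v = (SOME c. c \<in> C \<and> v \<in> set c)"
definition idx :: "'v \<Rightarrow> nat" where "idx v = (SOME k. k < g \<and> cyc v ! k = v)"
definition nxt :: "'v \<Rightarrow> 'v" where "nxt v = cyc v ! (Suc (idx v) mod g)"
definition prv :: "'v \<Rightarrow> 'v" where "prv v = cyc v ! ((idx v + (g - 1)) mod g)"

lemma cyc: "cyc v \<in> C" "v \<in> set (cyc v)"
proof -
  have "\<exists>c. c \<in> C \<and> v \<in> set c" using cover by auto
  then have "cyc v \<in> C \<and> v \<in> set (cyc v)" unfolding cyc_def by (rule someI_ex)
  then show "cyc v \<in> C" "v \<in> set (cyc v)" by auto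
qed

lemma idx: "idx v < g" "cyc v ! idx v = v"
proof -
  have "\<exists>k. k < g \<and> cyc v ! k = v" using cyc[of v] cycles[of "cyc v"] by (metis in_set_conv_nth)
  then have "idx v < g \<and> cyc v ! idx v = v" unfolding idx_def by (rule someI_ex)
  then show "idx v < g" "cyc v ! idx v = v" by auto
qed

lemma cyc_eq: "c \<in> C \<Longrightarrow> v \<in> set c \<Longrightarrow> cyc v = c"
  using disj[of c "cyc v"] cyc[of v] by auto

lemma cyc_nth:
  assumes "c \<in> C" "k < g"
  shows "cyc (c ! k) = c" "idx (c ! k) = k"
proof -
  have c: "length c = g" "distinct c" using cycles[OF assms(1)] by (auto simp: is_cycle_def)
  show e: "cyc (c ! k) = c" using assms c by (intro cyc_eq) auto
  show "idx (c ! k) = k" using idx[of "c ! k"] e c assms by (simp add: nth_eq_iff_index_eq)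
qed

lemma nxt_nth: "c \<in> C \<Longrightarrow> k < g \<Longrightarrow> nxt (c ! k) = c ! (Suc k mod g)"
  and prv_nth: "c \<in> C \<Longrightarrow> k < g \<Longrightarrow> prv (c ! k) = c ! ((k + (g - 1)) mod g)"
  by (simp_all add: nxt_def prv_def cyc_nth)

lemma cyc_nxt [simp]: "cyc (nxt v) = cyc v" and cyc_prv [simp]: "cyc (prv v) = cyc v"
  unfolding nxt_def prv_def using cyc g3 by (auto intro: cyc_nth)

lemma prv_nxt [simp]: "prv (nxt v) = v"
proof -
  have k: "Suc (idx v) mod g < g" using g3 by simp
  have "prv (nxt v) = cyc v ! ((Suc (idx v) mod g + (g - 1)) mod g)"
    unfolding nxt_def by (rule prv_nth[OF cyc(1) k])
  also have "(Suc (idx v) mod g + (g - 1)) mod g = idx v"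
    using idx(1)[of v] g3 by (auto simp: pred_mod[OF k] succ_mod)
  finally show ?thesis by (simp add: idx)
qed

lemma nxt_prv [simp]: "nxt (prv v) = v"
proof -
  have k: "(idx v + (g - 1)) mod g < g" using g3 by simp
  have "nxt (prv v) = cyc v ! (Suc ((idx v + (g - 1)) mod g) mod g)"
    unfolding prv_def by (rule nxt_nth[OF cyc(1) k])
  also have "Suc ((idx v + (g - 1)) mod g) mod g = idx v"
    using idx(1)[of v] g3 unfolding pred_mod[OF idx(1)] by auto
  finally show ?thesis by (simp add: idx)
qed

lemma nxt_neq_prv: "nxt v \<noteq> prv v"
proof
  assume "nxt v = prv v"
  moreover have "length (cyc v) = g" "distinct (cyc v)" using cycles[OF cyc(1)] by (auto simp: is_cycle_def)
  ultimately have "Suc (idx v) mod g = (idx v + (g - 1)) mod g"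
    using g3 by (simp add: nxt_def prv_def nth_eq_iff_index_eq)
  then show False using idx(1)[of v] g3 unfolding pred_mod[OF idx(1)] succ_mod[OF idx(1)]
    by (auto split: if_splits)
qed

lemma edge_iff: "{v, w} \<in> edges G \<longleftrightarrow> w = nxt v \<or> w = prv v"
proof
  assume "{v, w} \<in> edges G"
  then obtain c k where c: "c \<in> C" "k < g" "{v, w} = {c ! k, c ! (Suc k mod g)}"
    using cycles unfolding edges cycle_edges_def by fastforce
  then have "{v, w} = {c ! k, nxt (c ! k)}" by (simp add: nxt_nth)
  then show "w = nxt v \<or> w = prv v" by (auto simp: doubleton_eq_iff)
next
  have e: "{u, nxt u} \<in> edges G" for u
    unfolding edges cycle_edges_def nxt_def
    using cyc(1)[of u] idx[of u] cycles[OF cyc(1), of u] by (auto intro!: bexI[of _ "cyc u"] exI[of _ "idx u"])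
  assume "w = nxt v \<or> w = prv v"
  then show "{v, w} \<in> edges G" using e[of v] e[of w] by (auto simp: insert_commute)
qed

text \<open>All neighbours of a vertex of a cycle lie on the cycle, since there are only two of them. So any
cycle contains one of the given cycles.\<close>

lemma girth_ge: "enat g \<le> girth G"
  unfolding girth_def
proof (rule INF_greatest)
  fix c assume "c \<in> {c. is_cycle G c}"
  then have c: "3 \<le> length c" "distinct c" "cycle_edges c \<subseteq> edges G" by (auto simp: is_cycle_def)
  let ?n = "length c"
  have closed: "nxt v \<in> set c" if v: "v \<in> set c" for v
  proof -
    obtain k where k: "k < ?n" "c ! k = v" using v by (auto simp: in_set_conv_nth)
    define l where "l = (k + (?n - 1)) mod ?n"
    have l: "l < ?n" "Suc l mod ?n = k" "l \<noteq> Suc k mod ?n"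
      using k(1) c(1) unfolding l_def pred_mod[OF k(1)] by (auto split: if_splits simp: succ_mod)
    have "{c ! k, c ! (Suc k mod ?n)} \<in> cycle_edges c" "{c ! l, c ! (Suc l mod ?n)} \<in> cycle_edges c"
      unfolding cycle_edges_def using k l by blast+
    then have "{v, c ! (Suc k mod ?n)} \<in> edges G" "{v, c ! l} \<in> edges G"
      using c(3) k l by (auto simp: insert_commute)
    moreover have n: "Suc k mod ?n < ?n" using c(1) by (intro mod_less_divisor) linarith
    have "c ! (Suc k mod ?n) \<noteq> c ! l"
      using l(3) nth_eq_iff_index_eq[OF c(2) n l(1)] by simp
    moreover have "c ! l \<in> set c" "c ! (Suc k mod ?n) \<in> set c" using l(1) n by (simp_all only: nth_mem)
    ultimately show "nxt v \<in> set c" unfolding edge_iff by auto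
  qed
  obtain v where v: "v \<in> set c" using c(1) by (cases c) auto
  have "cyc v ! ((idx v + t) mod g) \<in> set c" for t
  proof (induction t)
    case 0
    then show ?case using v idx[of v] by simp
  next
    case (Suc t)
    have "(idx v + t) mod g < g" using g3 by simp
    from closed[OF Suc] nxt_nth[OF cyc(1) this] show ?case by (simp add: mod_Suc_eq)
  qed
  moreover have "\<exists>t. k = (idx v + t) mod g" if "k < g" for k
  proof -
    have "idx v + (k + (g - idx v)) = k + g" using idx(1)[of v] by simp
    then show ?thesis using that by (metis mod_add_self2 mod_less)
  qed
  ultimately have "set (cyc v) \<subseteq> set c"
    using cycles[OF cyc(1)[of v]] by (fastforce simp: in_set_conv_nth)
  then have "card (set (cyc v)) \<le> card (set c)" by (intro card_mono) auto
  then show "enat g \<le> enat (length c)"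
    using cycles[OF cyc(1)[of v]] c(2) by (simp add: distinct_card is_cycle_def)
qed

lemma finite_C: "finite C" and card_C: "card C * g = CARD('v)"
proof -
  have ne: "set c \<noteq> {}" if "c \<in> C" for c using cycles[OF that] g3 by auto
  have "inj_on set C"
  proof (rule inj_onI)
    fix c d assume "c \<in> C" "d \<in> C" "set c = set d"
    then show "c = d" using disj[of c d] ne[of c] by auto
  qed
  moreover have "finite (set ` C)" by (rule finite)
  ultimately show fin: "finite C" by (metis finite_imageD)
  have "card (\<Union>c\<in>C. set c) = (\<Sum>c\<in>C. card (set c))"
    using fin disj by (intro card_UN_disjoint) auto
  also have "\<dots> = (\<Sum>c\<in>C. g)"
    using cycles by (intro sum.cong refl) (auto simp: distinct_card is_cycle_def)
  finally show "card C * g = CARD('v)" by (simp add: cover)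
qed

end

context
  fixes A :: "real ^ 'n ^ 'n" and C g
  assumes A: "\<And>i j. A $ i $ j \<in> {0, 1}" and cov: "cycle_cover (support_graph A) C g"
begin

interpretation cycle_cover "support_graph A" C g by (rule cov)

lemma A_nonneg: "0 \<le> A $ i $ j" using A[of i j] by auto

lemma entry_iff: "A $ i $ j \<noteq> 0 \<longleftrightarrow> Inr j = nxt (Inl i) \<or> Inr j = prv (Inl i)"
  "A $ i $ j \<noteq> 0 \<longleftrightarrow> Inl i = nxt (Inr j) \<or> Inl i = prv (Inr j)"
proof -
  have "A $ i $ j \<noteq> 0 \<longleftrightarrow> {Inl i, Inr j} \<in> edges (support_graph A)"
    by (auto simp: support_graph_def doubleton_eq_iff)
  moreover have "{Inr j, Inl i} = {Inl i, Inr j}" by auto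
  ultimately show "A $ i $ j \<noteq> 0 \<longleftrightarrow> Inr j = nxt (Inl i) \<or> Inr j = prv (Inl i)"
    "A $ i $ j \<noteq> 0 \<longleftrightarrow> Inl i = nxt (Inr j) \<or> Inl i = prv (Inr j)"
    using edge_iff[of "Inl i" "Inr j"] edge_iff[of "Inr j" "Inl i"] by metis+
qed

lemma nxt_side: "isl (nxt v) \<longleftrightarrow> \<not> isl v" and prv_side: "isl (prv v) \<longleftrightarrow> \<not> isl v"
proof -
  have *: "isl w \<longleftrightarrow> \<not> isl v" if "{v, w} \<in> edges (support_graph A)" for v w
    using that by (auto simp: support_graph_def doubleton_eq_iff)
  show "isl (nxt v) \<longleftrightarrow> \<not> isl v" "isl (prv v) \<longleftrightarrow> \<not> isl v" by (intro * edge_iff[THEN iffD2]; simp)+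
qed

lemma row_support:
  obtains j k where "j \<noteq> k" "{j. A $ i $ j \<noteq> 0} = {j, k}"
proof -
  have "\<not> isl (nxt (Inl i))" "\<not> isl (prv (Inl i))" by (simp_all add: nxt_side prv_side)
  then obtain j k where jk: "nxt (Inl i) = Inr j" "prv (Inl i) = Inr k" by (metis sum.collapse(2))
  show thesis
    by (rule that[of j k]) (use nxt_neq_prv[of "Inl i"] in \<open>auto simp: entry_iff(1) jk\<close>)
qed

lemma column_support:
  obtains h i where "h \<noteq> i" "{i. A $ i $ j \<noteq> 0} = {h, i}"
proof -
  have "isl (nxt (Inr j))" "isl (prv (Inr j))" by (simp_all add: nxt_side prv_side)
  then obtain h i where hi: "nxt (Inr j) = Inl h" "prv (Inr j) = Inl i" by (metis sum.collapse(1))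
  show thesis
    by (rule that[of h i]) (use nxt_neq_prv[of "Inr j"] in \<open>auto simp: entry_iff(2) hi\<close>)
qed

text \<open>The two entries of a row are \<open>q\<close> and \<open>1 - q\<close>, and their factors are inverse to each other.\<close>

lemma objective_eq_1:
  assumes Q: "Q \<in> fractional_matchings A"
  shows "matrix_objective A Q = 1"
proof -
  let ?t = "\<lambda>i j. Q $ i $ j * ln (A $ i $ j) - xlx (Q $ i $ j) + xlx (1 - Q $ i $ j)"
  have "(\<Sum>j\<in>UNIV. ?t i j) = 0" for i
  proof -
    obtain j k where jk: "j \<noteq> k" "{j. A $ i $ j \<noteq> 0} = {j, k}" by (rule row_support)
    have off: "A $ i $ l = 0" "Q $ i $ l = 0" if "l \<notin> {j, k}" for l
    proof -
      show "A $ i $ l = 0" using jk that by auto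
      then show "Q $ i $ l = 0" using Q by (auto simp: fractional_matchings_def)
    qed
    have "A $ i $ j \<noteq> 0" "A $ i $ k \<noteq> 0" using jk(2) by auto
    then have one: "A $ i $ j = 1" "A $ i $ k = 1" using A by auto
    have "(\<Sum>l\<in>UNIV. Q $ i $ l) = (\<Sum>l\<in>{j, k}. Q $ i $ l)"
      using off by (intro sum.mono_neutral_right) auto
    then have s: "Q $ i $ j + Q $ i $ k = 1" using Q jk(1) by (simp add: fractional_matchings_def)
    have "(\<Sum>l\<in>UNIV. ?t i l) = (\<Sum>l\<in>{j, k}. ?t i l)"
      using off by (intro sum.mono_neutral_right) auto
    also have "\<dots> = ?t i j + ?t i k" using jk(1) by simp
    also have "\<dots> = 0"
    proof -
      have k: "Q $ i $ k = 1 - Q $ i $ j" using s by simp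
      show ?thesis unfolding k by (simp add: one)
    qed
    finally show ?thesis .
  qed
  then show ?thesis by (simp add: matrix_objective_exp[OF A_nonneg Q])
qed

lemma fractional_matchings_nonempty: "fractional_matchings A \<noteq> {}"
proof -
  \<comment> \<open>Every row and every column contains exactly two ones.\<close>
  define Q :: "real ^ 'n ^ 'n" where "Q = (\<chi> i j. A $ i $ j / 2)"
  have one: "A $ i $ j = 1" if "A $ i $ j \<noteq> 0" for i j using that A[of i j] by auto
  have "(\<Sum>j\<in>UNIV. A $ i $ j) = 2" for i
  proof -
    obtain j k where jk: "j \<noteq> k" "{j. A $ i $ j \<noteq> 0} = {j, k}" by (rule row_support)
    have "(\<Sum>j\<in>UNIV. A $ i $ j) = (\<Sum>j | A $ i $ j \<noteq> 0. 1)"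
      by (intro sum.mono_neutral_cong_right) (auto simp: one)
    then show ?thesis using jk by simp
  qed
  moreover have "(\<Sum>i\<in>UNIV. A $ i $ j) = 2" for j
  proof -
    obtain h i where hi: "h \<noteq> i" "{i. A $ i $ j \<noteq> 0} = {h, i}" by (rule column_support)
    have "(\<Sum>i\<in>UNIV. A $ i $ j) = (\<Sum>i | A $ i $ j \<noteq> 0. 1)"
      by (intro sum.mono_neutral_cong_right) (auto simp: one)
    then show ?thesis using hi by simp
  qed
  ultimately have "Q \<in> fractional_matchings A"
    using A_nonneg by (simp add: fractional_matchings_def Q_def sum_divide_distrib[symmetric])
  then show ?thesis by auto
qed

lemma Bethe_eq_1: "Bethe A = 1"
proof -
  obtain Q where "Q \<in> fractional_matchings A" "Bethe A = matrix_objective A Q"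
    by (rule Bethe_maximum[OF A_nonneg fractional_matchings_nonempty])
  then show ?thesis by (simp add: objective_eq_1)
qed

text \<open>Every set \<open>S\<close> of cycles gives a perfect matching, in which rows on a cycle of \<open>S\<close> choose their
successor and all other rows choose their predecessor.\<close>

lemma permanent_ge_choices: "2 ^ card C \<le> permanent A"
proof -
  define pick where "pick S v = (if cyc v \<in> S then nxt v else prv v)" for S v
  define s where "s S i = projr (pick S (Inl i))" for S and i :: 'n
  have pick: "Inr (s S i) = pick S (Inl i)" for S i
    using nxt_side[of "Inl i"] prv_side[of "Inl i"] unfolding s_def by (cases "pick S (Inl i)") (auto simp: pick_def split: if_splits)
  have cyc_pick: "cyc (pick S v) = cyc v" for S v by (simp add: pick_def)
  have inj: "inj (s S)" for S
  proof (rule injI)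
    fix i i' assume "s S i = s S i'"
    then have e: "pick S (Inl i) = pick S (Inl i')" using pick[of S i] pick[of S i'] by simp
    then have "cyc (Inl i) = cyc (Inl i')" using cyc_pick by metis
    with e have "nxt (Inl i) = nxt (Inl i') \<or> prv (Inl i) = prv (Inl i')" by (auto simp: pick_def split: if_splits)
    then have "Inl i = (Inl i' :: 'n + 'n)" by (metis prv_nxt nxt_prv)
    then show "i = i'" by simp
  qed
  have supp: "A $ i $ s S i = 1" for S i
  proof -
    have "A $ i $ s S i \<noteq> 0" unfolding entry_iff(1) pick by (simp add: pick_def)
    then show ?thesis using A[of i "s S i"] by auto
  qed
  have "inj_on s (Pow C)"
  proof (rule inj_onI)
    have sub: "c \<in> T" if "s S = s T" "S \<in> Pow C" "c \<in> S" for S T c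
    proof -
      have c: "c \<in> C" using that by auto
      have l: "0 < g" "c ! 0 \<in> set c" using g3 cycles[OF c] by (auto intro: nth_mem)
      obtain i where i: "cyc (Inl i) = c"
      proof (cases "c ! 0")
        case (Inl i)
        then show ?thesis using that[of i] cyc_eq[OF c] l by simp
      next
        case (Inr j)
        have "isl (nxt (Inr j))" by (simp add: nxt_side)
        then obtain i where "nxt (Inr j) = Inl i" by (metis sum.collapse(1))
        then show ?thesis using that[of i] cyc_nxt[of "Inr j"] cyc_eq[OF c l(2)] Inr by simp
      qed
      have "pick S (Inl i) = pick T (Inl i)" using pick[of S i] pick[of T i] that(1) by simp
      then show "c \<in> T" using nxt_neq_prv[of "Inl i"] \<open>c \<in> S\<close> by (auto simp: pick_def i split: if_splits)
    qed
    fix S T assume "S \<in> Pow C" "T \<in> Pow C" "s S = s T"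
    then show "S = T" using sub[of S T] sub[of T S] by auto
  qed
  then have "2 ^ card C = card (s ` Pow C)" by (simp add: card_image card_Pow finite_C)
  then have "2 ^ card C = real (card (s ` Pow C))" by (metis of_nat_numeral of_nat_power)
  also have "\<dots> = (\<Sum>f\<in>s ` Pow C. \<Prod>i\<in>UNIV. A $ i $ f i)"
  proof -
    have "(\<Prod>i\<in>UNIV. A $ i $ f i) = 1" if "f \<in> s ` Pow C" for f using that supp by auto
    then show ?thesis by simp
  qed
  also have "\<dots> \<le> (\<Sum>f | bij f. \<Prod>i\<in>UNIV. A $ i $ f i)"
  proof (rule sum_mono2)
    show "s ` Pow C \<subseteq> {f. bij f}" using inj by (auto simp: bij_def finite_UNIV_inj_surj)
    show "0 \<le> (\<Prod>i\<in>UNIV. A $ i $ f i)" for f by (intro prod_nonneg) (simp add: A_nonneg)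
  qed simp
  finally show ?thesis by (simp add: permanent_bij)
qed

lemma permanent_cycle_cover:
  assumes "4 \<le> g" "even g"
  shows "permanent A = 2 powr (2 * real CARD('n) / real g) * Bethe A"
proof (rule antisym)
  show "permanent A \<le> 2 powr (2 * real CARD('n) / real g) * Bethe A"
    by (intro permanent_le_Bethe A_nonneg assms girth_ge)
  have "card C * g = 2 * CARD('n)" using card_C by simp
  then have "2 * real CARD('n) / real g = real (card C)"
    using assms by (simp add: field_simps flip: of_nat_mult)
  then show "2 powr (2 * real CARD('n) / real g) * Bethe A \<le> permanent A"
    using permanent_ge_choices by (simp add: Bethe_eq_1 powr_realpow)
qed

end

theorem theorem1p3:
  fixes g :: nat
  assumes "g \<ge> 4" and "even g"
  shows "(\<forall>A :: real ^ 'n ^ 'n.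
            (\<forall>i j. A $ i $ j \<ge> 0) \<longrightarrow> girth (support_graph A) \<ge> enat g \<longrightarrow>
            Bethe A \<le> permanent A \<and>
            permanent A \<le> 2 powr (2 * real CARD('n) / real g) * Bethe A)
       \<and> (g dvd 2 * CARD('n) \<longrightarrow>
          (\<forall>A :: real ^ 'n ^ 'n.
            (\<forall>i j. A $ i $ j \<in> {0, 1}) \<longrightarrow>
            disjoint_union_of_cycles g (support_graph A) \<longrightarrow>
            permanent A = 2 powr (2 * real CARD('n) / real g) * Bethe A))"
proof (intro conjI allI impI)
  fix A :: "real ^ 'n ^ 'n"
  assume A: "\<forall>i j. A $ i $ j \<ge> 0" and girth: "girth (support_graph A) \<ge> enat g"
  show "Bethe A \<le> permanent A" using A by (intro Bethe_le_permanent) auto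
  show "permanent A \<le> 2 powr (2 * real CARD('n) / real g) * Bethe A"
    using A girth assms by (intro permanent_le_Bethe) auto
next
  fix A :: "real ^ 'n ^ 'n"
  assume A: "\<forall>i j. A $ i $ j \<in> {0, 1}" and C: "disjoint_union_of_cycles g (support_graph A)"
  from C obtain C where C: "\<forall>c\<in>C. is_cycle (support_graph A) c \<and> length c = g"
    "\<forall>c\<in>C. \<forall>d\<in>C. c \<noteq> d \<longrightarrow> set c \<inter> set d = {}"
    "verts (support_graph A) = (\<Union>c\<in>C. set c)" "edges (support_graph A) = (\<Union>c\<in>C. cycle_edges c)"
    unfolding disjoint_union_of_cycles_def by (elim exE conjE) (rule that)
  have "cycle_cover (support_graph A) C g"
    using C assms(1) by unfold_locales (auto simp: support_graph_def)
  then show "permanent A = 2 powr (2 * real CARD('n) / real g) * Bethe A"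
    using A assms by (intro permanent_cycle_cover) auto
qed

end
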